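(* Let $p > q$ be positive integers and let \[ R_{p,q} = \langle x, y, t \mid x^2 = y^2,\ t^{-1} x^{2q} t = x^{2p-1} y \rangle . \] Then $R_{p,q}$ is a one-relator group whose Dehn function is $\simeq n^{2\alpha}$, where $\alpha = \log_2(2p/q)$. In particular, $R_{p,q}$ has no subgroup isomorphic to a Baumslag--Solitar group $BS(m,n)$ with $m \neq \pm n$, but $R_{p,q}$ is not automatic and not CAT(0) (i.e. it does not act properly and cocompactly by isometries on a CAT(0) space).
   Context: The Baumslag--Solitar group is $BS(m,n) = \langle a, t \mid t^{-1} a^m t = a^n \rangle$. For functions $f,g:\mathbb{N}\to\mathbb{N}$, $f \preceq g$ means there is $C>0$ with $f(n) \le C g(Cn + C) + Cn + C$ for all $n$, and $f \simeq g$ means $f \preceq g$ and $g \preceq f$; Dehn functions of finitely presented groups are well defined up to $\simeq$. The presentation of $R_{p,q}$ is equivalent to the one-relator presentation $\langle x, t \mid x^2 (x^{-(2p-1)} t^{-1} x^{2q} t)^{-2} \rangle$. *)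

theory Defs
  imports Complex_Main "HOL-Algebra.Group"
begin

text \<open>A letter is a generator together with an exponent flag:
  (g, False) stands for g and (g, True) for g^-1.\<close>

type_synonym 'g letter = "'g \<times> bool"
type_synonym 'g word = "'g letter list"

definition inv_letter :: "'g letter \<Rightarrow> 'g letter" where
  "inv_letter l = (fst l, \<not> snd l)"

definition inv_word :: "'g word \<Rightarrow> 'g word" where
  "inv_word w = rev (map inv_letter w)"

definition words_over :: "'g set \<Rightarrow> 'g word set" where
  "words_over S = {w. \<forall>l\<in>set w. fst l \<in> S}"

definition gpow :: "'g \<Rightarrow> int \<Rightarrow> 'g word" where
  "gpow g k = replicate (nat \<bar>k\<bar>) (g, k < 0)"

inductive pres_step :: "'g set \<Rightarrow> 'g word set \<Rightarrow> 'g word \<Rightarrow> 'g word \<Rightarrow> bool"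
  for S R where
  free_ins: "g \<in> S \<Longrightarrow> pres_step S R (u @ v) (u @ [(g, b), (g, \<not> b)] @ v)"
| rel_ins: "r \<in> R \<Longrightarrow> pres_step S R (u @ v) (u @ r @ v)"

definition pres_eq :: "'g set \<Rightarrow> 'g word set \<Rightarrow> 'g word \<Rightarrow> 'g word \<Rightarrow> bool" where
  "pres_eq S R = (\<lambda>u v. pres_step S R u v \<or> pres_step S R v u)\<^sup>*\<^sup>*"

definition pres_rel :: "'g set \<Rightarrow> 'g word set \<Rightarrow> ('g word \<times> 'g word) set" where
  "pres_rel S R = {(u, v). u \<in> words_over S \<and> v \<in> words_over S \<and> pres_eq S R u v}"

definition presented_group :: "'g set \<Rightarrow> 'g word set \<Rightarrow> 'g word set monoid" where
  "presented_group S R =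
     \<lparr> carrier = words_over S // pres_rel S R,
       mult = (\<lambda>A B. {w \<in> words_over S. \<exists>a\<in>A. \<exists>b\<in>B. pres_eq S R w (a @ b)}),
       one = {w \<in> words_over S. pres_eq S R w []} \<rparr>"

definition area :: "'g set \<Rightarrow> 'g word set \<Rightarrow> 'g word \<Rightarrow> nat" where
  "area S R w = (LEAST N. \<exists>us rs. length us = N \<and> length rs = N \<and>
       set us \<subseteq> words_over S \<and> set rs \<subseteq> R \<union> inv_word ` R \<and>
       pres_eq S {} w (concat (map (\<lambda>(u, r). u @ r @ inv_word u) (zip us rs))))"

definition dehn_function :: "'g set \<Rightarrow> 'g word set \<Rightarrow> nat \<Rightarrow> nat" where
  "dehn_function S R n = Max {area S R w | w. w \<in> words_over S \<and> length w \<le> n \<and> pres_eq S R w []}"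

definition dehn_preceq :: "(nat \<Rightarrow> real) \<Rightarrow> (nat \<Rightarrow> real) \<Rightarrow> bool" where
  "dehn_preceq f g \<longleftrightarrow> (\<exists>C::nat. C > 0 \<and>
      (\<forall>n. f n \<le> real C * g (C * n + C) + real C * real n + real C))"

definition dehn_simeq :: "(nat \<Rightarrow> real) \<Rightarrow> (nat \<Rightarrow> real) \<Rightarrow> bool" where
  "dehn_simeq f g \<longleftrightarrow> dehn_preceq f g \<and> dehn_preceq g f"

text \<open>Baumslag--Solitar group: generators a = 0, t = 1; relator t^-1 a^m t a^-n.\<close>
definition BS_group :: "int \<Rightarrow> int \<Rightarrow> nat word set monoid" where
  "BS_group m n = presented_group {0, 1}
     {[(1, True)] @ gpow 0 m @ [(1, False)] @ inv_word (gpow 0 n)}"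

text \<open>R_{p,q}: generators x = 0, y = 1, t = 2; relators x^2 y^-2 and
  t^-1 x^{2q} t (x^{2p-1} y)^-1.\<close>
definition Rpq_rels :: "nat \<Rightarrow> nat \<Rightarrow> nat word set" where
  "Rpq_rels p q =
     {gpow 0 2 @ inv_word (gpow 1 2),
      [(2, True)] @ gpow 0 (2 * int q) @ [(2, False)] @ inv_word (gpow 0 (2 * int p - 1) @ [(1, False)])}"

definition Rpq :: "nat \<Rightarrow> nat \<Rightarrow> nat word set monoid" where
  "Rpq p q = presented_group {0, 1, 2} (Rpq_rels p q)"

definition one_relator_group :: "('c, 'd) monoid_scheme \<Rightarrow> bool" where
  "one_relator_group G \<longleftrightarrow>
     (\<exists>(S :: nat set) r. finite S \<and> r \<in> words_over S \<and> presented_group S {r} \<cong> G)"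

section \<open>Automatic groups (Epstein et al., Def. 2.3.1)\<close>

definition regular_lang :: "'c set \<Rightarrow> 'c list set \<Rightarrow> bool" where
  "regular_lang \<Sigma> L \<longleftrightarrow> finite \<Sigma> \<and> L \<subseteq> lists \<Sigma> \<and>
     (\<exists>(Q :: nat set) q0 \<delta> F. finite Q \<and> q0 \<in> Q \<and> F \<subseteq> Q \<and>
        (\<forall>q\<in>Q. \<forall>c\<in>\<Sigma>. \<delta> q c \<in> Q) \<and>
        L = {w \<in> lists \<Sigma>. foldl \<delta> q0 w \<in> F})"

definition pad :: "'c list \<Rightarrow> 'c list \<Rightarrow> ('c option \<times> 'c option) list" where
  "pad u v = (let k = max (length u) (length v) in
     zip (map Some u @ replicate (k - length u) None)
         (map Some v @ replicate (k - length v) None))"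

definition eval_word :: "('c, 'd) monoid_scheme \<Rightarrow> ('a \<Rightarrow> 'c) \<Rightarrow> 'a list \<Rightarrow> 'c" where
  "eval_word G \<mu> w = foldr (\<lambda>a g. \<mu> a \<otimes>\<^bsub>G\<^esub> g) w \<one>\<^bsub>G\<^esub>"

definition automatic_group :: "('c, 'd) monoid_scheme \<Rightarrow> bool" where
  "automatic_group G \<longleftrightarrow>
     (\<exists>(A :: nat set) \<mu> L. finite A \<and> \<mu> ` A \<subseteq> carrier G \<and>
        regular_lang A L \<and> eval_word G \<mu> ` L = carrier G \<and>
        (let PA = (insert None (Some ` A)) \<times> (insert None (Some ` A)) in
          regular_lang PA {pad u v | u v. u \<in> L \<and> v \<in> L \<and> eval_word G \<mu> u = eval_word G \<mu> v} \<and>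
          (\<forall>a\<in>A. regular_lang PA {pad u v | u v. u \<in> L \<and> v \<in> L \<and>
               eval_word G \<mu> u \<otimes>\<^bsub>G\<^esub> \<mu> a = eval_word G \<mu> v})))"

section \<open>CAT(0) spaces and geometric actions (Bridson--Haefliger)\<close>

definition geodesic_path :: "(real \<Rightarrow> 'a::metric_space) \<Rightarrow> 'a \<Rightarrow> 'a \<Rightarrow> bool" where
  "geodesic_path c x y \<longleftrightarrow> c 0 = x \<and> c (dist x y) = y \<and>
     (\<forall>s\<in>{0..dist x y}. \<forall>t\<in>{0..dist x y}. dist (c s) (c t) = \<bar>s - t\<bar>)"

text \<open>Point at distance s from P on the Euclidean segment [P,Q] of length d
  (the Euclidean plane is modelled by the complex numbers).\<close>
definition comp_point :: "complex \<Rightarrow> complex \<Rightarrow> real \<Rightarrow> real \<Rightarrow> complex" where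
  "comp_point P Q d s = P + of_real (s / d) * (Q - P)"

definition CAT0_space :: "'a::metric_space itself \<Rightarrow> bool" where
  "CAT0_space _ \<longleftrightarrow>
     (\<forall>x y :: 'a. \<exists>c. geodesic_path c x y) \<and>
     (\<forall>(p::'a) q r c1 c2 c3 (P::complex) Q R.
        geodesic_path c1 p q \<and> geodesic_path c2 q r \<and> geodesic_path c3 r p \<and>
        dist P Q = dist p q \<and> dist Q R = dist q r \<and> dist R P = dist r p \<longrightarrow>
        (let T = {(c1 s, comp_point P Q (dist p q) s) | s. s \<in> {0..dist p q}} \<union>
                 {(c2 s, comp_point Q R (dist q r) s) | s. s \<in> {0..dist q r}} \<union>
                 {(c3 s, comp_point R P (dist r p) s) | s. s \<in> {0..dist r p}}
         in \<forall>(x, x')\<in>T. \<forall>(y, y')\<in>T. dist x y \<le> dist x' y'))"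

definition isometric_action :: "('c, 'd) monoid_scheme \<Rightarrow> ('c \<Rightarrow> 'a::metric_space \<Rightarrow> 'a) \<Rightarrow> bool" where
  "isometric_action G \<phi> \<longleftrightarrow>
     \<phi> \<one>\<^bsub>G\<^esub> = id \<and>
     (\<forall>g\<in>carrier G. \<forall>h\<in>carrier G. \<phi> (g \<otimes>\<^bsub>G\<^esub> h) = \<phi> g \<circ> \<phi> h) \<and>
     (\<forall>g\<in>carrier G. \<forall>x y. dist (\<phi> g x) (\<phi> g y) = dist x y)"

definition proper_action :: "('c, 'd) monoid_scheme \<Rightarrow> ('c \<Rightarrow> 'a::metric_space \<Rightarrow> 'a) \<Rightarrow> bool" where
  "proper_action G \<phi> \<longleftrightarrow>
     (\<forall>x. \<exists>r>0. finite {g \<in> carrier G. \<phi> g ` {y. dist x y < r} \<inter> {y. dist x y < r} \<noteq> {}})"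

definition cocompact_action :: "('c, 'd) monoid_scheme \<Rightarrow> ('c \<Rightarrow> 'a::metric_space \<Rightarrow> 'a) \<Rightarrow> bool" where
  "cocompact_action G \<phi> \<longleftrightarrow> (\<exists>K. compact K \<and> (\<Union>g\<in>carrier G. \<phi> g ` K) = UNIV)"

end

theory Submission
  imports Defs "HOL-Analysis.Analysis" "HOL-Real_Asymp.Real_Asymp"
begin

text \<open>
  Put z = x^2, u = x^-1 y and c = x^(2p-1) y = z^p u. The group is an HNN extension of the Klein
  bottle group V = <x, u>, in which z is central and x inverts u, with t conjugating z^q to c. Since
  c and its conjugate by x multiply to z^(2p), the element z^(2pk) is a product of two conjugates of
  z^(qk), so that an element of V of word length n in R may have length of the order of
  n^\<alpha> in V, and no more.

  For the upper bound, Britton's lemma parses a word representing an element of V into letters,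
  products and conjugates by t. With \<alpha> >= 1 the function n^(2\<alpha>) is superadditive with a gap
  2 (m n)^\<alpha>, which pays for multiplying two elements of V in normal form. For the lower bound,
  area is bounded from below by a 2-cocycle, the signed area in the cosets of V, which on the commutator
  of two snowflake words for powers of z and u sees only the central rectangle, because the
  contributions of the snowflakes and of their inverses cancel.

  Automatic groups have at most quadratic Dehn functions, but 2\<alpha> > 2. For a proper cocompact action on
  a CAT(0) space, the distorted element x has translation length 0, and this infimum is attained
  by cocompactness and properness, so that x has a fixed point and hence finite order. Finally, if
  g^m and g^n are conjugate with |m| < |n|, the powers of g are exponentially distorted, whereas in R
  they are at most polynomially distorted.
\<close>


section \<open>Words and presentations\<close>

text \<open>The exponent has its origin in one doubling: two copies of a word for z^(qk) and
  boundedly many letters make a word for z^(2pk), so that doubling the length multiplies the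
  exponent by 2p/q, and log_2 of this factor is \<alpha>. That nothing grows faster holds because in
  a power of x the exponents of u cancel, so that the length is shared between the positive and the
  negative ones.

  The obstacle in the upper bound is that V has no normal form suited to all of its elements. Powers
  of c and of its conjugate by x are equally short, passing between the two forms costs the square
  of the exponent, and an odd power of x exchanges them. The induction therefore carries both forms
  and a quadratic correction term.

  No theory of HNN extensions or of diagrams is presupposed. A machine acting on stacks of coset
  representatives plays both roles: that it respects the relators gives the normal form theorem, its
  runs give the parse in Britton's lemma, and weights summed along its runs give the
  cocycle.\<close>

lemma words_over_Nil [simp]: "[] \<in> words_over S"
  and words_over_Cons [simp]: "l # w \<in> words_over S \<longleftrightarrow> fst l \<in> S \<and> w \<in> words_over S"
  and words_over_append [simp]: "u @ v \<in> words_over S \<longleftrightarrow> u \<in> words_over S \<and> v \<in> words_over S"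
  by (auto simp: words_over_def)

lemma words_over_concat [simp]: "concat ws \<in> words_over S \<longleftrightarrow> set ws \<subseteq> words_over S"
  by (induction ws) auto

lemma words_over_replicate [simp]: "replicate n l \<in> words_over S \<longleftrightarrow> n = 0 \<or> fst l \<in> S"
  by (auto simp: words_over_def)

lemma inv_word_Nil [simp]: "inv_word [] = []"
  and inv_word_append [simp]: "inv_word (u @ v) = inv_word v @ inv_word u"
  and inv_word_Cons: "inv_word (l # w) = inv_word w @ [(fst l, \<not> snd l)]"
  by (simp_all add: inv_word_def inv_letter_def)

lemma inv_word_single [simp]: "inv_word [(g, b)] = [(g, \<not> b)]"
  by (simp add: inv_word_Cons)

lemma inv_word_inv_word [simp]: "inv_word (inv_word w) = w"
  by (induction w) (auto simp: inv_word_Cons)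

lemma words_over_inv_word [simp]: "inv_word w \<in> words_over S \<longleftrightarrow> w \<in> words_over S"
  by (induction w) (auto simp: inv_word_Cons)

lemma length_inv_word [simp]: "length (inv_word w) = length w"
  by (simp add: inv_word_def)

lemma pres_eq_refl [simp, intro]: "pres_eq S R u u"
  by (simp add: pres_eq_def)

lemma pres_eq_sym: "pres_eq S R u v \<Longrightarrow> pres_eq S R v u"
  unfolding pres_eq_def
proof (induction rule: rtranclp_induct)
  case (step y z)
  then show ?case by (blast intro: converse_rtranclp_into_rtranclp)
qed simp

lemma pres_eq_trans [trans]: "pres_eq S R u v \<Longrightarrow> pres_eq S R v w \<Longrightarrow> pres_eq S R u w"
  unfolding pres_eq_def by (rule rtranclp_trans)

lemma pres_eq_step: "pres_step S R u v \<Longrightarrow> pres_eq S R u v"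
  by (auto simp: pres_eq_def)

lemma pres_step_context: "pres_step S R u v \<Longrightarrow> pres_step S R (a @ u @ b) (a @ v @ b)"
proof (induction rule: pres_step.induct)
  case (free_ins g u v c)
  from pres_step.free_ins[OF this, of R "a @ u" "v @ b" c] show ?case by simp
next
  case (rel_ins r u v)
  from pres_step.rel_ins[OF this, of S "a @ u" "v @ b"] show ?case by simp
qed

lemma pres_eq_context: "pres_eq S R u v \<Longrightarrow> pres_eq S R (a @ u @ b) (a @ v @ b)"
  unfolding pres_eq_def
proof (induction rule: rtranclp_induct)
  case (step y z)
  then show ?case using pres_step_context[of S R y z a b] pres_step_context[of S R z y a b]
    by (auto intro: rtranclp.rtrancl_into_rtrancl)
qed auto

lemma pres_eq_append:
  assumes "pres_eq S R u u'" "pres_eq S R v v'"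
  shows "pres_eq S R (u @ v) (u' @ v')"
  using pres_eq_trans[of S R "u @ v" "u' @ v" "u' @ v'"]
    pres_eq_context[OF assms(1), of "[]" v] pres_eq_context[OF assms(2), of u' "[]"] by simp

text \<open>Equality in the group is generated by single insertions and their inverses, so it is
  enough to check these. All invariants below are obtained in this way: the generators that occur,
  the state of the machine, the signed area and an affine action.\<close>

lemma pres_eq_invariant:
  assumes free: "\<And>g b u v. g \<in> S \<Longrightarrow> f (u @ [(g, b), (g, \<not> b)] @ v) = f (u @ v)"
    and rel: "\<And>r u v. r \<in> R \<Longrightarrow> f (u @ r @ v) = f (u @ v)"
    and "pres_eq S R w w'"
  shows "f w = f w'"
proof -
  have step: "f u = f v" if "pres_step S R u v" for u v
    using that by (induction rule: pres_step.induct) (simp_all only: free rel)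
  from assms(3) show ?thesis
    unfolding pres_eq_def by (induction rule: rtranclp_induct) (auto dest: step)
qed

lemma pres_eq_words_over:
  assumes "R \<subseteq> words_over S" "pres_eq S R w w'"
  shows "w \<in> words_over S \<longleftrightarrow> w' \<in> words_over S"
  by (rule pres_eq_invariant[OF _ _ assms(2)]) (use assms(1) in auto)

lemma pres_eq_mono:
  assumes "pres_eq S R u v" "R \<subseteq> R'"
  shows "pres_eq S R' u v"
proof -
  have "pres_step S R' a b" if "pres_step S R a b" for a b
    using that by (induction rule: pres_step.induct)
      (use assms(2) in \<open>auto intro: pres_step.free_ins pres_step.rel_ins simp del: append.simps\<close>)
  then show ?thesis using assms(1) unfolding pres_eq_def
    by (rule_tac rtranclp_mono[THEN predicate2D]) auto
qed

lemma pres_eq_free: "pres_eq S {} u v \<Longrightarrow> pres_eq S R u v"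
  by (rule pres_eq_mono) auto

lemma pres_eq_cancel_pair: "g \<in> S \<Longrightarrow> pres_eq S R [(g, b), (g, \<not> b)] []"
  using pres_step.free_ins[of g S R "[]" "[]" b] by (auto intro: pres_eq_sym pres_eq_step)

lemma pres_eq_relator: "r \<in> R \<Longrightarrow> pres_eq S R r []"
  using pres_step.rel_ins[of r R S "[]" "[]"] by (auto intro: pres_eq_sym pres_eq_step)

lemma pres_eq_inv_right: "w \<in> words_over S \<Longrightarrow> pres_eq S R (w @ inv_word w) []"
proof (induction w)
  case (Cons l w)
  have "pres_eq S R ([l] @ (w @ inv_word w) @ [(fst l, \<not> snd l)]) ([l] @ [] @ [(fst l, \<not> snd l)])"
    using Cons by (intro pres_eq_context) auto
  also have "pres_eq S R ([l] @ [] @ [(fst l, \<not> snd l)]) []"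
    using Cons pres_eq_cancel_pair[of "fst l" S R "snd l"] by simp
  finally show ?case by (simp add: inv_word_Cons)
qed auto

lemma pres_eq_inv_left: "w \<in> words_over S \<Longrightarrow> pres_eq S R (inv_word w @ w) []"
  using pres_eq_inv_right[of "inv_word w" S R] by simp

text \<open>The universal property of a presentation, on the level of words. The substitution acts
  on letters instead of generators, so that compatibility with inverses is the separate hypothesis
  \<open>free\<close>.\<close>

lemma pres_eq_substitute:
  assumes free: "\<And>g b. g \<in> S \<Longrightarrow> pres_eq S' R' (\<theta> (g, b) @ \<theta> (g, \<not> b)) []"
    and rel: "\<And>r. r \<in> R \<Longrightarrow> pres_eq S' R' (concat (map \<theta> r)) []"
    and "pres_eq S R w w'"
  shows "pres_eq S' R' (concat (map \<theta> w)) (concat (map \<theta> w'))"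
proof -
  have one: "pres_eq S' R' (concat (map \<theta> u)) (concat (map \<theta> v))" if "pres_step S R u v" for u v
    using that
  proof (induction rule: pres_step.induct)
    case (free_ins g u v b)
    from pres_eq_context[OF free[OF this], of "concat (map \<theta> u)" b "concat (map \<theta> v)"]
    show ?case by (auto dest: pres_eq_sym)
  next
    case (rel_ins r u v)
    from pres_eq_context[OF rel[OF this], of "concat (map \<theta> u)" "concat (map \<theta> v)"]
    show ?case by (auto dest: pres_eq_sym)
  qed
  from assms(3) show ?thesis
    unfolding pres_eq_def[of S R]
  proof (induction rule: rtranclp_induct)
    case (step y z)
    then have "pres_eq S' R' (concat (map \<theta> y)) (concat (map \<theta> z))"
      using one[of y z] one[of z y] pres_eq_sym by blast
    with step.IH show ?case by (rule pres_eq_trans)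
  qed simp
qed

lemma pres_eq_cancel_right:
  assumes "pres_eq S R (u @ w) (v @ w)" "w \<in> words_over S"
  shows "pres_eq S R u v"
proof -
  have "pres_eq S R (u @ []) (u @ w @ inv_word w)"
    using assms by (intro pres_eq_append pres_eq_refl pres_eq_sym[OF pres_eq_inv_right])
  also have "pres_eq S R (u @ w @ inv_word w) (v @ w @ inv_word w)"
    using pres_eq_append[OF assms(1) pres_eq_refl, of "inv_word w"] by simp
  also have "pres_eq S R (v @ w @ inv_word w) (v @ [])"
    using assms by (intro pres_eq_append pres_eq_refl pres_eq_inv_right)
  finally show ?thesis by simp
qed

lemma pres_eq_cancel_left:
  assumes "pres_eq S R (w @ u) (w @ v)" "w \<in> words_over S"
  shows "pres_eq S R u v"
proof -
  have *: "pres_eq S R (inv_word w @ w @ z) z" for z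
    using pres_eq_append[OF pres_eq_inv_left[OF assms(2)] pres_eq_refl, of R z] by simp
  have "pres_eq S R u (inv_word w @ w @ u)" by (rule pres_eq_sym[OF *])
  also have "pres_eq S R (inv_word w @ w @ u) (inv_word w @ w @ v)"
    by (intro pres_eq_append assms pres_eq_refl)
  also note *
  finally show ?thesis .
qed

lemma pres_eq_iff_inv:
  assumes "v \<in> words_over S"
  shows "pres_eq S R u v \<longleftrightarrow> pres_eq S R (u @ inv_word v) []"
proof
  assume "pres_eq S R u v"
  then have "pres_eq S R (u @ inv_word v) (v @ inv_word v)" by (auto intro: pres_eq_append)
  also have "pres_eq S R (v @ inv_word v) []" by (simp add: assms pres_eq_inv_right)
  finally show "pres_eq S R (u @ inv_word v) []" .
next
  assume *: "pres_eq S R (u @ inv_word v) []"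
  have "pres_eq S R (v @ inv_word v) []" by (simp add: assms pres_eq_inv_right)
  then have "pres_eq S R (u @ inv_word v) (v @ inv_word v)"
    using * pres_eq_trans pres_eq_sym by metis
  then show "pres_eq S R u v" by (rule pres_eq_cancel_right) (simp add: assms)
qed

lemma pres_eq_inv_word:
  assumes "pres_eq S R u v" "u \<in> words_over S" "v \<in> words_over S"
  shows "pres_eq S R (inv_word u) (inv_word v)"
proof -
  have "pres_eq S R (inv_word v @ u) (inv_word v @ v)"
    using assms by (intro pres_eq_append) auto
  also have "pres_eq S R (inv_word v @ v) []" using assms by (simp add: pres_eq_inv_left)
  finally have "pres_eq S R (inv_word v @ u) []" .
  then have "pres_eq S R (inv_word v) (inv_word u)"
    using pres_eq_iff_inv[of "inv_word u" S R "inv_word v"] assms by simp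
  then show ?thesis by (rule pres_eq_sym)
qed

section \<open>Presented groups as groups of classes of words\<close>

definition cls :: "'g set \<Rightarrow> 'g word set \<Rightarrow> 'g word \<Rightarrow> 'g word set" where
  "cls S R w = {v \<in> words_over S. pres_eq S R v w}"

lemma cls_eq_iff: "u \<in> words_over S \<Longrightarrow> cls S R u = cls S R v \<longleftrightarrow> pres_eq S R u v"
  unfolding cls_def using pres_eq_sym pres_eq_trans pres_eq_refl by (smt (verit) Collect_cong mem_Collect_eq)

lemma carrier_presented: "carrier (presented_group S R) = cls S R ` words_over S"
proof -
  have "pres_rel S R `` {w} = cls S R w" if "w \<in> words_over S" for w
    using that by (auto simp: pres_rel_def cls_def intro: pres_eq_sym)
  then show ?thesis by (force simp: presented_group_def quotient_def)
qed

lemma one_presented: "\<one>\<^bsub>presented_group S R\<^esub> = cls S R []"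
  by (simp add: presented_group_def cls_def)

lemma mult_presented:
  assumes "a \<in> words_over S" "b \<in> words_over S"
  shows "cls S R a \<otimes>\<^bsub>presented_group S R\<^esub> cls S R b = cls S R (a @ b)"
proof -
  have "pres_eq S R w (a @ b)" if "pres_eq S R w (a' @ b')" "pres_eq S R a' a" "pres_eq S R b' b" for w a' b'
    by (rule pres_eq_trans[OF that(1) pres_eq_append[OF that(2,3)]])
  then show ?thesis using assms unfolding presented_group_def cls_def by fastforce
qed

lemma group_presented: "group (presented_group S R)"
proof (rule groupI)
  fix x assume "x \<in> carrier (presented_group S R)"
  then obtain w where w: "w \<in> words_over S" "x = cls S R w" by (auto simp: carrier_presented)
  have "cls S R (inv_word w) \<otimes>\<^bsub>presented_group S R\<^esub> x = \<one>\<^bsub>presented_group S R\<^esub>"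
    using w by (simp add: mult_presented one_presented cls_eq_iff pres_eq_inv_left)
  then show "\<exists>y\<in>carrier (presented_group S R). y \<otimes>\<^bsub>presented_group S R\<^esub> x = \<one>\<^bsub>presented_group S R\<^esub>"
    using w by (auto simp: carrier_presented)
qed (auto simp: carrier_presented one_presented mult_presented)

lemma cls_in_carrier [simp]: "w \<in> words_over S \<Longrightarrow> cls S R w \<in> carrier (presented_group S R)"
  by (simp add: carrier_presented)

lemma inv_presented:
  assumes "w \<in> words_over S"
  shows "inv\<^bsub>presented_group S R\<^esub> (cls S R w) = cls S R (inv_word w)"
  using assms by (intro group.inv_equality[OF group_presented])
    (simp_all add: mult_presented one_presented cls_eq_iff pres_eq_inv_left)

section \<open>Integer powers of words\<close>

definition wpow :: "'g word \<Rightarrow> int \<Rightarrow> 'g word" where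
  "wpow w k = concat (replicate (nat \<bar>k\<bar>) (if k < 0 then inv_word w else w))"

lemma wpow_0 [simp]: "wpow w 0 = []" and wpow_1 [simp]: "wpow w 1 = w"
  and wpow_neg1 [simp]: "wpow w (-1) = inv_word w"
  by (simp_all add: wpow_def)

lemma gpow_eq_wpow: "gpow g k = wpow [(g, False)] k"
proof -
  have "concat (replicate n [l]) = replicate n l" for n and l :: "'a letter"
    by (induction n) auto
  then show ?thesis by (simp add: gpow_def wpow_def)
qed

lemma inv_word_concat_replicate: "inv_word (concat (replicate n w)) = concat (replicate n (inv_word w))"
proof (induction n)
  case (Suc n)
  have "concat (replicate n v) @ v = v @ concat (replicate n v)" for v :: "'a word"
    by (induction n) auto
  then show ?case by (simp add: Suc)
qed simp

lemma inv_word_wpow: "inv_word (wpow w k) = wpow w (- k)"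
  by (auto simp: wpow_def inv_word_concat_replicate)

lemma words_over_wpow [simp]: "w \<in> words_over S \<Longrightarrow> wpow w k \<in> words_over S"
  by (auto simp: wpow_def set_replicate_conv_if)

lemma length_wpow: "length (wpow w k) = nat \<bar>k\<bar> * length w"
  by (auto simp: wpow_def length_concat sum_list_replicate)

lemma wpow_Suc: "k \<ge> 0 \<Longrightarrow> wpow w (k + 1) = w @ wpow w k"
  by (simp add: wpow_def nat_add_distrib)

lemma concat_replicate_comm: "concat (replicate n v) @ v = v @ concat (replicate n v)"
  by (induction n) auto

lemma pres_eq_wpow_succ:
  assumes "w \<in> words_over S"
  shows "pres_eq S R (wpow w (k + 1)) (w @ wpow w k)"
proof (cases "k \<ge> 0")
  case False
  define n where "n = nat (- k - 1)"
  have k: "k = - int (Suc n)" using False by (simp add: n_def)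
  have "pres_eq S R ((w @ inv_word w) @ concat (replicate n (inv_word w)))
      ([] @ concat (replicate n (inv_word w)))"
    using assms by (intro pres_eq_append pres_eq_inv_right pres_eq_refl)
  then have "pres_eq S R (concat (replicate n (inv_word w))) (w @ concat (replicate (Suc n) (inv_word w)))"
    by (rule_tac pres_eq_sym) simp
  moreover have "wpow w (k + 1) = concat (replicate n (inv_word w))"
    using k by (auto simp: wpow_def)
  moreover have "nat \<bar>k\<bar> = Suc n" "k < 0" using k by auto
  then have "wpow w k = concat (replicate (Suc n) (inv_word w))" by (simp only: wpow_def if_True)
  ultimately show ?thesis by simp
qed (simp add: wpow_Suc)

lemma pres_eq_wpow_add:
  assumes "w \<in> words_over S"
  shows "pres_eq S R (wpow w (j + k)) (wpow w j @ wpow w k)"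
proof (induction j rule: int_induct[where k = 0])
  case (step1 i)
  have "pres_eq S R (wpow w (i + k + 1)) (w @ wpow w (i + k))"
    by (rule pres_eq_wpow_succ[OF assms])
  also have "pres_eq S R (w @ wpow w (i + k)) (w @ wpow w i @ wpow w k)"
    by (intro pres_eq_append step1 pres_eq_refl)
  also have "pres_eq S R ((w @ wpow w i) @ wpow w k) (wpow w (i + 1) @ wpow w k)"
    by (intro pres_eq_append pres_eq_sym[OF pres_eq_wpow_succ[OF assms]] pres_eq_refl)
  then have "pres_eq S R (w @ wpow w i @ wpow w k) (wpow w (i + 1) @ wpow w k)" by simp
  finally show ?case by (simp add: algebra_simps)
next
  case (step2 i)
  have "pres_eq S R (w @ wpow w (i - 1 + k)) (wpow w (i - 1 + k + 1))"
    by (rule pres_eq_sym[OF pres_eq_wpow_succ[OF assms]])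
  also have "wpow w (i - 1 + k + 1) = wpow w (i + k)" by (simp add: algebra_simps)
  also have "pres_eq S R (wpow w (i + k)) (wpow w i @ wpow w k)" by (rule step2)
  also have "pres_eq S R (wpow w i @ wpow w k) ((w @ wpow w (i - 1)) @ wpow w k)"
    using pres_eq_wpow_succ[OF assms, of R "i - 1"] by (intro pres_eq_append) auto
  finally have "pres_eq S R (w @ wpow w (i - 1 + k)) (w @ (wpow w (i - 1) @ wpow w k))" by simp
  then show ?case using assms by (rule pres_eq_cancel_left)
qed simp

lemma wpow_presented:
  fixes k :: int
  assumes "w \<in> words_over S"
  shows "cls S R w [^]\<^bsub>presented_group S R\<^esub> k = cls S R (wpow w k)"
proof -
  interpret group "presented_group S R" by (rule group_presented)
  have nat: "cls S R v [^]\<^bsub>presented_group S R\<^esub> n = cls S R (concat (replicate n v))"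
    if "v \<in> words_over S" for n :: nat and v
  proof (induction n)
    case (Suc n)
    then show ?case using that
      by (simp add: mult_presented set_replicate_conv_if concat_replicate_comm[symmetric])
  qed (simp add: one_presented)
  show ?thesis
  proof (cases "k < 0")
    case True
    then have "cls S R w [^]\<^bsub>presented_group S R\<^esub> k
        = inv\<^bsub>presented_group S R\<^esub> (cls S R w [^]\<^bsub>presented_group S R\<^esub> nat (- k))"
      by (subst int_pow_def2) simp
    also have "\<dots> = cls S R (concat (replicate (nat (- k)) (inv_word w)))"
      by (subst nat[OF assms], subst inv_presented)
        (use assms in \<open>auto simp: inv_word_concat_replicate set_replicate_conv_if\<close>)
    finally show ?thesis using True by (simp add: wpow_def)
  next
    case False
    then have "cls S R w [^]\<^bsub>presented_group S R\<^esub> k = cls S R w [^]\<^bsub>presented_group S R\<^esub> nat k"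
      by (subst int_pow_def2) simp
    then show ?thesis using False assms by (simp only: nat) (simp add: wpow_def)
  qed
qed

section \<open>Counting applications of relators\<close>

text \<open>The products of conjugates of relators that occur in \<open>area\<close>, built factor
  by factor, so that they can be concatenated, conjugated and inverted by induction while the number
  of factors is kept.\<close>

inductive relprod :: "'g set \<Rightarrow> 'g word set \<Rightarrow> nat \<Rightarrow> 'g word \<Rightarrow> bool" for S R where
  Nil: "relprod S R 0 []"
| Cons: "u \<in> words_over S \<Longrightarrow> r \<in> R \<union> inv_word ` R \<Longrightarrow> relprod S R n w \<Longrightarrow>
    relprod S R (Suc n) ((u @ r @ inv_word u) @ w)"

lemma relprod_iff:
  "relprod S R N w \<longleftrightarrow> (\<exists>us rs. length us = N \<and> length rs = N \<and>
     set us \<subseteq> words_over S \<and> set rs \<subseteq> R \<union> inv_word ` R \<and>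
     w = concat (map (\<lambda>(u, r). u @ r @ inv_word u) (zip us rs)))"
proof
  assume "relprod S R N w"
  then show "\<exists>us rs. length us = N \<and> length rs = N \<and> set us \<subseteq> words_over S \<and>
      set rs \<subseteq> R \<union> inv_word ` R \<and> w = concat (map (\<lambda>(u, r). u @ r @ inv_word u) (zip us rs))"
  proof induction
    case (Cons u r n w)
    then obtain us rs where "length us = n" "length rs = n" "set us \<subseteq> words_over S"
      "set rs \<subseteq> R \<union> inv_word ` R" "w = concat (map (\<lambda>(u, r). u @ r @ inv_word u) (zip us rs))"
      by blast
    then show ?case using Cons by (intro exI[of _ "u # us"] exI[of _ "r # rs"]) simp
  qed simp
next
  assume "\<exists>us rs. length us = N \<and> length rs = N \<and> set us \<subseteq> words_over S \<and>
      set rs \<subseteq> R \<union> inv_word ` R \<and> w = concat (map (\<lambda>(u, r). u @ r @ inv_word u) (zip us rs))"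
  then obtain us rs where "length us = N" "length rs = N" "set us \<subseteq> words_over S"
    "set rs \<subseteq> R \<union> inv_word ` R" "w = concat (map (\<lambda>(u, r). u @ r @ inv_word u) (zip us rs))"
    by blast
  then have "length us = length rs" "length rs = N" "set us \<subseteq> words_over S"
    "set rs \<subseteq> R \<union> inv_word ` R" "w = concat (map (\<lambda>(u, r). u @ r @ inv_word u) (zip us rs))"
    by auto
  then show "relprod S R N w"
  proof (induction us rs arbitrary: N w rule: list_induct2)
    case (Cons u us r rs)
    from Cons.prems have "relprod S R (length rs) (concat (map (\<lambda>(u, r). u @ r @ inv_word u) (zip us rs)))"
      by (intro Cons.IH) auto
    from relprod.Cons[OF _ _ this, of u r] Cons.prems show ?case by auto
  qed (simp add: relprod.Nil)
qed

lemma area_eq: "area S R w = (LEAST N. \<exists>P. relprod S R N P \<and> pres_eq S {} w P)"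
  unfolding area_def relprod_iff by (rule arg_cong[where f = Least]) blast

lemma relprod_append: "relprod S R m v \<Longrightarrow> relprod S R n w \<Longrightarrow> relprod S R (m + n) (v @ w)"
proof (induction rule: relprod.induct)
  case (Cons u r n' w')
  from relprod.Cons[OF Cons(1,2) Cons.IH[OF Cons.prems]] show ?case by simp
qed simp

lemma relprod_words_over:
  assumes "R \<subseteq> words_over S" "relprod S R n w"
  shows "w \<in> words_over S"
  using assms(2) by induction (use assms(1) in auto)

text \<open>Inserting \<open>inv_word a @ a\<close> between neighbouring factors moves a into each
  conjugator; the insertions are free, so the count n is unchanged.\<close>

lemma relprod_conj:
  assumes "relprod S R n w" "a \<in> words_over S"
  shows "\<exists>P. relprod S R n P \<and> pres_eq S {} (a @ w @ inv_word a) P"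
  using assms(1)
proof induction
  case Nil
  then show ?case using assms(2) by (intro exI[of _ "[]"]) (simp add: relprod.Nil pres_eq_inv_right)
next
  case (Cons u r n w)
  then obtain P where P: "relprod S R n P" "pres_eq S {} (a @ w @ inv_word a) P" by blast
  have "pres_eq S {} ((a @ u @ r @ inv_word u) @ [] @ (w @ inv_word a))
      ((a @ u @ r @ inv_word u) @ (inv_word a @ a) @ (w @ inv_word a))"
    using assms(2) by (intro pres_eq_context pres_eq_sym[OF pres_eq_inv_left])
  also have "pres_eq S {} (((a @ u) @ r @ inv_word (a @ u)) @ (a @ w @ inv_word a))
      (((a @ u) @ r @ inv_word (a @ u)) @ P)"
    by (intro pres_eq_append pres_eq_refl P(2))
  then have "pres_eq S {} ((a @ u @ r @ inv_word u) @ (inv_word a @ a) @ (w @ inv_word a))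
      (((a @ u) @ r @ inv_word (a @ u)) @ P)" by simp
  finally show ?case using relprod.Cons[of "a @ u" S r R n P] Cons(1,2) assms(2) P(1)
    by (intro exI[of _ "((a @ u) @ r @ inv_word (a @ u)) @ P"]) simp
qed

lemma relprod_inv: "relprod S R n w \<Longrightarrow> relprod S R n (inv_word w)"
proof (induction rule: relprod.induct)
  case (Cons u r n w)
  have "relprod S R 1 ((u @ inv_word r @ inv_word u) @ [])"
    using Cons(1,2) unfolding One_nat_def by (intro relprod.Cons relprod.Nil) force+
  from relprod_append[OF Cons.IH this] show ?case by simp
qed (simp add: relprod.Nil)

text \<open>The quotient of u and v is a product of N conjugates of relators. In this form areas are
  computed by equational rewriting: costs add under transitivity, while contexts and free equalities
  cost nothing. \<open>eqc\<close> relaxes N to a real bound, since the bounds below are real powers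
  of lengths.\<close>

definition eqn :: "'g set \<Rightarrow> 'g word set \<Rightarrow> nat \<Rightarrow> 'g word \<Rightarrow> 'g word \<Rightarrow> bool" where
  "eqn S R N u v \<longleftrightarrow> (\<exists>P. relprod S R N P \<and> pres_eq S {} u (P @ v))"

definition eqc :: "'g set \<Rightarrow> 'g word set \<Rightarrow> real \<Rightarrow> 'g word \<Rightarrow> 'g word \<Rightarrow> bool" where
  "eqc S R c u v \<longleftrightarrow> (\<exists>N. real N \<le> c \<and> eqn S R N u v)"

lemma eqn_free: "pres_eq S {} u v \<Longrightarrow> eqn S R 0 u v"
  unfolding eqn_def by (intro exI[of _ "[]"]) (simp add: relprod.Nil)

lemma eqn_trans:
  assumes "eqn S R m u v" "eqn S R n v w"
  shows "eqn S R (m + n) u w"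
proof -
  obtain P Q where P: "relprod S R m P" "pres_eq S {} u (P @ v)"
    and Q: "relprod S R n Q" "pres_eq S {} v (Q @ w)"
    using assms unfolding eqn_def by blast
  have "pres_eq S {} u (P @ Q @ w)"
    by (rule pres_eq_trans[OF P(2)]) (intro pres_eq_append pres_eq_refl Q(2))
  then show ?thesis unfolding eqn_def using relprod_append[OF P(1) Q(1)]
    by (intro exI[of _ "P @ Q"]) simp
qed

lemma eqn_context:
  assumes "eqn S R n u v" "a \<in> words_over S"
  shows "eqn S R n (a @ u @ b) (a @ v @ b)"
proof -
  obtain P where P: "relprod S R n P" "pres_eq S {} u (P @ v)"
    using assms unfolding eqn_def by blast
  obtain Q where Q: "relprod S R n Q" "pres_eq S {} (a @ P @ inv_word a) Q"
    using relprod_conj[OF P(1) assms(2)] by blast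
  have "pres_eq S {} (a @ u @ b) (a @ (P @ v) @ b)" by (intro pres_eq_context P)
  also have "pres_eq S {} ((a @ P) @ [] @ (v @ b)) ((a @ P) @ (inv_word a @ a) @ (v @ b))"
    by (intro pres_eq_context pres_eq_sym[OF pres_eq_inv_left] assms)
  then have "pres_eq S {} (a @ (P @ v) @ b) ((a @ P @ inv_word a) @ (a @ v @ b))" by simp
  also have "pres_eq S {} ((a @ P @ inv_word a) @ (a @ v @ b)) (Q @ (a @ v @ b))"
    by (intro pres_eq_append pres_eq_refl Q)
  finally show ?thesis unfolding eqn_def using Q by blast
qed

lemma eqn_sym:
  assumes "eqn S R n u v" "R \<subseteq> words_over S"
  shows "eqn S R n v u"
proof -
  obtain P where P: "relprod S R n P" "pres_eq S {} u (P @ v)"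
    using assms unfolding eqn_def by blast
  have "P \<in> words_over S" using relprod_words_over[OF assms(2) P(1)] .
  have "pres_eq S {} ((inv_word P @ P) @ v) ([] @ v)"
    by (intro pres_eq_append pres_eq_refl pres_eq_inv_left) fact
  then have "pres_eq S {} v (inv_word P @ (P @ v))" by (rule_tac pres_eq_sym) simp
  also have "pres_eq S {} (inv_word P @ (P @ v)) (inv_word P @ u)"
    by (intro pres_eq_append pres_eq_refl pres_eq_sym[OF P(2)])
  finally show ?thesis unfolding eqn_def using relprod_inv[OF P(1)] by blast
qed

lemma eqn_relator:
  assumes "r \<in> R"
  shows "eqn S R 1 r []"
  unfolding eqn_def using relprod.Cons[of "[]" S r R 0 "[]"] assms
  by (intro exI[of _ r]) (simp add: relprod.Nil)

lemma eqn_imp_pres_eq: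
  assumes "eqn S R n u v" "R \<subseteq> words_over S"
  shows "pres_eq S R u v"
proof -
  obtain P where P: "relprod S R n P" "pres_eq S {} u (P @ v)"
    using assms unfolding eqn_def by blast
  have "pres_eq S R P []" using P(1)
  proof induction
    case (Cons u r n w)
    have r: "pres_eq S R r []" using Cons(2)
    proof
      assume "r \<in> inv_word ` R"
      then obtain r' where r': "r = inv_word r'" "r' \<in> R" by blast
      have "pres_eq S R (inv_word r') (inv_word [])"
        using r' assms(2) by (intro pres_eq_inv_word pres_eq_relator) auto
      then show ?thesis using r' by simp
    qed (rule pres_eq_relator)
    have "pres_eq S R ((u @ r @ inv_word u) @ w) ((u @ [] @ inv_word u) @ [])"
      by (intro pres_eq_append pres_eq_context r Cons.IH)
    also have "pres_eq S R ((u @ [] @ inv_word u) @ []) []" using Cons(1) by (simp add: pres_eq_inv_right)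
    finally show ?case .
  qed simp
  from pres_eq_append[OF this pres_eq_refl, of v] show ?thesis
    using pres_eq_trans[OF pres_eq_free[OF P(2)]] by simp
qed

lemma pres_eq_imp_eqn:
  assumes "pres_eq S R u v" "u \<in> words_over S" "R \<subseteq> words_over S"
  shows "\<exists>n. eqn S R n u v"
proof -
  have one: "\<exists>n. eqn S R n a b" if "pres_step S R a b" "a \<in> words_over S" for a b
    using that
  proof (induction rule: pres_step.induct)
    case (free_ins g u v b)
    have "pres_eq S {} (u @ v) (u @ [(g, b), (g, \<not> b)] @ v)"
      by (intro pres_eq_step pres_step.free_ins free_ins)
    then show ?case using eqn_free by blast
  next
    case (rel_ins r u v)
    from eqn_context[OF eqn_relator[OF rel_ins(1)], of u S v] rel_ins(2)
    have "eqn S R 1 (u @ r @ v) (u @ v)" by simp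
    then show ?case using eqn_sym assms(3) by blast
  qed
  from assms(1) show ?thesis
    unfolding pres_eq_def
  proof (induction rule: rtranclp_induct)
    case base
    then show ?case using eqn_free[of S u u R] by blast
  next
    case (step y z)
    have y: "pres_eq S R u y" using step(1) by (simp add: pres_eq_def)
    then have y': "y \<in> words_over S" using pres_eq_words_over assms(2,3) by blast
    have "pres_eq S R y z" using step(2) by (auto simp: pres_eq_def)
    then have z': "z \<in> words_over S" using pres_eq_words_over assms(3) y' by blast
    from step(2) obtain m where "eqn S R m y z"
      using one[of y z] one[of z y] y' z' eqn_sym assms(3) by blast
    with step.IH show ?case using eqn_trans by blast
  qed
qed

lemma eqc_mono: "eqc S R c u v \<Longrightarrow> c \<le> d \<Longrightarrow> eqc S R d u v"
  unfolding eqc_def using order_trans by blast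

lemma eqc_nonneg: "eqc S R c u v \<Longrightarrow> 0 \<le> c"
  by (auto simp: eqc_def)

lemma eqc_free: "pres_eq S {} u v \<Longrightarrow> eqc S R 0 u v"
  unfolding eqc_def using eqn_free by (intro exI[of _ 0]) auto

lemma eqc_refl [simp]: "0 \<le> c \<Longrightarrow> eqc S R c u u"
  using eqc_mono[OF eqc_free[OF pres_eq_refl]] .

lemma eqc_trans:
  assumes "eqc S R c u v" "eqc S R d v w"
  shows "eqc S R (c + d) u w"
proof -
  obtain M N where "real M \<le> c" "real N \<le> d" "eqn S R M u v" "eqn S R N v w"
    using assms unfolding eqc_def by blast
  then show ?thesis unfolding eqc_def by (intro exI[of _ "M + N"]) (auto intro: eqn_trans)
qed

lemma eqc_free_trans: "pres_eq S {} u v \<Longrightarrow> eqc S R c v w \<Longrightarrow> eqc S R c u w"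
  using eqc_trans[OF eqc_free] by fastforce

lemma eqc_trans_free: "eqc S R c u v \<Longrightarrow> pres_eq S {} v w \<Longrightarrow> eqc S R c u w"
  using eqc_trans[OF _ eqc_free] by fastforce

lemma eqc_context: "eqc S R c u v \<Longrightarrow> a \<in> words_over S \<Longrightarrow> eqc S R c (a @ u @ b) (a @ v @ b)"
  unfolding eqc_def using eqn_context by blast

lemma eqc_append:
  assumes "eqc S R c u u'" "eqc S R d v v'" "u' \<in> words_over S"
  shows "eqc S R (c + d) (u @ v) (u' @ v')"
  using eqc_trans[of S R c "u @ v" "u' @ v" d "u' @ v'"]
    eqc_context[OF assms(1), of "[]" v] eqc_context[OF assms(2), of u' "[]"] assms(3)
  by simp

lemma eqc_sym: "eqc S R c u v \<Longrightarrow> R \<subseteq> words_over S \<Longrightarrow> eqc S R c v u"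
  unfolding eqc_def using eqn_sym by blast

lemma eqc_relator: "r \<in> R \<Longrightarrow> eqc S R 1 r []"
  unfolding eqc_def using eqn_relator by (intro exI[of _ 1]) auto

lemma eqc_imp_pres_eq: "eqc S R c u v \<Longrightarrow> R \<subseteq> words_over S \<Longrightarrow> pres_eq S R u v"
  unfolding eqc_def using eqn_imp_pres_eq by blast

lemma pres_eq_imp_eqc:
  "pres_eq S R u v \<Longrightarrow> u \<in> words_over S \<Longrightarrow> R \<subseteq> words_over S \<Longrightarrow> \<exists>c. eqc S R c u v"
  unfolding eqc_def using pres_eq_imp_eqn by (meson order_refl)

lemma eqc_cancel_left:
  assumes "eqc S R c (a @ u) (a @ v)" "a \<in> words_over S"
  shows "eqc S R c u v"
proof -
  have *: "pres_eq S {} (inv_word a @ a @ w) w" for w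
    using pres_eq_append[OF pres_eq_inv_left[OF assms(2)] pres_eq_refl, of "{}" w] by simp
  have "eqc S R c (inv_word a @ a @ u) (inv_word a @ a @ v)"
    using eqc_context[OF assms(1), of "inv_word a" "[]"] assms(2) by simp
  from eqc_free_trans[OF pres_eq_sym[OF *] eqc_trans_free[OF this *]] show ?thesis .
qed

lemma area_le: 
  assumes "eqc S R c w []"
  shows "real (area S R w) \<le> c"
proof -
  obtain N where N: "real N \<le> c" "eqn S R N w []" using assms by (auto simp: eqc_def)
  have "area S R w \<le> N" unfolding area_eq
    by (rule Least_le) (use N(2) in \<open>simp add: eqn_def\<close>)
  then show ?thesis using N by linarith
qed

lemma area_attained:
  assumes "pres_eq S R w []" "w \<in> words_over S" "R \<subseteq> words_over S"
  shows "\<exists>P. relprod S R (area S R w) P \<and> pres_eq S {} w P"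
proof -
  obtain n where "eqn S R n w []" using pres_eq_imp_eqn[OF assms] by blast
  then have "\<exists>P. relprod S R n P \<and> pres_eq S {} w P" by (simp add: eqn_def)
  then show ?thesis unfolding area_eq by (rule LeastI)
qed

lemma finite_words_over:
  assumes "finite S"
  shows "finite {w \<in> words_over S. length w \<le> n}"
proof -
  have "{w \<in> words_over S. length w \<le> n} \<subseteq> {w. set w \<subseteq> S \<times> UNIV \<and> length w \<le> n}"
    by (auto simp: words_over_def)
  then show ?thesis using finite_lists_length_le[of "S \<times> (UNIV :: bool set)" n] assms
    by (auto intro: finite_subset)
qed

text \<open>\<open>Max\<close> is meaningful here: there are finitely many words of bounded length
  over a finite alphabet, and the empty word keeps the set nonempty.\<close>

lemma dehn_function_le_iff:
  assumes "finite S"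
  shows "dehn_function S R n \<le> m \<longleftrightarrow>
    (\<forall>w. w \<in> words_over S \<and> length w \<le> n \<and> pres_eq S R w [] \<longrightarrow> area S R w \<le> m)"
proof -
  let ?A = "{w. w \<in> words_over S \<and> length w \<le> n \<and> pres_eq S R w []}"
  have "finite ?A" using finite_subset[OF _ finite_words_over[OF assms, of n], of ?A] by auto
  then have "finite (area S R ` ?A)" by simp
  moreover have "[] \<in> ?A" by simp
  then have "area S R ` ?A \<noteq> {}" by blast
  moreover have "{area S R w | w. w \<in> words_over S \<and> length w \<le> n \<and> pres_eq S R w []} = area S R ` ?A"
    by auto
  ultimately show ?thesis unfolding dehn_function_def
    using Max_le_iff[of "area S R ` ?A" m] by auto
qed

lemma dehn_function_ge:
  assumes "finite S" "w \<in> words_over S" "length w \<le> n" "pres_eq S R w []"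
  shows "area S R w \<le> dehn_function S R n"
  using dehn_function_le_iff[OF assms(1), of R n "dehn_function S R n"] assms by auto

section \<open>A stack machine for the HNN structure\<close>

text \<open>The sign in x^-i u x^i = u^(sg i).\<close>

definition sg :: "int \<Rightarrow> int" where
  "sg i = (if even i then 1 else -1)"

lemma sg_add: "sg (i + j) = sg i * sg j"
  and sg_diff: "sg (i - j) = sg i * sg j"
  and sg_uminus [simp]: "sg (- i) = sg i"
  and sg_mult_self [simp]: "sg i * sg i = 1"
  and sg_simps [simp]: "sg 0 = 1" "sg 1 = -1" "sg (-1) = -1" "sg 2 = 1" "sg (2 * j) = 1"
  and abs_sg [simp]: "\<bar>sg i\<bar> = 1" "\<bar>sg i * j\<bar> = \<bar>j\<bar>"
  by (auto simp: sg_def abs_mult)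

type_synonym vert = "int \<times> int"

text \<open>The pair (i, b) stands for x^i u^b with u = x^-1 y in the vertex group
  <x, y | x^2 = y^2>, in which x inverts u.\<close>

definition vm :: "vert \<Rightarrow> vert \<Rightarrow> vert" where
  "vm v w = (fst v + fst w, sg (fst w) * snd v + snd w)"

lemma vm_assoc: "vm (vm u v) w = vm u (vm v w)"
  by (simp add: vm_def sg_add algebra_simps)

lemma vm_0 [simp]: "vm (0, 0) v = v" "vm v (0, 0) = v"
  by (simp_all add: vm_def)

text \<open>The state (v, [(e_k, r_k), ..., (e_1, r_1)]) stands for the HNN normal form
  r_1 t^e_1 ... r_k t^e_k v, where the flag e encodes the sign as in a letter and r_i is a
  coset representative.\<close>

type_synonym state = "vert \<times> (bool \<times> vert) list"

text \<open>y is x u, and its inverse u^-1 x^-1 equals x^-1 u, whence the second component 1 in both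
  cases. The value at t is a dummy, as \<open>step\<close> treats t separately.\<close>

fun lval :: "nat letter \<Rightarrow> vert" where
  "lval (g, b) = (if g = 0 then (if b then (-1, 0) else (1, 0))
     else if g = 1 then (if b then (-1, 1) else (1, 1)) else (0, 0))"

lemma lval_inverse: "vm (lval (g, b)) (lval (g, \<not> b)) = (0, 0)"
  by (auto simp: vm_def)

locale rpq =
  fixes p q :: nat
  assumes q_pos: "0 < q" and q_less_p: "q < p"
begin

abbreviation "X \<equiv> {0, 1, 2 :: nat}"
abbreviation "RR \<equiv> Rpq_rels p q"

text \<open>The edge groups are generated by gp False 1 = x^(2q) and gp True 1 = x^(2p-1) y, and
  t^e conjugates the first to the second or back.\<close>

definition gp :: "bool \<Rightarrow> int \<Rightarrow> vert" where
  "gp e k = (if e then (2 * int p * k, k) else (2 * int q * k, 0))"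

text \<open>Left cosets modulo the edge group: v is \<open>rep e v\<close> times
  \<open>gp e (idx e v)\<close>. For c the representative is the power of x in the coset, for x^(2q)
  the exponent of x is reduced modulo 2q; the trivial coset is represented by (0, 0).\<close>

definition rep :: "bool \<Rightarrow> vert \<Rightarrow> vert" where
  "rep e v = (if e then (fst v - 2 * int p * snd v, 0) else (fst v mod (2 * int q), snd v))"

definition idx :: "bool \<Rightarrow> vert \<Rightarrow> int" where
  "idx e v = (if e then snd v else fst v div (2 * int q))"

lemma gp_0 [simp]: "gp e 0 = (0, 0)"
  by (simp add: gp_def)

lemma sg_even_mult [simp]: "sg (2 * i * j) = 1"
  by (simp add: mult.assoc)

lemma gp_add: "vm (gp e j) (gp e k) = gp e (j + k)"
  by (cases e) (simp_all add: gp_def vm_def distrib_left)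

lemma rep_idx: "vm (rep e v) (gp e (idx e v)) = v"
  by (cases v; cases e) (simp_all add: rep_def idx_def gp_def vm_def)

lemma rep_vm_gp [simp]: "rep e (vm v (gp e k)) = rep e v"
  and idx_vm_gp [simp]: "idx e (vm v (gp e k)) = idx e v + k"
proof -
  have "(i + 2 * int q * k) mod (2 * int q) = i mod (2 * int q)"
    "(i + 2 * int q * k) div (2 * int q) = i div (2 * int q) + k" for i
    using q_pos by (simp_all add: mult.commute)
  then show "rep e (vm v (gp e k)) = rep e v" "idx e (vm v (gp e k)) = idx e v + k"
    by (cases e; simp add: rep_def idx_def gp_def vm_def distrib_left)+
qed

lemma rep_gp [simp]: "rep e (gp e k) = (0, 0)" and idx_gp [simp]: "idx e (gp e k) = k"
  using rep_vm_gp[of e "(0, 0)" k] idx_vm_gp[of e "(0, 0)" k] by (simp_all add: rep_def idx_def)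

lemma rep_rep [simp]: "rep e (rep e v) = rep e v" and idx_rep [simp]: "idx e (rep e v) = 0"
  using q_pos by (simp_all add: rep_def idx_def)

lemma rep_eq_0_iff: "rep e v = (0, 0) \<longleftrightarrow> v = gp e (idx e v)"
  by (metis rep_gp rep_idx vm_0(1))

lemma rep_eq_0_iff': "rep e v = (0, 0) \<longleftrightarrow> (\<exists>k. v = gp e k)"
  using rep_eq_0_iff by (metis rep_gp)

definition poppable :: "bool \<Rightarrow> vert \<Rightarrow> (bool \<times> vert) list \<Rightarrow> bool" where
  "poppable e v S \<longleftrightarrow> S \<noteq> [] \<and> fst (hd S) = (\<not> e) \<and> rep e v = (0, 0)"

text \<open>Right multiplication of the normal form by t^e. The edge group part of v passes t^e and
  becomes an element of the other edge group; what stays behind is pushed together with t^e, or else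
  t^e cancels against the inverse letter on top of the stack.\<close>

definition tstep :: "bool \<Rightarrow> state \<Rightarrow> state" where
  "tstep e s = (if poppable e (fst s) (snd s)
     then (vm (snd (hd (snd s))) (gp (\<not> e) (idx e (fst s))), tl (snd s))
     else (gp (\<not> e) (idx e (fst s)), (e, rep e (fst s)) # snd s))"

definition step :: "state \<Rightarrow> nat letter \<Rightarrow> state" where
  "step s l = (if fst l = 2 then tstep (snd l) s else (vm (fst s) (lval l), snd s))"

definition run :: "state \<Rightarrow> nat word \<Rightarrow> state" where
  "run = foldl step"

lemma run_Nil [simp]: "run s [] = s" and run_Cons [simp]: "run s (l # w) = run (step s l) w"
  and run_append: "run s (v @ w) = run (run s v) w"
  by (simp_all add: run_def)

fun okst :: "(bool \<times> vert) list \<Rightarrow> bool" where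
  "okst [] \<longleftrightarrow> True"
| "okst ((e, r) # S) \<longleftrightarrow> rep e r = r \<and> \<not> poppable e r S \<and> okst S"

lemma poppable_rep: "poppable e (rep e v) S \<longleftrightarrow> poppable e v S"
  by (simp add: poppable_def)

lemma poppable_vm_gp [simp]: "poppable e (vm v (gp e k)) S \<longleftrightarrow> poppable e v S"
  by (simp add: poppable_def)

lemma okst_tstep: "okst (snd s) \<Longrightarrow> okst (snd (tstep e s))"
  by (cases s; cases "snd s") (auto simp: tstep_def poppable_rep)

lemma okst_step: "okst (snd s) \<Longrightarrow> okst (snd (step s l))"
  by (simp add: step_def okst_tstep)

lemma okst_run: "okst (snd s) \<Longrightarrow> okst (snd (run s w))"
  by (induction w arbitrary: s) (auto simp: okst_step)

text \<open>A pushed entry can be popped at once, because the new vertex lies in the edge group.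
  After a pop, the inverse letter has to push the same entry again: this is what \<open>okst\<close>
  guarantees, since its entries are their own coset representatives and are not poppable where they
  stand.\<close>

lemma tstep_inverse:
  assumes "okst (snd s)"
  shows "tstep (\<not> e) (tstep e s) = s"
proof (cases "poppable e (fst s) (snd s)")
  case True
  then obtain r S where S: "snd s = (\<not> e, r) # S"
    by (cases "snd s") (auto simp: poppable_def)
  have r: "rep (\<not> e) r = r" "\<not> poppable (\<not> e) r S" using assms S by auto
  then have "idx (\<not> e) r = 0" by (metis idx_rep)
  moreover have "gp e (idx e (fst s)) = fst s"
    using True rep_eq_0_iff[of e "fst s"] by (simp add: poppable_def)
  ultimately show ?thesis using True S r by (simp add: tstep_def prod_eq_iff)
next
  case False
  then have "poppable (\<not> e) (gp (\<not> e) (idx e (fst s))) ((e, rep e (fst s)) # snd s)"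
    by (simp add: poppable_def)
  then show ?thesis using False by (simp add: tstep_def rep_idx)
qed

lemma step_inverse: "okst (snd s) \<Longrightarrow> step (step s (g, b)) (g, \<not> b) = s"
  using tstep_inverse[of s b] lval_inverse[of g b]
  by (simp add: step_def vm_assoc del: lval.simps)

definition shift :: "state \<Rightarrow> vert \<Rightarrow> state" where
  "shift s v = (vm (fst s) v, snd s)"

lemma shift_shift: "shift (shift s v) w = shift s (vm v w)"
  by (simp add: shift_def vm_assoc)

lemma snd_shift [simp]: "snd (shift s v) = snd s"
  by (simp add: shift_def)

lemma shift_0 [simp]: "shift s (0, 0) = s"
  by (simp add: shift_def)

lemma tstep_shift: "tstep e (shift s (gp e k)) = shift (tstep e s) (gp (\<not> e) k)"
  by (simp add: tstep_def shift_def gp_add vm_assoc)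

lemma step_shift: "fst l \<noteq> 2 \<Longrightarrow> step s l = shift s (lval l)"
  by (simp add: step_def shift_def)

lemma run_replicate:
  assumes "fst l \<noteq> 2"
  shows "run s (replicate n l) = shift s (foldr vm (replicate n (lval l)) (0, 0))"
proof (induction n arbitrary: s)
  case (Suc n)
  then show ?case using assms by (simp add: step_shift shift_shift)
qed simp

lemma run_gpow_0: "run s (gpow 0 k) = shift s (k, 0)"
proof -
  have "foldr vm (replicate n (lval (0, b))) (0, 0) = ((if b then - int n else int n), 0)" for n b
    by (induction n) (auto simp: vm_def)
  then show ?thesis unfolding gpow_def by (subst run_replicate) auto
qed

lemma inv_gpow: "inv_word (gpow g k) = gpow g (- k)"
  by (simp add: gpow_eq_wpow inv_word_wpow)

definition cword :: "nat word" where
  "cword = gpow 0 (2 * int p - 1) @ [(1, False)]"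

definition trel :: "nat word" where
  "trel = [(2, True)] @ gpow 0 (2 * int q) @ [(2, False)] @ inv_word cword"

definition vrel :: "nat word" where
  "vrel = gpow 0 2 @ inv_word (gpow 1 2)"

lemma RR_eq: "RR = {vrel, trel}"
  by (simp add: Rpq_rels_def vrel_def trel_def cword_def)

lemma gpow_words_over [simp]: "g \<in> S \<Longrightarrow> gpow g k \<in> words_over S"
  by (simp add: gpow_def)

lemma cword_words_over [simp]: "cword \<in> words_over {0, Suc 0, 2}"
  by (simp add: cword_def)

lemma RR_words_over: "RR \<subseteq> words_over X"
  by (simp add: RR_eq vrel_def trel_def)

lemma run_cword: "run s cword = shift s (gp True 1)"
  by (simp add: cword_def run_append run_gpow_0 step_shift shift_shift vm_def gp_def)

lemma run_inv: 
  assumes "okst (snd s)"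
  shows "run (run s w) (inv_word w) = s"
  using assms
proof (induction w arbitrary: s)
  case (Cons l w)
  then show ?case
    using step_inverse[of s "fst l" "snd l"] by (simp add: inv_word_Cons run_append okst_step)
qed simp

lemma run_inv': 
  assumes "okst (snd s)" "run s' w = s" "okst (snd s')"
  shows "run s (inv_word w) = s'"
  using run_inv assms by blast

lemma vrel_eq: "vrel = [(0, False), (0, False), (1, True), (1, True)]"
  by (simp add: vrel_def gpow_def numeral_2_eq_2 inv_word_Cons)

lemma run_vrel: "run s vrel = s"
  by (simp add: vrel_eq step_shift shift_shift vm_def)

lemma run_trel:
  assumes "okst (snd s)"
  shows "run s trel = s"
proof -
  have "run s ([(2, True)] @ gpow 0 (2 * int q) @ [(2, False)])
      = tstep False (shift (tstep True s) (gp False 1))"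
    by (simp add: run_append run_gpow_0 step_def gp_def)
  also have "\<dots> = shift s (gp True 1)"
    using tstep_inverse[OF assms, of True] by (simp add: tstep_shift)
  also have "\<dots> = run s cword" by (simp add: run_cword)
  finally show ?thesis
    using run_inv[OF assms, of cword] unfolding trel_def
    by (metis append.assoc run_append)
qed

text \<open>The group acts from the right on the reduced states. This action takes the place of the
  normal form theorem: words that lead to different states are different in the group.\<close>

lemma run_pres_eq:
  assumes "pres_eq X RR w w'" "okst (snd s)"
  shows "run s w = run s w'"
proof (rule pres_eq_invariant[OF _ _ assms(1)])
  fix g b u v
  show "run s (u @ [(g, b), (g, \<not> b)] @ v) = run s (u @ v)"
    using step_inverse[OF okst_run[OF assms(2), of u], of g b] by (simp add: run_append)
next
  fix r u v assume "r \<in> RR"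
  then have "run (run s u) r = run s u"
    using run_trel[OF okst_run[OF assms(2)]] by (auto simp: RR_eq run_vrel)
  then show "run s (u @ r @ v) = run s (u @ v)" by (simp add: run_append)
qed

abbreviation "start \<equiv> (((0, 0), []) :: state)"

subsection \<open>Britton's lemma\<close>

inductive Der :: "nat word \<Rightarrow> vert \<Rightarrow> bool" where
  Nil: "Der [] (0, 0)"
| Letter: "g \<in> {0, 1} \<Longrightarrow> Der [(g, b)] (lval (g, b))"
| App: "Der v a \<Longrightarrow> Der w b \<Longrightarrow> Der (v @ w) (vm a b)"
| Conj: "Der w (gp e k) \<Longrightarrow> Der ((2, \<not> e) # w @ [(2, e)]) (gp (\<not> e) k)"

text \<open>A word parsed along its stack: each letter t^e that has not been cancelled is kept, with
  a parse tree of the piece read after it. The vertex of the state also contains the edge group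
  element that came across t^e when it was pushed.\<close>

inductive Conf :: "nat word \<Rightarrow> state \<Rightarrow> bool" where
  Base: "Der w v \<Longrightarrow> Conf w (v, [])"
| Push: "Conf w (v, S) \<Longrightarrow> Der w' v' \<Longrightarrow>
    Conf (w @ (2, e) # w') (vm (gp (\<not> e) (idx e v)) v', (e, rep e v) # S)"

lemma Conf_App: "Conf w s \<Longrightarrow> Der w' v' \<Longrightarrow> Conf (w @ w') (shift s v')"
proof (induction rule: Conf.induct)
  case (Base w v)
  then show ?case by (simp add: shift_def Conf.Base Der.App)
next
  case (Push w v S w1 v1 e)
  from Conf.Push[OF Push(1) Der.App[OF Push(2) Push.prems], of e]
  show ?case by (simp add: shift_def vm_assoc)
qed

lemma Conf_step:
  assumes "Conf w s" "fst l \<in> X"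
  shows "Conf (w @ [l]) (step s l)"
proof (cases "fst l = 2")
  case False
  then have "Der [l] (lval l)" using assms Der.Letter[of "fst l" "snd l"] by auto
  then show ?thesis using Conf_App[OF assms(1)] step_shift[OF False] by simp
next
  case True
  define e where "e = snd l"
  have l: "l = (2, e)" using True by (simp add: e_def prod_eq_iff)
  show ?thesis
  proof (cases "poppable e (fst s) (snd s)")
    case False
    then have "step s l = (vm (gp (\<not> e) (idx e (fst s))) (0, 0), (e, rep e (fst s)) # snd s)"
      by (simp add: l step_def tstep_def)
    then show ?thesis using Conf.Push[of w "fst s" "snd s" "[]" "(0, 0)" e] assms l
      by (simp add: Der.Nil)
  next
    case True
    from assms(1) show ?thesis
    proof cases
      case Base
      then show ?thesis using True by (simp add: poppable_def)
    next
      case (Push w1 v S w' v' e')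
      then have e': "e' = (\<not> e)" using True by (simp add: poppable_def)
      \<comment> \<open>The current vertex is \<open>gp e j\<close> times v', where
        \<open>gp e j\<close> came across the pending letter. As the product lies in the edge group,
        so does v' itself, and the pending letter, w' and the new letter form a
        \<open>Conj\<close>.\<close>
      define j where "j = idx e' v"
      have v': "rep e (vm (gp e j) v') = (0, 0)" using True Push e' by (simp add: poppable_def j_def)
      then obtain k where k: "vm (gp e j) v' = gp e k" unfolding rep_eq_0_iff' by blast
      then have "v' = gp e (k - j)"
        by (metis add.commute gp_0 gp_add uminus_add_conv_diff vm_0(1) vm_assoc add.right_inverse add.left_inverse)
      then have "Der ((2, \<not> e) # w' @ [(2, e)]) (gp (\<not> e) (k - j))" using Push Der.Conj by blast
      from Conf_App[OF Push(3) this]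
      have "Conf (w1 @ (2, \<not> e) # w' @ [(2, e)]) (vm v (gp (\<not> e) (k - j)), S)"
        by (simp add: shift_def)
      moreover have "vm (rep e' v) (gp e' k) = vm v (gp e' (k - j))"
      proof -
        have "gp e' k = vm (gp e' j) (gp e' (k - j))" by (simp add: gp_add)
        then show ?thesis by (metis j_def rep_idx vm_assoc)
      qed
      moreover have "step s l = (vm (rep e' v) (gp e' k), S)"
        using True Push k e' by (simp add: l step_def tstep_def j_def)
      ultimately show ?thesis using Push e' l by simp
    qed
  qed
qed

lemma Conf_run: "w \<in> words_over X \<Longrightarrow> Conf w (run start w)"
proof (induction w rule: rev_induct)
  case Nil
  then show ?case by (simp add: Conf.Base Der.Nil)
next
  case (snoc l w)
  then show ?case using Conf_step[of w "run start w" l] by (simp add: run_append)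
qed

lemma Der_complete:
  assumes "w \<in> words_over X" "run start w = (v, [])"
  shows "Der w v"
  using Conf_run[OF assms(1)] unfolding assms(2) by cases auto

lemma Der_words_over: "Der w v \<Longrightarrow> w \<in> words_over X"
  by (induction rule: Der.induct) auto

lemma Der_run: "Der w v \<Longrightarrow> okst (snd s) \<Longrightarrow> run s w = shift s v"
proof (induction arbitrary: s rule: Der.induct)
  case (Letter g b)
  then show ?case using step_shift[of "(g, b)" s] by auto
next
  case (App v a w b)
  then show ?case by (simp add: run_append shift_shift)
next
  case (Conj w e k)
  then show ?case using tstep_inverse[of s "\<not> e"]
    by (simp add: run_append step_def okst_tstep tstep_shift)
qed simp

end

section \<open>Distortion of the vertex group\<close>

text \<open>For 0 \<le> x \<le> a + b the quotient x / (a + b) lies in [0, 1], where raising to the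
  power s \<ge> 1 does not increase it; the resulting inequalities for a and b are added.\<close>

lemma powr_superadditive:
  fixes a b :: real
  assumes "0 \<le> a" "0 \<le> b" "1 \<le> s"
  shows "a powr s + b powr s \<le> (a + b) powr s"
proof (cases "a + b = 0")
  case False
  then have pos: "a + b > 0" using assms by simp
  have le: "x powr s \<le> x / (a + b) * (a + b) powr s" if "0 \<le> x" "x \<le> a + b" for x
  proof -
    have "(x / (a + b)) powr s \<le> (x / (a + b)) powr 1"
      using that pos assms(3) by (intro powr_mono') auto
    moreover have "x powr s = (x / (a + b)) powr s * (a + b) powr s"
      using that pos by (subst powr_mult[symmetric]) auto
    ultimately show ?thesis using that pos mult_right_mono[of "(x / (a + b)) powr s" "x / (a + b)" "(a + b) powr s"]
      by simp
  qed
  have "a powr s + b powr s \<le> a / (a + b) * (a + b) powr s + b / (a + b) * (a + b) powr s"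
    using le[of a] le[of b] assms by simp
  also have "\<dots> = (a + b) powr s"
    using pos by (simp flip: distrib_right add_divide_distrib)
  finally show ?thesis .
next
  case True
  then have "a = 0" "b = 0" using assms by linarith+
  then show ?thesis by simp
qed

context rpq
begin

definition al :: real where "al = log 2 (2 * real p / real q)"

lemma two_powr_al: "2 powr al = 2 * real p / real q"
  using q_pos q_less_p unfolding al_def by (subst powr_log_cancel) auto

lemma al_gt_1: "1 < al"
proof -
  have "log 2 2 < log 2 (2 * real p / real q)"
    using q_pos q_less_p by (subst log_less_cancel_iff) (auto simp: field_simps)
  then show ?thesis by (simp add: al_def)
qed

lemma al_superadd: "0 \<le> a \<Longrightarrow> 0 \<le> b \<Longrightarrow> a powr al + b powr al \<le> (a + b) powr al"
  using powr_superadditive al_gt_1 by simp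

text \<open>The equation defining al in the form that is needed: halving the length compensates the
  factor 2p/q exactly.\<close>

lemma half_powr_al: "0 \<le> n \<Longrightarrow> 2 * real p * (n / 2) powr al = real q * n powr al"
  using two_powr_al q_pos q_less_p by (simp add: powr_divide)

text \<open>A product that lies in the edge group of x has as many u's as u^-1's. Splitting its length
  as n1 + n2 accordingly, both contributions to fst v are bounded by the one of the shorter part,
  so that the factor p/q gained at the edges is compensated by 2 (n/2) powr al.\<close>

definition Bnd :: "real \<Rightarrow> vert \<Rightarrow> bool" where
  "Bnd n v \<longleftrightarrow> (\<exists>n0 n1 n2 b1 b2. 0 \<le> n0 \<and> 0 \<le> n1 \<and> 0 \<le> n2 \<and> 0 \<le> b1 \<and> 0 \<le> b2 \<and>
     n0 + n1 + n2 \<le> n \<and> real_of_int (snd v) = b1 - b2 \<and> b1 \<le> n1 powr al \<and> b2 \<le> n2 powr al \<and>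
     \<bar>real_of_int (fst v)\<bar> \<le> 2 * real p * (b1 + b2) + 2 * real q * n0 powr al)"

lemma BndI:
  assumes "0 \<le> n0" "0 \<le> n1" "0 \<le> n2" "0 \<le> b1" "0 \<le> b2"
    "n0 + n1 + n2 \<le> n" "real_of_int (snd v) = b1 - b2" "b1 \<le> n1 powr al" "b2 \<le> n2 powr al"
    "\<bar>real_of_int (fst v)\<bar> \<le> 2 * real p * (b1 + b2) + 2 * real q * n0 powr al"
  shows "Bnd n v"
  unfolding Bnd_def using assms by blast

lemma Bnd_nonneg: "Bnd n v \<Longrightarrow> 0 \<le> n"
  unfolding Bnd_def by force

lemma Bnd_snd:
  assumes "Bnd n v"
  shows "\<bar>real_of_int (snd v)\<bar> \<le> n powr al"
proof -
  obtain n0 n1 n2 b1 b2 where *: "0 \<le> n0" "0 \<le> n1" "0 \<le> n2" "0 \<le> b1" "0 \<le> b2"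
    "n0 + n1 + n2 \<le> n" "real_of_int (snd v) = b1 - b2" "b1 \<le> n1 powr al" "b2 \<le> n2 powr al"
    using assms unfolding Bnd_def by blast
  have "n1 powr al \<le> n powr al" "n2 powr al \<le> n powr al"
    using * al_gt_1 by (auto intro!: powr_mono2)
  then show ?thesis using * by linarith
qed

lemma Bnd_fst:
  assumes "Bnd n v"
  shows "\<bar>real_of_int (fst v)\<bar> \<le> 2 * real p * n powr al"
proof -
  obtain n0 n1 n2 b1 b2 where *: "0 \<le> n0" "0 \<le> n1" "0 \<le> n2" "0 \<le> b1" "0 \<le> b2"
    "n0 + n1 + n2 \<le> n" "b1 \<le> n1 powr al" "b2 \<le> n2 powr al"
    "\<bar>real_of_int (fst v)\<bar> \<le> 2 * real p * (b1 + b2) + 2 * real q * n0 powr al"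
    using assms unfolding Bnd_def by blast
  have "real q * n0 powr al \<le> real p * n0 powr al" using q_less_p by (intro mult_right_mono) auto
  moreover have "real p * (b1 + b2) \<le> real p * (n1 powr al + n2 powr al)"
    using * by (intro mult_left_mono) auto
  moreover have "n1 powr al + n2 powr al \<le> (n1 + n2) powr al" using * by (intro al_superadd)
  moreover have "(n1 + n2) powr al + n0 powr al \<le> (n1 + n2 + n0) powr al"
    using * by (intro al_superadd) auto
  moreover have "(n1 + n2 + n0) powr al \<le> n powr al" using * al_gt_1 by (intro powr_mono2) auto
  ultimately have "\<bar>real_of_int (fst v)\<bar> \<le> 2 * (real p * (n1 powr al + n2 powr al)) + 2 * (real p * n0 powr al)"
    using *(9) by (simp add: mult.assoc)
  also have "\<dots> = 2 * real p * (n1 powr al + n2 powr al + n0 powr al)" by (simp add: algebra_simps)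
  also have "\<dots> \<le> 2 * real p * n powr al"
    by (intro mult_left_mono) (use \<open>_ \<le> n powr al\<close> \<open>_ \<le> (n1 + n2 + n0) powr al\<close>
      \<open>_ \<le> (n1 + n2) powr al\<close> in auto)
  finally show ?thesis .
qed

lemma Bnd_fst_edge:
  assumes "Bnd n v" "snd v = 0"
  shows "\<bar>real_of_int (fst v)\<bar> \<le> 2 * real q * n powr al"
proof -
  obtain n0 n1 n2 b1 b2 where *: "0 \<le> n0" "0 \<le> n1" "0 \<le> n2" "0 \<le> b1" "0 \<le> b2"
    "n0 + n1 + n2 \<le> n" "real_of_int (snd v) = b1 - b2" "b1 \<le> n1 powr al" "b2 \<le> n2 powr al"
    "\<bar>real_of_int (fst v)\<bar> \<le> 2 * real p * (b1 + b2) + 2 * real q * n0 powr al"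
    using assms unfolding Bnd_def by blast
  have eq: "b1 = b2" using * assms(2) by simp
  have "min n1 n2 powr al \<le> ((n1 + n2) / 2) powr al"
    using * al_gt_1 by (intro powr_mono2) auto
  moreover have "b1 \<le> min n1 n2 powr al" using * eq by (auto simp: min_def)
  ultimately have "b1 \<le> ((n1 + n2) / 2) powr al" by simp
  then have "2 * real p * (b1 + b2) \<le> 2 * (2 * real p * ((n1 + n2) / 2) powr al)"
    using eq by (simp add: mult_left_mono)
  also have "\<dots> = 2 * real q * (n1 + n2) powr al" using half_powr_al[of "n1 + n2"] * by simp
  finally have "\<bar>real_of_int (fst v)\<bar> \<le> 2 * real q * ((n1 + n2) powr al + n0 powr al)"
    using *(10) by (simp add: distrib_left)
  also have "(n1 + n2) powr al + n0 powr al \<le> (n1 + n2 + n0) powr al"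
    using * by (intro al_superadd) auto
  also have "(n1 + n2 + n0) powr al \<le> n powr al" using * al_gt_1 by (intro powr_mono2) auto
  finally show ?thesis by (simp add: mult_left_mono)
qed

text \<open>If the exponent of x in w is odd, moving v past it inverts u, which exchanges the
  positive and the negative part of v. After this exchange the witnesses are added, by
  superadditivity.\<close>

lemma Bnd_vm:
  assumes "Bnd m v" "Bnd n w"
  shows "Bnd (m + n) (vm v w)"
proof -
  have "\<exists>m0 m1 m2 a1 a2. 0 \<le> m0 \<and> 0 \<le> m1 \<and> 0 \<le> m2 \<and> 0 \<le> a1 \<and> 0 \<le> a2 \<and>
    m0 + m1 + m2 \<le> m \<and> sg (fst w) * real_of_int (snd v) = a1 - a2 \<and> a1 \<le> m1 powr al \<and> a2 \<le> m2 powr al \<and>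
    \<bar>real_of_int (fst v)\<bar> \<le> 2 * real p * (a1 + a2) + 2 * real q * m0 powr al"
  proof -
    obtain n0 n1 n2 b1 b2 where *: "0 \<le> n0" "0 \<le> n1" "0 \<le> n2" "0 \<le> b1" "0 \<le> b2"
      "n0 + n1 + n2 \<le> m" "real_of_int (snd v) = b1 - b2" "b1 \<le> n1 powr al" "b2 \<le> n2 powr al"
      "\<bar>real_of_int (fst v)\<bar> \<le> 2 * real p * (b1 + b2) + 2 * real q * n0 powr al"
      using assms(1) unfolding Bnd_def by blast
    show ?thesis
    proof (cases "even (fst w)")
      case True
      show ?thesis by (rule exI[of _ n0], rule exI[of _ n1], rule exI[of _ n2], rule exI[of _ b1],
        rule exI[of _ b2]) (use * True in \<open>simp add: sg_def\<close>)
    next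
      case False
      show ?thesis by (rule exI[of _ n0], rule exI[of _ n2], rule exI[of _ n1], rule exI[of _ b2],
        rule exI[of _ b1]) (use * False in \<open>simp add: sg_def add.commute\<close>)
    qed
  qed
  then obtain m0 m1 m2 a1 a2 where a: "0 \<le> m0" "0 \<le> m1" "0 \<le> m2" "0 \<le> a1" "0 \<le> a2"
    "m0 + m1 + m2 \<le> m" "sg (fst w) * real_of_int (snd v) = a1 - a2" "a1 \<le> m1 powr al" "a2 \<le> m2 powr al"
    "\<bar>real_of_int (fst v)\<bar> \<le> 2 * real p * (a1 + a2) + 2 * real q * m0 powr al"
    by blast
  obtain n0 n1 n2 b1 b2 where b: "0 \<le> n0" "0 \<le> n1" "0 \<le> n2" "0 \<le> b1" "0 \<le> b2"
    "n0 + n1 + n2 \<le> n" "real_of_int (snd w) = b1 - b2" "b1 \<le> n1 powr al" "b2 \<le> n2 powr al"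
    "\<bar>real_of_int (fst w)\<bar> \<le> 2 * real p * (b1 + b2) + 2 * real q * n0 powr al"
    using assms(2) unfolding Bnd_def by blast
  show ?thesis
  proof (rule BndI[of "m0 + n0" "m1 + n1" "m2 + n2" "a1 + b1" "a2 + b2"])
    show "a1 + b1 \<le> (m1 + n1) powr al" using a b al_superadd[of m1 n1] by linarith
    show "a2 + b2 \<le> (m2 + n2) powr al" using a b al_superadd[of m2 n2] by linarith
    have "2 * real q * (m0 powr al + n0 powr al) \<le> 2 * real q * (m0 + n0) powr al"
      using a b by (intro mult_left_mono al_superadd) auto
    then show "\<bar>real_of_int (fst (vm v w))\<bar>
        \<le> 2 * real p * (a1 + b1 + (a2 + b2)) + 2 * real q * (m0 + n0) powr al"
      using a(10) b(10) by (simp add: vm_def distrib_left)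
  qed (use a b in \<open>auto simp: vm_def\<close>)
qed

lemma Bnd_gp:
  assumes "Bnd n (gp e k)"
  shows "\<bar>real_of_int k\<bar> \<le> n powr al"
proof (cases e)
  case True
  then show ?thesis using Bnd_snd[OF assms] by (simp add: gp_def)
next
  case False
  then have "2 * real q * \<bar>real_of_int k\<bar> \<le> 2 * real q * n powr al"
    using Bnd_fst_edge[OF assms] by (simp add: gp_def abs_mult)
  then show ?thesis using q_pos by simp
qed

text \<open>When an edge is crossed, the history of the element is forgotten: its whole length is
  booked on n0 for a power of x^(2q), and on n1 or n2, according to the sign of k, for a power of
  c.\<close>

lemma Bnd_gp_switch:
  assumes "Bnd m (gp e k)" "m \<le> n"
  shows "Bnd n (gp (\<not> e) k)"
proof -
  have m: "0 \<le> m" using Bnd_nonneg[OF assms(1)] .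
  have k: "\<bar>real_of_int k\<bar> \<le> m powr al" using Bnd_gp[OF assms(1)] .
  show ?thesis
  proof (cases e)
    case True
    have "2 * real q * \<bar>real_of_int k\<bar> \<le> 2 * real q * m powr al" using k by (intro mult_left_mono) auto
    then show ?thesis using True m assms(2)
      by (intro BndI[of m 0 0 0 0]) (auto simp: gp_def abs_mult)
  next
    case False
    show ?thesis
    proof (cases "k \<ge> 0")
      case True
      then show ?thesis using False m assms(2) k
        by (intro BndI[of 0 m 0 "real_of_int k" 0]) (auto simp: gp_def abs_mult)
    next
      case False
      then show ?thesis using \<open>\<not> e\<close> m assms(2) k
        by (intro BndI[of 0 0 m 0 "- real_of_int k"]) (auto simp: gp_def abs_mult)
    qed
  qed
qed

lemma Der_Bnd: "Der w v \<Longrightarrow> Bnd (real (length w)) v"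
proof (induction rule: Der.induct)
  case Nil
  then show ?case by (intro BndI[of 0 0 0 0 0]) auto
next
  case (Letter g b)
  then consider "g = 0" | "g = 1" by blast
  then show ?case
  proof cases
    case 1
    then show ?thesis using q_pos by (intro BndI[of 1 0 0 0 0]) auto
  next
    case 2
    then show ?thesis using q_less_p by (intro BndI[of 0 1 0 1 0]) auto
  qed
next
  case (App v a w b)
  then show ?case using Bnd_vm by simp
next
  case (Conj w e k)
  then show ?case using Bnd_gp_switch by simp
qed

end

section \<open>Cost calculus\<close>

lemma eqc_of_inv:
  assumes "eqc S R c (u @ inv_word v) []" "v \<in> words_over S"
  shows "eqc S R c u v"
proof -
  have "pres_eq S {} (u @ []) (u @ inv_word v @ v)"
    by (intro pres_eq_append pres_eq_refl pres_eq_sym[OF pres_eq_inv_left] assms)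
  then have "pres_eq S {} u ((u @ inv_word v) @ v)" by simp
  moreover have "eqc S R c ((u @ inv_word v) @ v) v"
    using eqc_context[OF assms(1), of "[]" v] by simp
  ultimately show ?thesis by (rule eqc_free_trans)
qed

lemma eqc_inv_word:
  assumes "eqc S R c u v" "u \<in> words_over S" "v \<in> words_over S" "R \<subseteq> words_over S"
  shows "eqc S R c (inv_word u) (inv_word v)"
proof -
  have "eqc S R c (inv_word v @ u @ inv_word u) (inv_word v @ v @ inv_word u)"
    using assms by (intro eqc_context) auto
  moreover have "pres_eq S {} ((inv_word v @ v) @ inv_word u) ([] @ inv_word u)"
    by (intro pres_eq_append pres_eq_inv_left assms pres_eq_refl)
  moreover have "pres_eq S {} (inv_word v @ u @ inv_word u) (inv_word v @ [])"
    by (intro pres_eq_append pres_eq_inv_right assms pres_eq_refl)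
  ultimately have "eqc S R c (inv_word v) (inv_word u)"
    by (metis append.assoc append.right_neutral append_Nil eqc_free_trans eqc_trans_free pres_eq_sym)
  then show ?thesis using assms(4) by (rule eqc_sym)
qed

lemma eqc_concat_replicate:
  assumes "eqc S R c u v" "v \<in> words_over S"
  shows "eqc S R (c * real n) (concat (replicate n u)) (concat (replicate n v))"
proof (induction n)
  case (Suc n)
  from eqc_append[OF assms(1) Suc assms(2)] show ?case by (simp add: algebra_simps)
qed simp

lemma eqc_wpow:
  assumes "eqc S R c u v" "u \<in> words_over S" "v \<in> words_over S" "R \<subseteq> words_over S"
  shows "eqc S R (c * \<bar>real_of_int k\<bar>) (wpow u k) (wpow v k)"
  using eqc_concat_replicate[OF assms(1,3), of "nat \<bar>k\<bar>"]
    eqc_concat_replicate[OF eqc_inv_word[OF assms], of "nat \<bar>k\<bar>"] assms(3)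
  by (auto simp: wpow_def)

lemma wpow_conj:
  assumes "a \<in> words_over S" "w \<in> words_over S"
  shows "pres_eq S R (wpow (a @ w @ inv_word a) k) (a @ wpow w k @ inv_word a)"
proof -
  have nat: "pres_eq S R (concat (replicate n (a @ v @ inv_word a))) (a @ concat (replicate n v) @ inv_word a)"
    for n v
  proof (induction n)
    case 0
    then show ?case using pres_eq_sym[OF pres_eq_inv_right[OF assms(1)]] by simp
  next
    case (Suc n)
    have "pres_eq S R ((a @ v @ inv_word a) @ concat (replicate n (a @ v @ inv_word a)))
        ((a @ v @ inv_word a) @ (a @ concat (replicate n v) @ inv_word a))"
      by (intro pres_eq_append pres_eq_refl Suc)
    moreover have "pres_eq S R ((a @ v) @ (inv_word a @ a) @ (concat (replicate n v) @ inv_word a))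
        ((a @ v) @ [] @ (concat (replicate n v) @ inv_word a))"
      by (intro pres_eq_context pres_eq_inv_left assms)
    ultimately show ?case by simp (rule pres_eq_trans)
  qed
  show ?thesis using nat[of "nat (- k)" "inv_word w"] nat[of "nat k" w] by (simp add: wpow_def)
qed

lemma eqc_conj_wpow:
  assumes "eqc S R c (a @ w @ inv_word a) v" "a \<in> words_over S" "w \<in> words_over S" "v \<in> words_over S"
    "R \<subseteq> words_over S"
  shows "eqc S R (c * \<bar>real_of_int k\<bar>) (a @ wpow w k @ inv_word a) (wpow v k)"
  using eqc_free_trans[OF pres_eq_sym[OF wpow_conj] eqc_wpow[OF assms(1)]] assms by simp

text \<open>Conjugation by b turns a into a' at cost c, hence the k-th power at |k| times this cost.
  Applied to a cost that is itself linear in another exponent, it yields the bilinear costs of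
  commuting powers.\<close>

lemma eqc_commute_wpow:
  assumes "eqc S R c (a @ b) (b @ a')" "a \<in> words_over S" "a' \<in> words_over S" "b \<in> words_over S"
    "R \<subseteq> words_over S"
  shows "eqc S R (c * \<bar>real_of_int k\<bar>) (wpow a k @ b) (b @ wpow a' k)"
proof -
  have "eqc S R c (inv_word b @ (a @ b)) (inv_word b @ (b @ a'))"
    using eqc_context[OF assms(1), of "inv_word b" "[]"] assms by simp
  moreover have "pres_eq S {} ((inv_word b @ b) @ a') ([] @ a')"
    by (intro pres_eq_append pres_eq_inv_left assms pres_eq_refl)
  ultimately have "eqc S R c (inv_word b @ a @ inv_word (inv_word b)) a'"
    by (simp add: eqc_trans_free)
  from eqc_conj_wpow[OF this] assms
  have "eqc S R (c * \<bar>real_of_int k\<bar>) (inv_word b @ wpow a k @ b) (wpow a' k)" by simp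
  then have "eqc S R (c * \<bar>real_of_int k\<bar>) (b @ (inv_word b @ wpow a k @ b) @ []) (b @ wpow a' k @ [])"
    using assms by (intro eqc_context) auto
  moreover have "pres_eq S {} ((b @ inv_word b) @ (wpow a k @ b)) ([] @ (wpow a k @ b))"
    by (intro pres_eq_append pres_eq_inv_right assms pres_eq_refl)
  ultimately show ?thesis by simp (rule eqc_free_trans[OF pres_eq_sym])
qed

lemma gpow_add: "g \<in> S \<Longrightarrow> pres_eq S R (gpow g j @ gpow g k) (gpow g (j + k))"
  unfolding gpow_eq_wpow by (rule pres_eq_sym, rule pres_eq_wpow_add) simp

lemma gpow_comm: "g \<in> S \<Longrightarrow> pres_eq S R (gpow g j @ gpow g k) (gpow g k @ gpow g j)"
  by (rule pres_eq_trans[OF gpow_add pres_eq_sym[OF gpow_add[of g S R k j, unfolded add.commute[of k j]]]])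

lemma gpow_0 [simp]: "gpow g 0 = []" and gpow_1 [simp]: "gpow g 1 = [(g, False)]"
  and gpow_neg1 [simp]: "gpow g (-1) = [(g, True)]"
  by (simp_all add: gpow_def)

lemma wpow_gpow: "g \<in> S \<Longrightarrow> pres_eq S R (wpow (gpow g j) k) (gpow g (j * k))"
proof (induction k rule: int_induct[where k = 0])
  case (step1 i)
  then have w: "gpow g j \<in> words_over S" by (simp add: gpow_def)
  have "pres_eq S R (wpow (gpow g j) (1 + i)) (gpow g j @ wpow (gpow g j) i)"
    using pres_eq_wpow_add[OF w, of R 1 i] by simp
  also have "pres_eq S R (gpow g j @ wpow (gpow g j) i) (gpow g j @ gpow g (j * i))"
    using step1 by (intro pres_eq_append) auto
  also have "pres_eq S R (gpow g j @ gpow g (j * i)) (gpow g (j + j * i))"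
    using step1 by (intro gpow_add)
  finally show ?case by (simp add: algebra_simps)
next
  case (step2 i)
  then have w: "gpow g j \<in> words_over S" by (simp add: gpow_def)
  have "pres_eq S R (wpow (gpow g j) (- 1 + i)) (gpow g (- j) @ wpow (gpow g j) i)"
    using pres_eq_wpow_add[OF w, of R "-1" i] by (simp add: gpow_eq_wpow inv_word_wpow)
  also have "pres_eq S R (gpow g (- j) @ wpow (gpow g j) i) (gpow g (- j) @ gpow g (j * i))"
    using step2 by (intro pres_eq_append) auto
  also have "pres_eq S R (gpow g (- j) @ gpow g (j * i)) (gpow g (- j + j * i))"
    using step2 by (intro gpow_add)
  finally show ?case by (simp add: algebra_simps)
qed simp

context rpq
begin

section \<open>The upper bound for the area\<close>

abbreviation eqx :: "real \<Rightarrow> nat word \<Rightarrow> nat word \<Rightarrow> bool" where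
  "eqx \<equiv> eqc X RR"

lemma RR_words_over' [simp]: "RR \<subseteq> words_over {0, Suc 0, 2}"
  using RR_words_over by simp

text \<open>cw True represents c = (2p, 1) and cw False its conjugate (2p, -1).\<close>

definition cw :: "bool \<Rightarrow> nat word" where
  "cw e = (if e then cword else [(0, True)] @ cword @ [(0, False)])"

lemma cw_words_over [simp]: "cw e \<in> words_over {0, Suc 0, 2}"
  by (simp add: cw_def)

lemma eqx_squares: "eqx 1 (gpow 0 2) (gpow 1 2)"
  using eqc_of_inv[OF eqc_relator[of vrel RR X, unfolded vrel_def]] by (simp add: RR_eq vrel_def)

lemma eqx_edge: "eqx \<bar>real_of_int k\<bar> ([(2, True)] @ gpow 0 (2 * int q * k) @ [(2, False)]) (wpow cword k)"
proof -
  have "eqx 1 ([(2, True)] @ gpow 0 (2 * int q) @ [(2, False)]) cword"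
    using eqc_of_inv[of X RR 1 "[(2, True)] @ gpow 0 (2 * int q) @ [(2, False)]" cword]
      eqc_relator[of trel RR X, unfolded trel_def] by (simp add: RR_eq trel_def)
  from eqc_conj_wpow[of X RR 1 "[(2, True)]", OF _ _ _ _ RR_words_over, of "gpow 0 (2 * int q)" cword k] this
  have "eqx \<bar>real_of_int k\<bar> ([(2, True)] @ wpow (gpow 0 (2 * int q)) k @ [(2, False)]) (wpow cword k)"
    by simp
  moreover have "pres_eq X {} ([(2, True)] @ wpow (gpow 0 (2 * int q)) k @ [(2, False)])
      ([(2, True)] @ gpow 0 (2 * int q * k) @ [(2, False)])"
    by (intro pres_eq_context wpow_gpow) simp
  ultimately show ?thesis using eqc_free_trans pres_eq_sym by blast
qed

lemma eqx_edge': "eqx \<bar>real_of_int k\<bar> ([(2, False)] @ wpow cword k @ [(2, True)]) (gpow 0 (2 * int q * k))"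
proof -
  let ?g = "gpow 0 (2 * int q * k) :: nat word"
  have "eqx \<bar>real_of_int k\<bar> ([(2, False)] @ ([(2, True)] @ ?g @ [(2, False)]) @ [(2, True)])
      ([(2, False)] @ wpow cword k @ [(2, True)])"
    using eqx_edge by (intro eqc_context) auto
  then have "eqx \<bar>real_of_int k\<bar> ([(2, False)] @ wpow cword k @ [(2, True)])
      ([(2, False), (2, True)] @ ?g @ [(2, False), (2, True)])"
    using eqc_sym[OF _ RR_words_over] by fastforce
  moreover have "pres_eq X {} ([(2, False), (2, True)] @ ?g @ [(2, False), (2, True)]) ([] @ ?g @ [])"
    using pres_eq_cancel_pair[of 2 X "{}" False] by (intro pres_eq_append pres_eq_refl) auto
  ultimately show ?thesis using eqc_trans_free by fastforce
qed

text \<open>x^2 is replaced by y^2, which commutes freely with y, and restored: one application of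
  the square relator in each direction.\<close>

lemma eqx_y_x2: "eqx 2 ([(1, b)] @ gpow 0 2) (gpow 0 2 @ [(1, b)])"
proof -
  have "eqx 1 ([(1, b)] @ gpow 0 2 @ []) ([(1, b)] @ gpow 1 2 @ [])"
    by (intro eqc_context eqx_squares) simp
  moreover have "pres_eq X {} ([(1, b)] @ gpow 1 2) (gpow 1 2 @ [(1, b)])"
  proof -
    have "pres_eq X {} (gpow 1 (if b then -1 else 1) @ gpow 1 2) (gpow 1 2 @ gpow 1 (if b then -1 else 1))"
      by (rule gpow_comm) simp
    then show ?thesis by (cases b) simp_all
  qed
  moreover have "eqx 1 ([] @ gpow 1 2 @ [(1, b)]) ([] @ gpow 0 2 @ [(1, b)])"
    by (intro eqc_context eqc_sym[OF eqx_squares RR_words_over]) simp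
  ultimately show ?thesis
    using eqc_trans[OF eqc_trans_free, of X RR 1 _ _ _ 1] by fastforce
qed

lemma eqx_y_even: "\<exists>c. eqx c ([(1, b)] @ gpow 0 (2 * j)) (gpow 0 (2 * j) @ [(1, b)])"
proof -
  have "eqx (2 * \<bar>real_of_int j\<bar>) (wpow (gpow 0 2) j @ [(1, b)]) ([(1, b)] @ wpow (gpow 0 2) j)"
    by (intro eqc_commute_wpow eqc_sym[OF eqx_y_x2]) auto
  moreover have "pres_eq X {} (wpow (gpow 0 2) j) (gpow 0 (2 * j))" by (rule wpow_gpow) simp
  ultimately have "eqx (2 * \<bar>real_of_int j\<bar>) (gpow 0 (2 * j) @ [(1, b)]) ([(1, b)] @ gpow 0 (2 * j))"
    by (meson eqc_free_trans eqc_trans_free pres_eq_append pres_eq_refl pres_eq_sym)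
  then show ?thesis using eqc_sym[OF _ RR_words_over] by blast
qed

lemma eq_y_even: "pres_eq X RR ([(1, b)] @ gpow 0 (2 * j)) (gpow 0 (2 * j) @ [(1, b)])"
  using eqx_y_even eqc_imp_pres_eq[OF _ RR_words_over] by blast

text \<open>Passing from c to its conjugate is free by the definition of \<open>cw False\<close>. In
  the other direction c has to be moved past x^2, where only its last letter y costs
  anything.\<close>

lemma eqx_cw_x: "eqx 2 (cw e @ gpow 0 1) (gpow 0 1 @ cw (\<not> e))"
proof (cases e)
  case True
  have "pres_eq X {} ([] @ cword @ [(0, False)]) ([(0, False), (0, True)] @ cword @ [(0, False)])"
    using pres_eq_sym[OF pres_eq_cancel_pair[of 0 X "{}" False]]
    by (intro pres_eq_append pres_eq_refl) auto
  from eqc_mono[OF eqc_free[OF this], of 2] show ?thesis using True by (simp add: cw_def)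
next
  case False
  let ?g = "gpow 0 (2 * int p - 1) :: nat word"
  have "eqx 2 (?g @ ([(1, False)] @ gpow 0 2) @ []) (?g @ (gpow 0 2 @ [(1, False)]) @ [])"
    by (intro eqc_context eqx_y_x2) simp
  moreover have "pres_eq X {} ((?g @ gpow 0 2) @ [(1, False)]) ((gpow 0 2 @ ?g) @ [(1, False)])"
    by (rule pres_eq_append[OF gpow_comm pres_eq_refl]) simp
  ultimately have "eqx 2 (cword @ gpow 0 2) (gpow 0 2 @ cword)"
    by (simp add: cword_def eqc_trans_free)
  then have "eqx 2 ([(0, True)] @ (cword @ gpow 0 2) @ []) ([(0, True)] @ (gpow 0 2 @ cword) @ [])"
    by (intro eqc_context) auto
  moreover have "pres_eq X {} ((gpow 0 (-1) @ gpow 0 2) @ cword) (gpow 0 1 @ cword)"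
    using gpow_add[of 0 X "{}" "-1" 2] by (intro pres_eq_append) auto
  ultimately have "eqx 2 ([(0, True)] @ cword @ gpow 0 2) (gpow 0 1 @ cword)"
    by (simp add: eqc_trans_free)
  moreover have "gpow 0 2 = gpow 0 1 @ (gpow 0 1 :: nat word)"
    by (simp add: gpow_def numeral_2_eq_2)
  ultimately show ?thesis using False by (simp add: cw_def)
qed

definition flip :: "int \<Rightarrow> bool \<Rightarrow> bool" where
  "flip j e = (if even j then e else \<not> e)"

lemma eqx_cw_gpow: "eqx (2 * \<bar>real_of_int j\<bar>) (cw e @ gpow 0 j) (gpow 0 j @ cw (flip j e))"
proof -
  have nat: "eqx (2 * real n) (cw e @ gpow 0 (int n)) (gpow 0 (int n) @ cw (flip (int n) e))" for n e
  proof (induction n)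
    case (Suc n)
    have split: "gpow 0 (int (Suc n)) = gpow 0 (int n) @ (gpow 0 1 :: nat word)"
      by (simp add: gpow_def replicate_append_same nat_add_distrib)
    have "eqx (2 * real n) ([] @ (cw e @ gpow 0 (int n)) @ gpow 0 1)
        ([] @ (gpow 0 (int n) @ cw (flip (int n) e)) @ gpow 0 1)"
      by (intro eqc_context Suc) simp
    moreover have "eqx 2 (gpow 0 (int n) @ (cw (flip (int n) e) @ gpow 0 1) @ [])
        (gpow 0 (int n) @ (gpow 0 1 @ cw (\<not> flip (int n) e)) @ [])"
      by (intro eqc_context eqx_cw_x) simp
    moreover have "flip (int (Suc n)) e = (\<not> flip (int n) e)" by (auto simp: flip_def)
    ultimately show ?case unfolding split
      using eqc_trans[of X RR "2 * real n" _ _ 2] by (fastforce simp: algebra_simps)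
  qed (simp add: flip_def)
  show ?thesis
  proof (cases "j \<ge> 0")
    case True
    then show ?thesis using nat[where e = e and n = "nat j"] by simp
  next
    case False
    define n where "n = nat (- j)"
    have j: "j = - int n" "flip (int n) (flip j e) = e" using False by (auto simp: n_def flip_def)
    let ?g = "gpow 0 (int n) :: nat word"
    have ig: "inv_word ?g = gpow 0 j" by (simp add: inv_gpow j)
    have "eqx (2 * real n) (inv_word ?g @ (cw (flip j e) @ ?g) @ inv_word ?g)
        (inv_word ?g @ (?g @ cw e) @ inv_word ?g)"
      using nat[where e = "flip j e" and n = n] j by (intro eqc_context) auto
    moreover have "pres_eq X {} ((inv_word ?g @ cw (flip j e)) @ (?g @ inv_word ?g)) ((inv_word ?g @ cw (flip j e)) @ [])"
      by (intro pres_eq_append pres_eq_refl pres_eq_inv_right) simp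
    moreover have "pres_eq X {} ((inv_word ?g @ ?g) @ (cw e @ inv_word ?g)) ([] @ (cw e @ inv_word ?g))"
      by (intro pres_eq_append pres_eq_refl pres_eq_inv_left) simp
    ultimately have "eqx (2 * real n) (inv_word ?g @ cw (flip j e)) (cw e @ inv_word ?g)"
      by simp (rule eqc_free_trans[OF pres_eq_sym eqc_trans_free])
    then show ?thesis using eqc_sym[OF _ RR_words_over] unfolding ig using j by fastforce
  qed
qed

lemma eqx_cw_wpow_gpow:
  "eqx (2 * \<bar>real_of_int j\<bar> * \<bar>real_of_int k\<bar>) (wpow (cw e) k @ gpow 0 j) (gpow 0 j @ wpow (cw (flip j e)) k)"
  by (intro eqc_commute_wpow eqx_cw_gpow) auto

lemma cw_cw: "pres_eq X RR (cw e @ cw (\<not> e)) (gpow 0 (4 * int p))"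
proof -
  let ?g = "\<lambda>k. gpow 0 k :: nat word"
  let ?y = "[(1, False)] :: nat word"
  have g: "pres_eq X RR (?g j @ ?g k) (?g (j + k))" for j k by (rule gpow_add) simp
  have yy: "pres_eq X RR (?y @ ?y) (?g 2)"
    using eqc_imp_pres_eq[OF eqx_squares RR_words_over]
    by (auto simp: gpow_def numeral_2_eq_2 intro: pres_eq_sym)
  have key: "pres_eq X RR (?g i @ ?y @ ?g (2 * j) @ ?y @ ?g k) (?g (i + 2 * j + 2 + k))" for i j k
  proof -
    have "pres_eq X RR (?g i @ (?y @ ?g (2 * j)) @ (?y @ ?g k)) (?g i @ (?g (2 * j) @ ?y) @ (?y @ ?g k))"
      by (rule pres_eq_context[OF eq_y_even])
    also have "pres_eq X RR ((?g i @ ?g (2 * j)) @ (?y @ ?y) @ ?g k) (?g (i + 2 * j) @ ?g 2 @ ?g k)"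
      by (intro pres_eq_append g yy pres_eq_refl)
    then have "pres_eq X RR (?g i @ (?g (2 * j) @ ?y) @ (?y @ ?g k)) (?g (i + 2 * j) @ ?g 2 @ ?g k)" by simp
    also have "pres_eq X RR (?g (i + 2 * j) @ ?g 2 @ ?g k) (?g (i + 2 * j) @ ?g (2 + k))"
      by (intro pres_eq_append g pres_eq_refl)
    also note g
    finally show ?thesis by (simp add: algebra_simps)
  qed
  show ?thesis
  proof (cases e)
    case True
    have "pres_eq X RR (?g (2 * int p - 1) @ ?y @ (?g (-1) @ ?g (2 * int p - 1)) @ ?y @ ?g 1)
        (?g (2 * int p - 1) @ ?y @ ?g (-1 + (2 * int p - 1)) @ ?y @ ?g 1)"
      by (intro pres_eq_append g pres_eq_refl)
    also have "pres_eq X RR \<dots> (?g (4 * int p))"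
      using key[of "2 * int p - 1" "int p - 1" 1] by (simp add: algebra_simps)
    finally show ?thesis using True by (simp add: cw_def cword_def)
  next
    case False
    have "pres_eq X RR ((?g (-1) @ ?g (2 * int p - 1)) @ ?y @ (?g 1 @ ?g (2 * int p - 1)) @ ?y @ ?g 0)
        (?g (-1 + (2 * int p - 1)) @ ?y @ ?g (1 + (2 * int p - 1)) @ ?y @ ?g 0)"
      by (intro pres_eq_append g pres_eq_refl)
    also have "pres_eq X RR \<dots> (?g (4 * int p))"
      using key[of "2 * int p - 2" "int p" 0] by (simp add: algebra_simps)
    finally show ?thesis using False by (simp add: cw_def cword_def)
  qed
qed

text \<open>In c^k each factor is replaced by x^(4p) times the inverse of the conjugate, and the
  powers of x are collected on the left. Step n moves x^(4pn) past one factor at cost 8pn, so that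
  the sum is quadratic.\<close>

lemma eqx_cw_convert:
  "\<exists>D>0. \<forall>e k. eqx (D * (real_of_int k)^2) (wpow (cw e) k) (gpow 0 (4 * int p * k) @ wpow (cw (\<not> e)) (- k))"
proof -
  have "\<exists>c. eqx c (cw e) (gpow 0 (4 * int p) @ inv_word (cw (\<not> e)))" for e
  proof -
    have "pres_eq X RR (cw e) (gpow 0 (4 * int p) @ inv_word (cw (\<not> e)))"
    proof -
      have "pres_eq X RR (cw e @ (cw (\<not> e) @ inv_word (cw (\<not> e)))) (cw e @ [])"
        by (intro pres_eq_append pres_eq_refl pres_eq_inv_right) simp
      moreover have "pres_eq X RR ((cw e @ cw (\<not> e)) @ inv_word (cw (\<not> e))) (gpow 0 (4 * int p) @ inv_word (cw (\<not> e)))"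
        by (intro pres_eq_append pres_eq_refl cw_cw)
      ultimately show ?thesis by simp (rule pres_eq_trans[OF pres_eq_sym])
    qed
    then show ?thesis by (intro pres_eq_imp_eqc) auto
  qed
  then obtain cc where cc: "\<And>e. eqx (cc e) (cw e) (gpow 0 (4 * int p) @ inv_word (cw (\<not> e)))" by metis
  define K where "K = max (cc True) (cc False)"
  have K: "eqx K (cw e) (gpow 0 (4 * int p) @ inv_word (cw (\<not> e)))" for e
    by (rule eqc_mono[OF cc]) (cases e; simp add: K_def)
  have K0: "0 \<le> K" using eqc_nonneg[OF K] .
  define D where "D = K + 8 * real p"
  have nat: "eqx (D * (real n)^2) (wpow (cw e) (int n)) (gpow 0 (4 * int p * int n) @ wpow (cw (\<not> e)) (- int n))" for e n
  proof (induction n)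
    case (Suc n)
    let ?i = "inv_word (cw (\<not> e))"
    have fl: "flip (4 * int p * int n) (\<not> e) = (\<not> e)" by (simp add: flip_def)
    have "eqx (K + D * (real n)^2) (cw e @ wpow (cw e) (int n))
       ((gpow 0 (4 * int p) @ ?i) @ (gpow 0 (4 * int p * int n) @ wpow (cw (\<not> e)) (- int n)))"
      by (intro eqc_append K Suc) simp
    moreover have "eqx (2 * \<bar>real_of_int (4 * int p * int n)\<bar> * \<bar>real_of_int (-1)\<bar>)
        (gpow 0 (4 * int p) @ (wpow (cw (\<not> e)) (-1) @ gpow 0 (4 * int p * int n)) @ wpow (cw (\<not> e)) (- int n))
        (gpow 0 (4 * int p) @ (gpow 0 (4 * int p * int n) @ wpow (cw (\<not> e)) (-1)) @ wpow (cw (\<not> e)) (- int n))"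
      using eqx_cw_wpow_gpow[of "4 * int p * int n" "-1" "\<not> e"] unfolding fl
      by (intro eqc_context) auto
    moreover have "pres_eq X {} ((gpow 0 (4 * int p) @ gpow 0 (4 * int p * int n)) @ (wpow (cw (\<not> e)) (-1) @ wpow (cw (\<not> e)) (- int n)))
        (gpow 0 (4 * int p + 4 * int p * int n) @ wpow (cw (\<not> e)) (-1 + - int n))"
      by (intro pres_eq_append gpow_add pres_eq_sym[OF pres_eq_wpow_add]) auto
    ultimately have "eqx (K + D * (real n)^2 + 2 * (4 * real p * real n)) (cw e @ wpow (cw e) (int n))
        (gpow 0 (4 * int p + 4 * int p * int n) @ wpow (cw (\<not> e)) (-1 + - int n))"
      using eqc_trans_free[OF eqc_trans] by (fastforce simp: abs_mult)
    moreover have "K + D * (real n)^2 + 2 * (4 * real p * real n) \<le> D * (real (Suc n))^2"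
      using K0 by (simp add: D_def power2_eq_square algebra_simps)
    moreover have "cw e @ wpow (cw e) (int n) = wpow (cw e) (int (Suc n))"
      using wpow_Suc[of "int n" "cw e"] by (simp add: add.commute)
    ultimately show ?case using eqc_mono by (fastforce simp: algebra_simps)
  qed simp
  have "eqx (D * (real_of_int k)^2) (wpow (cw e) k) (gpow 0 (4 * int p * k) @ wpow (cw (\<not> e)) (- k))" for e k
  proof (cases "k \<ge> 0")
    case True
    then show ?thesis using nat[where e = e and n = "nat k"] by simp
  next
    case False
    define n where "n = nat (- k)"
    have k: "k = - int n" using False by (simp add: n_def)
    let ?g = "gpow 0 (4 * int p * k) :: nat word"
    have "eqx (D * (real n)^2) (?g @ wpow (cw (\<not> e)) (int n) @ []) (?g @ (gpow 0 (4 * int p * int n) @ wpow (cw e) (- int n)) @ [])"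
      using nat[where e = "\<not> e" and n = n] by (intro eqc_context) auto
    moreover have "pres_eq X {} ((?g @ gpow 0 (4 * int p * int n)) @ wpow (cw e) (- int n)) (gpow 0 (4 * int p * k + 4 * int p * int n) @ wpow (cw e) (- int n))"
      by (intro pres_eq_append gpow_add pres_eq_refl) simp
    ultimately have "eqx (D * (real n)^2) (?g @ wpow (cw (\<not> e)) (int n)) (wpow (cw e) k)"
      using eqc_trans_free by (fastforce simp: k)
    then show ?thesis using eqc_sym[OF _ RR_words_over] by (fastforce simp: k)
  qed
  moreover have "D > 0" using K0 q_less_p by (simp add: D_def)
  ultimately show ?thesis by blast
qed

section \<open>The two normal forms of elements of V\<close>

definition ks :: "bool \<Rightarrow> int \<Rightarrow> int" where
  "ks e b = (if e then b else - b)"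

text \<open>Powers of c or of its conjugate are used in place of powers of u because then, in the
  form \<open>nf True\<close>, the elements of both edge groups are pure powers, and |k|
  applications of the relator of t suffice to cross the edge. The sign in \<open>ks\<close> is there
  because the conjugate of c is (2p, -1).\<close>

definition nf :: "bool \<Rightarrow> vert \<Rightarrow> nat word" where
  "nf e v = gpow 0 (fst v - 2 * int p * ks e (snd v)) @ wpow (cw e) (ks e (snd v))"

lemma nf_words_over [simp]: "nf e v \<in> words_over {0, Suc 0, 2}"
  by (simp add: nf_def)

lemma nf_gp_False: "nf e (gp False k) = gpow 0 (2 * int q * k)"
  and nf_gp_True: "nf True (gp True k) = wpow cword k"
  by (simp_all add: nf_def gp_def ks_def cw_def)

lemma nf_switch:
  assumes D: "\<And>e k. eqx (D * (real_of_int k)^2) (wpow (cw e) k) (gpow 0 (4 * int p * k) @ wpow (cw (\<not> e)) (- k))"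
  shows "eqx (D * (real_of_int (snd v))^2) (nf e v) (nf (\<not> e) v)"
proof -
  let ?k = "ks e (snd v)" and ?i = "fst v"
  have k: "ks (\<not> e) (snd v) = - ?k" by (simp add: ks_def)
  have "eqx (D * (real_of_int ?k)^2) (gpow 0 (?i - 2 * int p * ?k) @ wpow (cw e) ?k @ [])
      (gpow 0 (?i - 2 * int p * ?k) @ (gpow 0 (4 * int p * ?k) @ wpow (cw (\<not> e)) (- ?k)) @ [])"
    by (intro eqc_context D) simp
  moreover have "pres_eq X {} ((gpow 0 (?i - 2 * int p * ?k) @ gpow 0 (4 * int p * ?k)) @ wpow (cw (\<not> e)) (- ?k))
      (gpow 0 (?i - 2 * int p * ?k + 4 * int p * ?k) @ wpow (cw (\<not> e)) (- ?k))"
    by (intro pres_eq_append gpow_add pres_eq_refl) simp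
  moreover have "?i - 2 * int p * ?k + 4 * int p * ?k = ?i - 2 * int p * (- ?k)" by simp
  moreover have "(real_of_int ?k)^2 = (real_of_int (snd v))^2" by (simp add: ks_def)
  ultimately show ?thesis unfolding nf_def k using eqc_trans_free by fastforce
qed

text \<open>The left factor is taken in the form that the power of x in the right factor turns into
  e: the exponent that has to be passed has the parity of \<open>fst w\<close>, since the other
  summand is even. The cost is that of moving one power past the other.\<close>

lemma nf_vm:
  defines "e1 \<equiv> \<lambda>e w. flip (fst w) e"
  shows "eqx (2 * \<bar>real_of_int (fst w - 2 * int p * ks e (snd w))\<bar> * \<bar>real_of_int (ks (e1 e w) (snd v))\<bar>)
    (nf (e1 e w) v @ nf e w) (nf e (vm v w))"
proof -
  let ?e = "e1 e w"
  let ?k1 = "ks ?e (snd v)" and ?k2 = "ks e (snd w)"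
  let ?j1 = "fst v - 2 * int p * ?k1" and ?j2 = "fst w - 2 * int p * ?k2"
  have fl: "flip ?j2 ?e = e" by (simp add: flip_def e1_def)
  have ks: "ks e (snd (vm v w)) = ?k1 + ?k2" by (auto simp: ks_def vm_def sg_def e1_def flip_def)
  have "eqx (2 * \<bar>real_of_int ?j2\<bar> * \<bar>real_of_int ?k1\<bar>)
      (gpow 0 ?j1 @ (wpow (cw ?e) ?k1 @ gpow 0 ?j2) @ wpow (cw e) ?k2)
      (gpow 0 ?j1 @ (gpow 0 ?j2 @ wpow (cw e) ?k1) @ wpow (cw e) ?k2)"
    using eqx_cw_wpow_gpow[of ?j2 ?k1 ?e] unfolding fl by (intro eqc_context) auto
  moreover have "pres_eq X {} ((gpow 0 ?j1 @ gpow 0 ?j2) @ (wpow (cw e) ?k1 @ wpow (cw e) ?k2))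
      (gpow 0 (?j1 + ?j2) @ wpow (cw e) (?k1 + ?k2))"
    by (intro pres_eq_append gpow_add pres_eq_sym[OF pres_eq_wpow_add]) auto
  moreover have "?j1 + ?j2 = fst (vm v w) - 2 * int p * (?k1 + ?k2)" by (simp add: vm_def algebra_simps)
  ultimately show ?thesis unfolding nf_def ks using eqc_trans_free by fastforce
qed

lemma eq_letter_nf_True: "g \<in> {0, 1} \<Longrightarrow> pres_eq X RR [(g, b)] (nf True (lval (g, b)))"
proof -
  assume g: "g \<in> {0, 1}"
  let ?g = "\<lambda>k. gpow 0 k :: nat word"
  show ?thesis
  proof (cases "g = 0")
    case True
    then show ?thesis by (cases b) (simp_all add: nf_def ks_def)
  next
    case False
    then have g: "g = 1" using g by simp
    let ?s = "if b then -1 else 1 :: int"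
    have "pres_eq X RR ((?g (?s - 2 * int p) @ ?g (2 * int p - 1)) @ [(1, False)])
        (?g (?s - 2 * int p + (2 * int p - 1)) @ [(1, False)])"
      by (intro pres_eq_append pres_eq_refl gpow_add) simp
    then have 1: "pres_eq X RR (nf True (lval (g, b))) (?g (?s - 1) @ [(1, False)])"
      using g by (auto simp: nf_def ks_def cw_def cword_def)
    have "pres_eq X RR (?g (?s - 1) @ [(1, False)]) [(1, b)]"
    proof (cases b)
      case True
      have "pres_eq X RR (?g 2) (gpow 1 2)" using eqc_imp_pres_eq[OF eqx_squares RR_words_over] .
      from pres_eq_inv_word[OF this] have "pres_eq X RR (?g (-2)) (gpow 1 (-2))" by (simp add: inv_gpow)
      then have "pres_eq X RR (?g (-2) @ [(1, False)]) (gpow 1 (-2) @ gpow 1 1)"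
        by (intro pres_eq_append) auto
      also have "pres_eq X RR (gpow 1 (-2) @ gpow 1 1) (gpow 1 (-2 + 1))" by (rule gpow_add) simp
      finally show ?thesis using True by simp
    qed simp
    then show ?thesis using pres_eq_trans[OF 1] pres_eq_sym g by blast
  qed
qed

lemma eqx_letter_nf: "\<exists>K. \<forall>g\<in>{0, 1}. \<forall>b e. eqx K [(g, b)] (nf e (lval (g, b)))"
proof -
  obtain D where D: "\<And>e k. eqx (D * (real_of_int k)^2) (wpow (cw e) k) (gpow 0 (4 * int p * k) @ wpow (cw (\<not> e)) (- k))"
    using eqx_cw_convert by blast
  have "pres_eq X RR [(g, b)] (nf e (lval (g, b)))" if "g \<in> {0, 1}" for g b e
  proof (cases e)
    case False
    then show ?thesis
      using pres_eq_trans[OF eq_letter_nf_True[OF that]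
        eqc_imp_pres_eq[OF nf_switch[OF D, of "lval (g, b)" True] RR_words_over]] by simp
  qed (use eq_letter_nf_True[OF that] in simp)
  then have "\<exists>c. eqx c [(g, b)] (nf e (lval (g, b)))" if "g \<in> {0, 1}" for g b e
    using that by (intro pres_eq_imp_eqc) auto
  then obtain f where f: "\<And>g b e. g \<in> {0, 1} \<Longrightarrow> eqx (f g b e) [(g, b)] (nf e (lval (g, b)))" by metis
  let ?K = "\<Sum>g\<in>{0, 1}. \<Sum>b\<in>UNIV. \<Sum>e\<in>UNIV. f g b e"
  have nn: "0 \<le> f g b e" if "g \<in> {0, 1}" for g b e using eqc_nonneg[OF f[OF that]] .
  have "f g b e \<le> ?K" if "g \<in> {0, 1}" for g b e
  proof -
    have "f g b e \<le> (\<Sum>e\<in>UNIV. f g b e)" by (rule member_le_sum) (use nn that in auto)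
    also have "\<dots> \<le> (\<Sum>b\<in>UNIV. \<Sum>e\<in>UNIV. f g b e)"
      by (rule member_le_sum[where f = "\<lambda>b. \<Sum>e\<in>UNIV. f g b e"]) (use nn that in \<open>auto intro!: sum_nonneg\<close>)
    also have "\<dots> \<le> ?K"
      by (rule member_le_sum[where f = "\<lambda>g. \<Sum>b\<in>UNIV. \<Sum>e\<in>UNIV. f g b e"]) (use nn that in \<open>auto intro!: sum_nonneg\<close>)
    finally show ?thesis .
  qed
  then show ?thesis by (intro exI ballI allI) (rule eqc_mono[OF f])
qed

text \<open>The quadratic form k (2 p k - i) vanishes on the axes of c and of x and is positive on the
  axis of the conjugate of c: it absorbs the quadratic cost of rewriting a power of c in the
  other normal form, and its polar form is bounded by the product of the sizes.\<close>

definition qf :: "bool \<Rightarrow> vert \<Rightarrow> real" where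
  "qf e v = real_of_int (ks e (snd v) * (2 * int p * ks e (snd v) - fst v))"

lemma qf_gp: "qf e (gp False k) = 0" "qf True (gp True k) = 0" "qf False (gp True k) = 4 * real p * (real_of_int k)^2"
  by (simp_all add: qf_def gp_def ks_def power2_eq_square)

lemma qf_vm:
  assumes "\<bar>real_of_int (snd v)\<bar> \<le> a" "\<bar>real_of_int (fst v)\<bar> \<le> 2 * real p * a"
    "\<bar>real_of_int (snd w)\<bar> \<le> b" "\<bar>real_of_int (fst w)\<bar> \<le> 2 * real p * b"
  shows "qf (flip (fst w) e) v + qf e w \<le> qf e (vm v w) + 8 * real p * (a * b)"
proof -
  let ?k1 = "real_of_int (ks (flip (fst w) e) (snd v))" and ?k2 = "real_of_int (ks e (snd w))"
  let ?i1 = "real_of_int (fst v)" and ?i2 = "real_of_int (fst w)"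
  have ks: "ks e (snd (vm v w)) = ks (flip (fst w) e) (snd v) + ks e (snd w)"
    by (auto simp: ks_def vm_def sg_def flip_def)
  have b: "\<bar>?k1\<bar> \<le> a" "\<bar>?k2\<bar> \<le> b" using assms by (auto simp: ks_def)
  have nn: "0 \<le> a" "0 \<le> b" using assms by linarith+
  have "\<bar>?k1 * ?k2\<bar> \<le> a * b" using b nn by (simp add: abs_mult mult_mono)
  then have "real p * \<bar>?k1 * ?k2\<bar> \<le> real p * (a * b)" by (rule mult_left_mono) simp
  then have 1: "\<bar>real p * (?k1 * ?k2)\<bar> \<le> real p * (a * b)" by (simp add: abs_mult)
  have "\<bar>?k1 * ?i2\<bar> \<le> a * (2 * real p * b)" using b assms nn unfolding abs_mult by (intro mult_mono) auto
  then have 2: "\<bar>?k1 * ?i2\<bar> \<le> 2 * (real p * (a * b))" by (simp add: algebra_simps)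
  have "\<bar>?k2 * ?i1\<bar> \<le> b * (2 * real p * a)" using b assms nn unfolding abs_mult by (intro mult_mono) auto
  then have 3: "\<bar>?k2 * ?i1\<bar> \<le> 2 * (real p * (a * b))" by (simp add: algebra_simps)
  have "qf e (vm v w) - qf (flip (fst w) e) v - qf e w
      = 4 * (real p * (?k1 * ?k2)) - ?k1 * ?i2 - ?k2 * ?i1"
    unfolding qf_def ks by (simp add: vm_def algebra_simps)
  then show ?thesis using 1 2 3 by linarith
qed

text \<open>The induction runs over both forms at once, since the left factor of a product may be
  needed in the other form. The correction \<open>D * qf e v\<close> vanishes in the form in which
  the relator of t is applied, and for v = (0, 0), so that it leaves no trace in the area of a
  trivial word.\<close>

lemma Der_eqx:
  "\<exists>E D. 0 \<le> E \<and> 0 < D \<and> (\<forall>w v e. Der w v \<longrightarrow>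
     eqx (E * real (length w) powr (2 * al) + D * qf e v) w (nf e v))"
proof -
  obtain D where D0: "D > 0"
    and D: "\<And>e k. eqx (D * (real_of_int k)^2) (wpow (cw e) k) (gpow 0 (4 * int p * k) @ wpow (cw (\<not> e)) (- k))"
    using eqx_cw_convert by blast
  obtain K where K: "\<And>g b e. g \<in> {0, 1} \<Longrightarrow> eqx K [(g, b)] (nf e (lval (g, b)))"
    using eqx_letter_nf by metis
  have K0: "0 \<le> K" using eqc_nonneg[OF K[of 0]] by simp
  \<comment> \<open>K pays for letters and 1 for the relators of t. For factors of lengths m and n,
    the gap 2 E (m n)^\<alpha> has to pay 8p (m n)^\<alpha> for moving the normal forms past each
    other and 8pD (m n)^\<alpha> for the polar form of \<open>qf\<close>.\<close>
  define E where "E = K + 1 + 8 * real p + 8 * real p * D"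
  have E: "K \<le> E" "1 \<le> E" "0 \<le> E" "4 * real p + 4 * real p * D \<le> E"
    using K0 D0 by (simp_all add: E_def)
  let ?s = "\<lambda>w. real (length w) powr al"
  have sq: "real (length w) powr (2 * al) = ?s w * ?s w" for w :: "nat word"
    by (simp only: mult_2 powr_add)
  have "eqx (E * real (length w) powr (2 * al) + D * qf e v) w (nf e v)" if "Der w v" for w v e
    using that
  proof (induction arbitrary: e rule: Der.induct)
    case Nil
    then show ?case by (simp add: nf_def qf_def ks_def)
  next
    case (Letter g b)
    have "0 \<le> qf e (lval (g, b))" using q_less_p by (auto simp: qf_def ks_def)
    then have "0 \<le> D * qf e (lval (g, b))" using D0 by simp
    then show ?case using E by (intro eqc_mono[OF K[OF Letter]]) simp
  next
    case (App v a w b)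
    let ?e = "flip (fst b) e"
    have bv: "\<bar>real_of_int (snd a)\<bar> \<le> ?s v" "\<bar>real_of_int (fst a)\<bar> \<le> 2 * real p * ?s v"
      "\<bar>real_of_int (snd b)\<bar> \<le> ?s w" "\<bar>real_of_int (fst b)\<bar> \<le> 2 * real p * ?s w"
      using Der_Bnd[OF App(1)] Der_Bnd[OF App(2)] Bnd_fst Bnd_snd by blast+
    let ?c = "2 * \<bar>real_of_int (fst b - 2 * int p * ks e (snd b))\<bar> * \<bar>real_of_int (ks ?e (snd a))\<bar>"
    have "eqx ((E * real (length v) powr (2 * al) + D * qf ?e a) + (E * real (length w) powr (2 * al) + D * qf e b) + ?c)
        (v @ w) (nf e (vm a b))"
      using eqc_trans[OF eqc_append[OF App.IH(1)[of ?e] App.IH(2)[of e]] nf_vm] by simp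
    moreover have "?c \<le> 8 * real p * (?s v * ?s w)"
    proof -
      have "\<bar>real_of_int (fst b - 2 * int p * ks e (snd b))\<bar>
          \<le> \<bar>real_of_int (fst b)\<bar> + 2 * real p * \<bar>real_of_int (snd b)\<bar>"
        by (simp add: ks_def abs_mult abs_triangle_ineq4 abs_triangle_ineq)
          (use abs_triangle_ineq4[of "real_of_int (fst b)" "2 * real p * real_of_int (snd b)"]
             abs_triangle_ineq[of "real_of_int (fst b)" "2 * real p * real_of_int (snd b)"] in \<open>simp add: abs_mult\<close>)
      also have "\<dots> \<le> 2 * real p * ?s w + 2 * real p * ?s w"
        using bv by (intro add_mono mult_left_mono) auto
      finally have "\<bar>real_of_int (fst b - 2 * int p * ks e (snd b))\<bar> \<le> 4 * real p * ?s w" by simp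
      moreover have "\<bar>real_of_int (ks ?e (snd a))\<bar> \<le> ?s v" using bv by (simp add: ks_def)
      ultimately have "\<bar>real_of_int (fst b - 2 * int p * ks e (snd b))\<bar> * \<bar>real_of_int (ks ?e (snd a))\<bar>
          \<le> (4 * real p * ?s w) * ?s v" by (intro mult_mono) auto
      then show ?thesis by (simp add: algebra_simps)
    qed
    moreover have "D * qf ?e a + D * qf e b \<le> D * qf e (vm a b) + 8 * real p * D * (?s v * ?s w)"
      using mult_left_mono[OF qf_vm[OF bv, of e], of D] D0 by (simp add: algebra_simps)
    moreover have "E * real (length v) powr (2 * al) + E * real (length w) powr (2 * al)
        + (8 * real p + 8 * real p * D) * (?s v * ?s w) \<le> E * real (length (v @ w)) powr (2 * al)"
    proof -
      have "?s v + ?s w \<le> ?s (v @ w)" using al_superadd[of "real (length v)" "real (length w)"] by simp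
      then have "(?s v + ?s w) * (?s v + ?s w) \<le> ?s (v @ w) * ?s (v @ w)" by (intro mult_mono) auto
      then have "E * ((?s v + ?s w) * (?s v + ?s w)) \<le> E * (?s (v @ w) * ?s (v @ w))"
        using E by (intro mult_left_mono) auto
      moreover have "(8 * real p + 8 * real p * D) * (?s v * ?s w) \<le> (2 * E) * (?s v * ?s w)"
        using E by (intro mult_right_mono) auto
      ultimately show ?thesis unfolding sq by (simp add: algebra_simps)
    qed
    ultimately show ?case by (elim eqc_mono) (simp add: algebra_simps)
  next
    case (Conj w e' k)
    have bk: "\<bar>real_of_int k\<bar> \<le> ?s w" using Bnd_gp[OF Der_Bnd[OF Conj(1)]] .
    let ?w = "(2, \<not> e') # w @ [(2, e')]"
    \<comment> \<open>The two letters t raise the \<alpha>-th power of the length by at least 1;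
      after squaring, the mixed term pays for the |k| relators.\<close>
    have num: "E * real (length w) powr (2 * al) + \<bar>real_of_int k\<bar> \<le> E * real (length ?w) powr (2 * al)"
    proof -
      have "?s w + 1 \<le> ?s w + 2 powr al" using al_gt_1 ge_one_powr_ge_zero[of 2 al] by simp
      also have "\<dots> \<le> ?s ?w" using al_superadd[of "real (length w)" 2] by (simp add: add.commute)
      finally have "(?s w + 1) * (?s w + 1) \<le> ?s ?w * ?s ?w" by (intro mult_mono) auto
      then have "E * ((?s w + 1) * (?s w + 1)) \<le> E * (?s ?w * ?s ?w)" using E by (intro mult_left_mono) auto
      moreover have "1 * ?s w \<le> E * ?s w" using E by (intro mult_right_mono) auto
      ultimately show ?thesis unfolding sq using bk E by (simp add: algebra_simps)
    qed
    show ?case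
    proof (cases e')
      case False
      have "eqx (E * real (length w) powr (2 * al)) w (gpow 0 (2 * int q * k))"
        using Conj.IH[of True] False by (simp add: nf_gp_False qf_gp)
      then have "eqx (E * real (length w) powr (2 * al)) ([(2, True)] @ w @ [(2, False)])
          ([(2, True)] @ gpow 0 (2 * int q * k) @ [(2, False)])"
        by (rule eqc_context) simp
      from eqc_trans[OF this eqx_edge] have t: "eqx (E * real (length ?w) powr (2 * al)) ?w (nf True (gp True k))"
        using False num eqc_mono by (simp add: nf_gp_True) (fastforce intro: eqc_mono)
      show ?thesis
      proof (cases e)
        case True
        then show ?thesis using t False by (simp add: qf_gp)
      next
        case e: False
        have "eqx (E * real (length ?w) powr (2 * al) + D * (real_of_int k)^2) ?w (nf False (gp True k))"
          using eqc_trans[OF t nf_switch[OF D]] by (simp add: gp_def)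
        moreover have "(real_of_int k)^2 * 1 \<le> (real_of_int k)^2 * (4 * real p)"
          using q_less_p by (intro mult_left_mono) auto
        then have "D * (real_of_int k)^2 \<le> D * (4 * real p * (real_of_int k)^2)"
          using D0 by (simp add: mult.commute)
        ultimately show ?thesis using e False by (auto simp: qf_gp elim!: eqc_mono)
      qed
    next
      case True
      have "eqx (E * real (length w) powr (2 * al)) w (wpow cword k)"
        using Conj.IH[of True] True by (simp add: nf_gp_True qf_gp)
      then have "eqx (E * real (length w) powr (2 * al)) ([(2, False)] @ w @ [(2, True)])
          ([(2, False)] @ wpow cword k @ [(2, True)])"
        by (rule eqc_context) simp
      from eqc_trans[OF this eqx_edge'] show ?thesis
        using True num by (auto simp: nf_gp_False qf_gp elim!: eqc_mono)
    qed
  qed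
  then show ?thesis using E(3) D0 by blast
qed

theorem dehn_upper:
  "\<exists>E\<ge>0. \<forall>n. real (dehn_function X RR n) \<le> E * real n powr (2 * al)"
proof -
  obtain E D where E: "0 \<le> E" "\<And>w v e. Der w v \<Longrightarrow>
     eqx (E * real (length w) powr (2 * al) + D * qf e v) w (nf e v)"
    using Der_eqx by metis
  have "real (dehn_function X RR n) \<le> E * real n powr (2 * al)" for n
  proof -
    have "area X RR w \<le> nat \<lfloor>E * real n powr (2 * al)\<rfloor>"
      if "w \<in> words_over X \<and> length w \<le> n \<and> pres_eq X RR w []" for w
    proof -
      have "run start w = start" using run_pres_eq[of w "[]" start] that by simp
      then have "Der w (0, 0)" using Der_complete that by blast
      from E(2)[OF this, of True] have "eqx (E * real (length w) powr (2 * al)) w []"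
        by (simp add: nf_def qf_def ks_def)
      from area_le[OF this] have "real (area X RR w) \<le> E * real (length w) powr (2 * al)" .
      also have "\<dots> \<le> E * real n powr (2 * al)"
        using that E al_gt_1 by (intro mult_left_mono powr_mono2) auto
      finally show ?thesis by (simp add: le_nat_floor)
    qed
    then have "dehn_function X RR n \<le> nat \<lfloor>E * real n powr (2 * al)\<rfloor>"
      by (subst dehn_function_le_iff) auto
    then show ?thesis using E(1) by (simp add: le_nat_iff le_floor_iff)
  qed
  then show ?thesis using E(1) by blast
qed

end

lemma sg_even [simp]: "even i \<Longrightarrow> sg i = 1" and sg_odd [simp]: "odd i \<Longrightarrow> sg i = -1"
  by (simp_all add: sg_def)

context rpq
begin

section \<open>The lower bound for the area\<close>

text \<open>kap is a primitive of the signed area form of the vertex planes along the edges of the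
  Cayley graph. It is chosen such that the second relator carries no area at all.\<close>

definition pot :: "vert \<Rightarrow> int" where
  "pot v = sg (fst v) * (snd v * (fst v - int p * snd v + int p - 1))"

definition kap :: "state \<Rightarrow> nat letter \<Rightarrow> int" where
  "kap s l = (if fst l = 1 then (if snd l then - sg (fst (fst s)) * (fst (fst s) - 1) else - sg (fst (fst s)) * fst (fst s))
     else if fst l = 2 then (if snd l then - pot (fst s) else pot (fst (step s l))) else 0)"

fun kapw :: "state \<Rightarrow> nat word \<Rightarrow> int" where
  "kapw s [] = 0"
| "kapw s (l # w) = kap s l + kapw (step s l) w"

lemma kapw_append: "kapw s (v @ w) = kapw s v + kapw (run s v) w"
  by (induction v arbitrary: s) auto

lemma kap_inverse:
  assumes "okst (snd s)"
  shows "kap (step s (g, b)) (g, \<not> b) = - kap s (g, b)"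
  using step_inverse[OF assms, of g b]
  by (auto simp: kap_def step_shift shift_def vm_def sg_add sg_diff)

lemma kapw_inv:
  assumes "okst (snd s)"
  shows "kapw (run s w) (inv_word w) = - kapw s w"
  using assms
proof (induction w arbitrary: s)
  case (Cons l w)
  have ok: "okst (snd (step s l))" using Cons.prems by (rule okst_step)
  show ?case using Cons.IH[OF ok] run_inv[OF ok, of w] kap_inverse[OF Cons.prems, of "fst l" "snd l"]
    by (simp add: inv_word_Cons kapw_append)
qed simp

lemma kapw_inv':
  assumes "okst (snd s)" "run s w = s'"
  shows "kapw s' (inv_word w) = - kapw s w"
  using kapw_inv assms by blast

lemma kapw_gpow_0 [simp]: "kapw s (gpow 0 k) = 0"
proof -
  have "kapw s (replicate n (0, b)) = 0" for n b
    by (induction n arbitrary: s) (auto simp: kap_def)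
  then show ?thesis by (simp add: gpow_def)
qed

lemma kapw_free:
  assumes "pres_eq X {} w w'" "okst (snd s)"
  shows "kapw s w = kapw s w'"
proof (rule pres_eq_invariant[OF _ _ assms(1)])
  fix g b u v
  have ok: "okst (snd (run s u))" using okst_run[OF assms(2)] .
  show "kapw s (u @ [(g, b), (g, \<not> b)] @ v) = kapw s (u @ v)"
    using kap_inverse[OF ok, of g b] step_inverse[OF ok, of g b] by (simp add: kapw_append)
qed simp

text \<open>For k = 1 this is the weight that \<open>kap\<close> gives to the word c, which makes
  the weight of the second relator vanish.\<close>

lemma pot_shift: "pot (vm v (gp True k)) - pot v
    = sg (fst v) * (k * (fst v + int p - 1) + int p * k * k)"
  by (simp add: pot_def vm_def gp_def sg_add algebra_simps)

text \<open>An element written as u^B x^i has coordinates i and B, and on the letters x and y the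
  weight \<open>kap\<close> is i dB, a primitive of the area form, where i is the smaller of the
  exponents at the two ends of the edge. The square relator then encloses area 1 up to sign.\<close>

lemma kapw_vrel: "\<bar>kapw s vrel\<bar> \<le> 1"
  by (simp add: vrel_eq kap_def step_shift shift_def vm_def sg_add algebra_simps)

lemma kapw_trel:
  assumes "okst (snd s)"
  shows "kapw s trel = 0"
proof -
  let ?w = "[(2, True)] @ gpow 0 (2 * int q) @ [(2, False)]"
  have D: "Der (gpow 0 (2 * int q)) (gp False 1)"
    using Der_complete[of "gpow 0 (2 * int q)"] by (simp add: run_gpow_0 shift_def gp_def)
  have run: "run s ?w = shift s (gp True 1)"
    using Der_run[OF Der.Conj[OF D] assms] by simp
  have s': "step (run (step s (2, True)) (gpow 0 (2 * int q))) (2, False) = shift s (gp True 1)"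
    using run by (simp add: run_append)
  have "kapw s ?w = pot (vm (fst s) (gp True 1)) - pot (fst s)"
    using s' by (simp add: kapw_append kap_def shift_def)
  also have "\<dots> = kapw s cword"
    by (simp only: pot_shift) (simp add: cword_def kapw_append kap_def run_gpow_0 shift_def vm_def
      sg_add sg_diff algebra_simps)
  finally show ?thesis
    using kapw_inv[OF assms, of cword] run unfolding trel_def
    by (simp add: kapw_append run_cword[symmetric] run_append)
qed

text \<open>A relator returns to the state at which it starts, so u and its inverse contribute
  opposite weights and only the weight of the relator remains.\<close>

lemma kapw_relprod:
  assumes "relprod X RR n w" "okst (snd s)"
  shows "\<bar>kapw s w\<bar> \<le> int n"
  using assms
proof (induction)
  case (Cons u r n w)
  have ok: "okst (snd (run s u))" using okst_run[OF Cons.prems] .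
  have r: "\<bar>kapw (run s u) r\<bar> \<le> 1 \<and> run (run s u) r = run s u"
  proof -
    have rel: "\<bar>kapw (run s u) r'\<bar> \<le> 1 \<and> run (run s u) r' = run s u" if "r' \<in> RR" for r'
      using that kapw_vrel[of "run s u"] run_vrel[of "run s u"] run_trel[OF ok] kapw_trel[OF ok]
      by (auto simp: RR_eq)
    show ?thesis using Cons(2)
    proof
      assume "r \<in> inv_word ` RR"
      then obtain r' where r': "r = inv_word r'" "r' \<in> RR" by blast
      then show ?thesis using rel[OF r'(2)] kapw_inv'[OF ok, of r' "run s u"] run_inv'[OF ok, of "run s u" r'] ok
        by simp
    qed (rule rel)
  qed
  then have "kapw s ((u @ r @ inv_word u) @ w) = kapw (run s u) r + kapw s w"
    using kapw_inv[OF Cons.prems, of u] run_inv[OF Cons.prems, of u]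
    by (simp add: kapw_append run_append)
  then show ?case using r Cons.IH[OF Cons.prems] abs_triangle_ineq[of "kapw (run s u) r" "kapw s w"]
    by linarith
qed simp

lemma area_ge_kapw:
  assumes "w \<in> words_over X" "pres_eq X RR w []"
  shows "\<bar>kapw start w\<bar> \<le> int (area X RR w)"
proof -
  obtain P where P: "relprod X RR (area X RR w) P" "pres_eq X {} w P"
    using area_attained[OF assms(2,1) RR_words_over] by blast
  then show ?thesis using kapw_relprod[OF P(1), of start] kapw_free[OF P(2), of start] by simp
qed

subsection \<open>Snowflake words\<close>

text \<open>\<open>kseq (Suc d)\<close> is 2p \<open>kseq d\<close> / q rounded up. So the growth by
  2p/q is not lost, and the exponent that is missing after the doubling is a nonnegative number
  \<open>rem d\<close> below q, supplied by a bounded power of z.\<close>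

fun kseq :: "nat \<Rightarrow> nat" where
  "kseq 0 = 1"
| "kseq (Suc d) = (2 * p * kseq d + q - 1) div q"

definition rem :: "nat \<Rightarrow> int" where
  "rem d = int q * int (kseq (Suc d)) - 2 * int p * int (kseq d)"

lemma rem_bounds: "0 \<le> rem d" "rem d < int q"
proof -
  let ?m = "2 * p * kseq d + q - 1"
  have "q * (?m div q) + ?m mod q = ?m" by simp
  moreover have "?m mod q < q" using q_pos by simp
  ultimately have "q * (?m div q) \<ge> 2 * p * kseq d" "q * (?m div q) < 2 * p * kseq d + q"
    using q_pos by linarith+
  then have "int (2 * p * kseq d) \<le> int (q * (?m div q))" "int (q * (?m div q)) < int (2 * p * kseq d + q)"
    by linarith+
  then show "0 \<le> rem d" "rem d < int q" by (simp_all add: rem_def)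
qed

text \<open>With k = \<open>kseq d\<close> and c^k = t^-1 z^(qk) t, the word reads c^k (x^-1 c^k x)
  z^r for r = \<open>rem d\<close>. It represents z^(2pk + r), whose exponent is q
  \<open>kseq (Suc d)\<close>.\<close>

fun Zw :: "nat \<Rightarrow> nat word" where
  "Zw 0 = gpow 0 (2 * int q)"
| "Zw (Suc d) = ((2, True) # Zw d @ [(2, False)]) @ [(0, True)] @ ((2, True) # Zw d @ [(2, False)])
     @ [(0, False)] @ gpow 0 (2 * rem d)"

definition Aw :: "nat \<Rightarrow> nat word" where
  "Aw d = (2, True) # Zw d @ [(2, False)]"

lemma Zw_Suc: "Zw (Suc d) = Aw d @ [(0, True)] @ Aw d @ [(0, False)] @ gpow 0 (2 * rem d)"
  by (simp add: Aw_def)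

text \<open>This is c^k times the conjugate by x of c^-k, where k = \<open>kseq d\<close>: the
  powers of z cancel and u^(2k) remains.\<close>

definition Uw :: "nat \<Rightarrow> nat word" where
  "Uw d = Aw d @ [(0, True)] @ inv_word (Aw d) @ [(0, False)]"

definition Ww :: "nat \<Rightarrow> nat word" where
  "Ww d = Zw d @ Uw d @ inv_word (Zw d) @ inv_word (Uw d)"

lemma Der_gpow_0: "Der (gpow 0 k) (k, 0)"
  using Der_complete[of "gpow 0 k"] by (simp add: run_gpow_0 shift_def vm_def)

lemma Der_x: "Der [(0, b)] (if b then (-1, 0) else (1, 0))"
  using Der.Letter[of 0 b] by simp

lemma Der_Zw: "Der (Zw d) (gp False (int (kseq d)))"
proof (induction d)
  case 0
  then show ?case using Der_gpow_0[of "2 * int q"] by (simp add: gp_def)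
next
  case (Suc d)
  let ?k = "int (kseq d)"
  have A: "Der (Aw d) (gp True ?k)" using Der.Conj[OF Suc] by (simp add: Aw_def)
  from Der.App[OF A Der.App[OF Der_x[of True] Der.App[OF A Der.App[OF Der_x[of False] Der_gpow_0]]]]
  have "Der (Zw (Suc d)) (vm (gp True ?k) (vm (-1, 0) (vm (gp True ?k) (vm (1, 0) (2 * rem d, 0)))))"
    by (simp only: Zw_Suc if_True if_False)
  also have "vm (gp True ?k) (vm (-1, 0) (vm (gp True ?k) (vm (1, 0) (2 * rem d, 0))))
      = gp False (int (kseq (Suc d)))"
    by (simp add: gp_def vm_def sg_add sg_diff rem_def algebra_simps del: kseq.simps)
  finally show ?case .
qed

lemma Der_Aw: "Der (Aw d) (gp True (int (kseq d)))"
  using Der.Conj[OF Der_Zw] by (simp add: Aw_def)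

lemma Zw_words_over [simp]: "Zw d \<in> words_over {0, Suc 0, 2}"
  and Aw_words_over [simp]: "Aw d \<in> words_over {0, Suc 0, 2}"
  using Der_words_over[OF Der_Zw] Der_words_over[OF Der_Aw] by auto

lemma run_Zw: "okst (snd s) \<Longrightarrow> run s (Zw d) = shift s (gp False (int (kseq d)))"
  and run_Aw: "okst (snd s) \<Longrightarrow> run s (Aw d) = shift s (gp True (int (kseq d)))"
  using Der_run[OF Der_Zw] Der_run[OF Der_Aw] by auto

text \<open>In such a state t^-1 cannot cancel, so reading \<open>Aw\<close> enters a fresh plane at
  a point with even first coordinate, and the next level again starts in such a state. Otherwise the
  weight of a snowflake word might depend on the contents of the stack.\<close>

definition pushy :: "state \<Rightarrow> bool" where
  "pushy s \<longleftrightarrow> okst (snd s) \<and> (snd s = [] \<or> fst (hd (snd s)))"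

lemma pushy_shift [simp]: "pushy (shift s v) = pushy s"
  by (simp add: pushy_def)

lemma pushy_tstep:
  assumes "pushy s"
  shows "pushy (tstep True s)" "even (fst (fst (tstep True s)))"
proof -
  have "\<not> poppable True (fst s) (snd s)" using assms by (auto simp: pushy_def poppable_def)
  then show "pushy (tstep True s)" "even (fst (fst (tstep True s)))"
    using assms okst_tstep[of s True] by (auto simp: pushy_def tstep_def gp_def)
qed

lemma kapw_Aw:
  assumes "pushy s" "\<And>s. pushy s \<Longrightarrow> even (fst (fst s)) \<Longrightarrow> kapw s (Zw d) = c"
  shows "kapw s (Aw d) = sg (fst (fst s)) * (int (kseq d) * (fst (fst s) + int p - 1)
      + int p * int (kseq d) * int (kseq d)) + c"
proof -
  have ok: "okst (snd s)" using assms(1) by (simp add: pushy_def)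
  let ?s = "tstep True s"
  have "run s (Aw d) = step (run ?s (Zw d)) (2, False)"
    by (simp add: Aw_def step_def run_append)
  then have s': "step (run ?s (Zw d)) (2, False) = shift s (gp True (int (kseq d)))"
    using run_Aw[OF ok] by simp
  have "kapw s (Aw d) = - pot (fst s) + kapw ?s (Zw d) + pot (vm (fst s) (gp True (int (kseq d))))"
    using s' by (simp add: Aw_def kapw_append kap_def step_def shift_def)
  then show ?thesis
    using assms(2)[OF pushy_tstep[OF assms(1)]] pot_shift[of "fst s" "int (kseq d)"] by simp
qed

text \<open>Up to a constant, the weight of \<open>Aw\<close> is linear in the first coordinate i of
  its start, with a sign given by the parity of i. The two copies of \<open>Aw\<close> start at an
  even and at an odd first coordinate, so the terms in i cancel.\<close>

lemma kapw_Zw: "\<exists>c. \<forall>s. pushy s \<and> even (fst (fst s)) \<longrightarrow> kapw s (Zw d) = c"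
proof (induction d)
  case (Suc d)
  then obtain c where c: "\<And>s. pushy s \<Longrightarrow> even (fst (fst s)) \<Longrightarrow> kapw s (Zw d) = c" by blast
  let ?k = "int (kseq d)"
  have "kapw s (Zw (Suc d)) = ?k - 2 * int p * ?k * ?k + 2 * c"
    if s: "pushy s" "even (fst (fst s))" for s
  proof -
    have ok: "okst (snd s)" using s by (simp add: pushy_def)
    let ?s1 = "shift s (gp True ?k)" and ?s2 = "shift s (vm (gp True ?k) (-1, 0))"
    have "kapw s (Zw (Suc d)) = kapw s (Aw d) + kapw ?s2 (Aw d)"
      using ok by (simp add: Zw_Suc kapw_append run_Aw run_append kap_def step_shift shift_shift del: Zw.simps)
    moreover have "kapw s (Aw d) = ?k * (fst (fst s) + int p - 1) + int p * ?k * ?k + c"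
      using kapw_Aw[OF s(1) c] s(2) by (simp add: sg_def)
    moreover have "fst (fst ?s2) = fst (fst s) + 2 * int p * ?k - 1"
      by (simp add: shift_def vm_def gp_def)
    then have "kapw ?s2 (Aw d) = - (?k * (fst (fst s) + 2 * int p * ?k - 1 + int p - 1) + int p * ?k * ?k) + c"
      using kapw_Aw[of ?s2, OF _ c] s by (simp del: of_nat_add)
    ultimately show ?thesis by (simp add: algebra_simps)
  qed
  then show ?case by blast
qed auto

lemma run_Uw:
  assumes "okst (snd s)"
  shows "run s (Uw d) = shift s (0, 2 * int (kseq d))"
proof -
  let ?k = "int (kseq d)"
  let ?s2 = "shift s (vm (gp True ?k) (-1, 0))"
  have inv: "run ?s2 (inv_word (Aw d)) = shift ?s2 (gp True (- ?k))"
    by (rule run_inv') (use assms in \<open>simp_all add: run_Aw shift_shift gp_add vm_assoc\<close>)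
  then have "run s (Uw d) = shift s (vm (vm (vm (gp True ?k) (-1, 0)) (gp True (- ?k))) (1, 0))"
    using assms by (simp add: Uw_def run_append run_Aw step_shift shift_shift)
  then show ?thesis by (simp add: vm_def gp_def sg_add sg_diff)
qed

lemma kapw_Uw:
  assumes "pushy s" "even (fst (fst s))"
  shows "kapw s (Uw d) = 2 * int (kseq d) * fst (fst s) + int (kseq d) * (2 * int p - 3)
    + 2 * int p * int (kseq d) * int (kseq d)"
proof -
  obtain c where c: "\<And>s. pushy s \<Longrightarrow> even (fst (fst s)) \<Longrightarrow> kapw s (Zw d) = c"
    using kapw_Zw by blast
  have ok: "okst (snd s)" using assms by (simp add: pushy_def)
  let ?k = "int (kseq d)"
  let ?s2 = "shift s (vm (gp True ?k) (-1, 0))"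
  let ?s3 = "shift ?s2 (gp True (- ?k))"
  have r3: "run ?s3 (Aw d) = ?s2"
    using ok by (simp add: run_Aw shift_shift gp_add vm_assoc)
  have "kapw ?s2 (inv_word (Aw d)) = - kapw ?s3 (Aw d)"
    by (rule kapw_inv'[OF _ r3]) (use ok in simp)
  moreover have "kapw ?s3 (Aw d) = - (?k * (fst (fst s) - 1 + int p - 1) + int p * ?k * ?k) + c"
  proof -
    have "fst (fst ?s3) = fst (fst s) - 1" by (simp add: shift_def vm_def gp_def)
    then show ?thesis using kapw_Aw[of ?s3, OF _ c] assms by simp
  qed
  moreover have "kapw s (Aw d) = ?k * (fst (fst s) + int p - 1) + int p * ?k * ?k + c"
    using kapw_Aw[OF assms(1) c] assms(2) by (simp add: sg_def)
  moreover have "kapw s (Uw d) = kapw s (Aw d) + kapw ?s2 (inv_word (Aw d))"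
    using ok by (simp add: Uw_def kapw_append run_append run_Aw kap_def step_shift shift_shift)
  ultimately show ?thesis by (simp add: algebra_simps)
qed

lemma Uw_words_over [simp]: "Uw d \<in> words_over {0, Suc 0, 2}"
  and Ww_words_over [simp]: "Ww d \<in> words_over {0, Suc 0, 2}"
  by (simp_all add: Uw_def Ww_def)

lemma Der_imp_pres_eq_nf: "Der w v \<Longrightarrow> pres_eq X RR w (nf e v)"
  using Der_eqx eqc_imp_pres_eq[OF _ RR_words_over] by blast

lemma pres_eq_iff_run:
  assumes "v \<in> words_over X" "w \<in> words_over X"
  shows "pres_eq X RR v w \<longleftrightarrow> run start v = run start w"
proof
  show "pres_eq X RR v w \<Longrightarrow> run start v = run start w" by (simp add: run_pres_eq)
next
  assume eq: "run start v = run start w"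
  have ok: "okst (snd (run start w))" by (rule okst_run) simp
  have "run start (v @ inv_word w) = start" using eq run_inv[of start w] by (simp add: run_append)
  then have "Der (v @ inv_word w) (0, 0)" using Der_complete assms by simp
  then have "pres_eq X RR (v @ inv_word w) []"
    using Der_imp_pres_eq_nf[of _ "(0, 0)" True] by (simp add: nf_def ks_def)
  then show "pres_eq X RR v w" using pres_eq_iff_inv assms by blast
qed

text \<open>Since z is central, the commutator closes up. The weights of the two copies of
  \<open>Zw\<close> cancel. That of \<open>Uw\<close> has slope 2k in the first coordinate, and the
  two copies of \<open>Uw\<close> are 2qk apart: the sum is the area 2k * 2qk of a
  rectangle.\<close>

lemma run_Ww: "run start (Ww d) = start" and kapw_Ww: "kapw start (Ww d) = 4 * int q * (int (kseq d))^2"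
proof -
  let ?k = "int (kseq d)"
  let ?z = "gp False ?k" and ?u = "(0, 2 * ?k)"
  have com: "vm ?z ?u = vm ?u ?z" by (simp add: vm_def gp_def)
  let ?s1 = "shift start ?z" and ?s2 = "shift start (vm ?z ?u)" and ?s3 = "shift start ?u"
  have r1: "run start (Zw d) = ?s1" by (simp add: run_Zw)
  have r2: "run ?s1 (Uw d) = ?s2" by (simp add: run_Uw shift_shift)
  have r3': "run ?s3 (Zw d) = ?s2" by (simp add: run_Zw shift_shift com)
  have r3: "run ?s2 (inv_word (Zw d)) = ?s3" by (rule run_inv'[OF _ r3']) simp_all
  have r4': "run start (Uw d) = ?s3" by (simp add: run_Uw)
  have r4: "run ?s3 (inv_word (Uw d)) = start" by (rule run_inv'[OF _ r4']) simp_all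
  show "run start (Ww d) = start" by (simp add: Ww_def run_append r1 r2 r3 r4)
  obtain c where c: "\<And>s. pushy s \<Longrightarrow> even (fst (fst s)) \<Longrightarrow> kapw s (Zw d) = c"
    using kapw_Zw by blast
  have push: "pushy start" by (simp add: pushy_def)
  have "kapw start (Ww d) = kapw start (Zw d) + kapw ?s1 (Uw d) + kapw ?s2 (inv_word (Zw d)) + kapw ?s3 (inv_word (Uw d))"
    by (simp add: Ww_def kapw_append run_append r1 r2 r3 r4)
  also have "kapw ?s2 (inv_word (Zw d)) = - kapw ?s3 (Zw d)" by (rule kapw_inv'[OF _ r3']) simp
  also have "kapw ?s3 (inv_word (Uw d)) = - kapw start (Uw d)" by (rule kapw_inv'[OF _ r4']) simp
  also have "kapw start (Zw d) = c" using c push by simp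
  also have "kapw ?s3 (Zw d) = c" by (rule c) (use push pushy_shift[of start ?u] in \<open>simp_all add: shift_def\<close>)
  also have "kapw ?s1 (Uw d) - kapw start (Uw d) = 2 * ?k * (2 * int q * ?k)"
    using kapw_Uw[of ?s1 d] kapw_Uw[of start d] push pushy_shift[of start ?z]
    by (simp add: shift_def vm_def gp_def)
  then have "c + kapw ?s1 (Uw d) + - c + - kapw start (Uw d) = 4 * int q * ?k^2"
    by (simp add: power2_eq_square)
  finally show "kapw start (Ww d) = 4 * int q * ?k^2" .
qed

lemma kseq_ge: "(2 powr al) ^ d \<le> real (kseq d)"
proof (induction d)
  case (Suc d)
  have "real_of_int (rem d) \<ge> 0" using rem_bounds(1)[of d] by simp
  then have "real q * real (kseq (Suc d)) \<ge> 2 * real p * real (kseq d)"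
    unfolding rem_def by (simp del: kseq.simps)
  then have "2 powr al * real (kseq d) \<le> real (kseq (Suc d))"
    unfolding two_powr_al using q_pos by (simp add: field_simps del: kseq.simps)
  moreover have "2 powr al * (2 powr al) ^ d \<le> 2 powr al * real (kseq d)"
    using Suc by (intro mult_left_mono) auto
  ultimately show ?case unfolding power_Suc by linarith
qed simp

text \<open>The added constant turns the recursion L' \<le> 2 L + 6 + 2q into mere doubling of L + 6
  + 2q.\<close>

lemma length_Zw: "length (Zw d) + 6 + 2 * q \<le> (4 * q + 6) * 2 ^ d"
proof (induction d)
  case (Suc d)
  have "length (gpow 0 (2 * rem d) :: nat word) \<le> 2 * q" using rem_bounds[of d] by (simp add: gpow_def)
  moreover have "(4 * q + 6) * 2 ^ Suc d = 2 * ((4 * q + 6) * 2 ^ d)" by simp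
  moreover have "length (Zw (Suc d)) = 2 * length (Zw d) + 6 + length (gpow 0 (2 * rem d) :: nat word)" by simp
  ultimately show ?case using Suc by linarith
qed (simp add: gpow_def)

lemma length_Ww: "length (Ww d) \<le> 6 * (4 * q + 6) * 2 ^ d"
proof -
  have "length (Ww d) = 6 * length (Zw d) + 12" by (simp add: Ww_def Uw_def Aw_def)
  moreover have "6 * (4 * q + 6) * 2 ^ d = 6 * ((4 * q + 6) * 2 ^ d)" by simp
  ultimately show ?thesis using length_Zw[of d] by linarith
qed

lemma dehn_lower_pow:
  "(2 ^ d) powr (2 * al) \<le> real (dehn_function X RR (6 * (4 * q + 6) * 2 ^ d))"
proof -
  have eq: "pres_eq X RR (Ww d) []" using pres_eq_iff_run[of "Ww d" "[]"] run_Ww[of d] by simp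
  have "4 * int q * (int (kseq d))^2 \<le> int (area X RR (Ww d))"
    using area_ge_kapw[OF _ eq] kapw_Ww[of d] by simp
  also have "int (area X RR (Ww d)) \<le> int (dehn_function X RR (6 * (4 * q + 6) * 2 ^ d))"
    using dehn_function_ge[OF _ _ length_Ww eq] by simp
  finally have "4 * real q * (real (kseq d))^2 \<le> real (dehn_function X RR (6 * (4 * q + 6) * 2 ^ d))"
    by (metis (mono_tags, lifting) of_int_le_iff of_int_mult of_int_numeral of_int_of_nat_eq of_int_power)
  moreover have "1 * (real (kseq d))^2 \<le> 4 * real q * (real (kseq d))^2"
    using q_pos by (intro mult_right_mono) auto
  moreover have "(2 ^ d) powr (2 * al) = ((2 powr al) ^ d)^2"
    by (simp add: powr_powr[symmetric] powr_mult_base mult.commute flip: powr_realpow powr_numeral)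
      (simp add: powr_powr mult.commute mult.left_commute)
  moreover have "((2 powr al) ^ d)^2 \<le> (real (kseq d))^2"
    by (rule power_mono[OF kseq_ge]) simp
  ultimately show ?thesis by linarith
qed

theorem dehn_lower:
  "\<exists>C::nat. C > 0 \<and> (\<forall>n. real n powr (2 * al) \<le> real (dehn_function X RR (C * n)))"
proof -
  have "real n powr (2 * al) \<le> real (dehn_function X RR (12 * (4 * q + 6) * n))" for n
  proof (cases "n = 0")
    case False
    \<comment> \<open>The least power of two that is at least n is at most 2n, which accounts for 12
      in place of 6.\<close>
    define d where "d = (LEAST d. n \<le> 2 ^ d)"
    have d: "n \<le> 2 ^ d" unfolding d_def by (rule LeastI[of _ n]) (simp add: less_imp_le)
    have "2 ^ d \<le> 2 * n"
    proof (cases d)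
      case (Suc e)
      then have "\<not> n \<le> 2 ^ e" using not_less_Least[of e "\<lambda>d. n \<le> 2 ^ d"] by (simp add: d_def)
      then show ?thesis using Suc by simp
    qed (use False in simp)
    then have "6 * (4 * q + 6) * 2 ^ d \<le> 6 * (4 * q + 6) * (2 * n)" by (rule mult_le_mono2)
    then have le: "6 * (4 * q + 6) * 2 ^ d \<le> 12 * (4 * q + 6) * n"
      by (simp only: mult.assoc mult.left_commute[of _ 2])
    have "real n \<le> 2 ^ d" using d by (metis of_nat_le_iff of_nat_numeral of_nat_power)
    then have "real n powr (2 * al) \<le> (2 ^ d) powr (2 * al)"
      using al_gt_1 by (intro powr_mono2) auto
    also have "\<dots> \<le> real (dehn_function X RR (6 * (4 * q + 6) * 2 ^ d))" by (rule dehn_lower_pow)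
    also have "\<dots> \<le> real (dehn_function X RR (12 * (4 * q + 6) * n))"
      using dehn_function_le_iff[of X RR "6 * (4 * q + 6) * 2 ^ d" "dehn_function X RR (12 * (4 * q + 6) * n)"]
        dehn_function_ge[of X _ "12 * (4 * q + 6) * n" RR] le by fastforce
    finally show ?thesis .
  qed simp
  then show ?thesis by (intro exI[of _ "12 * (4 * q + 6)"]) simp
qed

theorem dehn_simeq_powr:
  "dehn_simeq (\<lambda>n. real (dehn_function X RR n)) (\<lambda>n. real n powr (2 * al))"
proof -
  obtain E where E: "0 \<le> E" "\<And>n. real (dehn_function X RR n) \<le> E * real n powr (2 * al)"
    using dehn_upper by blast
  obtain C :: nat where C: "C > 0" "\<And>n. real n powr (2 * al) \<le> real (dehn_function X RR (C * n))"
    using dehn_lower by blast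
  have mono: "dehn_function X RR m \<le> dehn_function X RR n" if "m \<le> n" for m n
    using dehn_function_le_iff[of X RR m "dehn_function X RR n"] dehn_function_ge[of X _ n RR] that
    by fastforce
  define K where "K = nat \<lceil>E\<rceil> + 1"
  have K: "E \<le> real K" "K > 0" by (auto simp: K_def) linarith
  have 1: "real (dehn_function X RR n) \<le> real K * real (K * n + K) powr (2 * al) + real K * real n + real K" for n
  proof -
    have "1 * n \<le> K * n" using K(2) by (intro mult_le_mono1) simp
    then have "real n \<le> real (K * n + K)" by (intro of_nat_mono) linarith
    then have "real n powr (2 * al) \<le> real (K * n + K) powr (2 * al)"
      using al_gt_1 by (rule_tac powr_mono2) simp_all
    then have "E * real n powr (2 * al) \<le> real K * real (K * n + K) powr (2 * al)"
      using K E by (intro mult_mono) auto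
    then show ?thesis using E(2)[of n] by (simp add: add_increasing2)
  qed
  have 2: "real n powr (2 * al) \<le> real C * real (dehn_function X RR (C * n + C)) + real C * real n + real C" for n
  proof -
    have "real (dehn_function X RR (C * n)) \<le> real (dehn_function X RR (C * n + C))"
      using mono[of "C * n" "C * n + C"] by simp
    also have "\<dots> \<le> real C * real (dehn_function X RR (C * n + C))"
      using C(1) by (intro mult_le_cancel_right1[THEN iffD2]) auto
    finally show ?thesis using C(2)[of n] by (simp add: add_increasing2)
  qed
  show ?thesis unfolding dehn_simeq_def dehn_preceq_def using 1 2 K(2) C(1) by blast
qed

end

section \<open>Distortion of cyclic subgroups\<close>

definition conjw :: "'g set \<Rightarrow> 'g word set \<Rightarrow> 'g word \<Rightarrow> 'g word \<Rightarrow> bool" where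
  "conjw S R g g' \<longleftrightarrow> (\<exists>a\<in>words_over S. pres_eq S R g (a @ g' @ inv_word a))"

lemma conjw_trans:
  assumes "conjw S R f g" "conjw S R g h"
  shows "conjw S R f h"
proof -
  obtain a b where a: "a \<in> words_over S" "pres_eq S R f (a @ g @ inv_word a)"
    and b: "b \<in> words_over S" "pres_eq S R g (b @ h @ inv_word b)"
    using assms unfolding conjw_def by blast
  from pres_eq_trans[OF a(2) pres_eq_context[OF b(2), of a "inv_word a"]]
  have "pres_eq S R f ((a @ b) @ h @ inv_word (a @ b))" by simp
  then show ?thesis unfolding conjw_def using a b by (intro bexI[of _ "a @ b"]) auto
qed

lemma conjw_rotate:
  assumes "v \<in> words_over S"
  shows "conjw S R (v @ w) (w @ v)"
proof -
  have "pres_eq S R ((v @ w) @ []) ((v @ w) @ v @ inv_word v)"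
    by (intro pres_eq_append pres_eq_refl pres_eq_sym[OF pres_eq_inv_right] assms)
  then show ?thesis unfolding conjw_def using assms by (intro bexI[of _ v]) auto
qed

lemma conjw_wpow:
  assumes "conjw S R g g'" "g \<in> words_over S" "g' \<in> words_over S"
  shows "\<exists>a\<in>words_over S. \<forall>k. pres_eq S R (wpow g k) (a @ wpow g' k @ inv_word a)"
proof -
  obtain a where a: "a \<in> words_over S" "pres_eq S R g (a @ g' @ inv_word a)"
    using assms unfolding conjw_def by blast
  have "pres_eq S R (wpow g k) (wpow (a @ g' @ inv_word a) k)" for k
  proof -
    have "pres_eq S R (concat (replicate n u)) (concat (replicate n v))" if "pres_eq S R u v" for n u v
      using that by (induction n) (auto intro: pres_eq_append)
    then show ?thesis
      using a assms pres_eq_inv_word[OF a(2)] by (simp add: wpow_def)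
  qed
  then show ?thesis using a wpow_conj assms(3) pres_eq_trans by blast
qed

context rpq
begin

lemma stack_le_length: "length (snd (run s w)) \<le> length (snd s) + length w"
proof (induction w arbitrary: s)
  case (Cons l w)
  have "length (snd (step s l)) \<le> length (snd s) + 1"
    by (auto simp: step_def tstep_def)
  then show ?case using Cons[of "step s l"] by simp
qed simp

section \<open>Cyclic reduction and the growth of the stack\<close>

type_synonym syl = "nat word \<times> vert \<times> bool"

definition sylw :: "syl list \<Rightarrow> nat word" where
  "sylw ss = concat (map (\<lambda>(u, v, e). u @ [(2, e)]) ss)"

definition valid :: "syl list \<Rightarrow> bool" where
  "valid ss \<longleftrightarrow> (\<forall>(u, v, e)\<in>set ss. Der u v)"

lemma sylw_simps [simp]: "sylw [] = []" "sylw ((u, v, e) # ss) = u @ (2, e) # sylw ss"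
  "sylw (ss @ ss') = sylw ss @ sylw ss'"
  and valid_simps [simp]: "valid []" "valid ((u, v, e) # ss) \<longleftrightarrow> Der u v \<and> valid ss"
  "valid (ss @ ss') \<longleftrightarrow> valid ss \<and> valid ss'"
  by (simp_all add: sylw_def valid_def ball_Un)

lemma sylw_words_over: "valid ss \<Longrightarrow> sylw ss \<in> words_over {0, Suc 0, 2}"
proof (induction ss)
  case (Cons a ss)
  obtain u v e where a: "a = (u, v, e)" by (cases a)
  then show ?case using Cons Der_words_over[of u v] by simp
qed simp

lemma syl_decompose:
  assumes "w \<in> words_over X"
  shows "\<exists>ss u v. valid ss \<and> Der u v \<and> w = sylw ss @ u"
  using assms
proof (induction w rule: rev_induct)
  case Nil
  then show ?case by (intro exI[of _ "[]"]) (auto intro: Der.Nil)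
next
  case (snoc l w)
  then obtain ss u v where *: "valid ss" "Der u v" "w = sylw ss @ u" by auto
  show ?case
  proof (cases "fst l = 2")
    case True
    then have "w @ [l] = sylw (ss @ [(u, v, snd l)]) @ []" using * by (cases l) simp
    moreover have "valid (ss @ [(u, v, snd l)])" using * by simp
    ultimately show ?thesis using Der.Nil by blast
  next
    case False
    then have "Der [l] (lval l)" using snoc.prems Der.Letter[of "fst l" "snd l"] by auto
    from Der.App[OF *(2) this] have "Der (u @ [l]) (vm v (lval l))" .
    moreover have "w @ [l] = sylw ss @ (u @ [l])" using * by simp
    ultimately show ?thesis using *(1) by blast
  qed
qed

text \<open>Only the vertex between the two letters t matters, which is that of the second syllable:
  for opposite signs the letters cancel exactly when this vertex lies in the edge group.\<close>

definition pinch :: "syl \<Rightarrow> syl \<Rightarrow> bool" where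
  "pinch a b \<longleftrightarrow> snd (snd b) = (\<not> snd (snd a)) \<and> rep (snd (snd b)) (fst (snd b)) = (0, 0)"

definition okhead :: "state \<Rightarrow> syl \<Rightarrow> bool" where
  "okhead s a \<longleftrightarrow> \<not> poppable (snd (snd a)) (vm (fst s) (fst (snd a))) (snd s)"

lemma rep_gp_vm: "rep e (vm (gp e k) v) = (0, 0) \<longleftrightarrow> rep e v = (0, 0)"
  unfolding rep_eq_0_iff'
  by (metis add.left_inverse gp_0 gp_add vm_0(1) vm_assoc)

text \<open>After a push the vertex lies in an edge group, so whether the next letter t cancels is
  decided by the next syllable alone. Without pinches every letter t is pushed. The syllable c is
  not read; it allows the statement to be iterated.\<close>

lemma run_reduced:
  assumes "successively (\<lambda>a b. \<not> pinch a b) (ss @ [c])" "valid ss" "okst (snd s)" "okhead s (hd (ss @ [c]))"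
  shows "length (snd (run s (sylw ss))) = length (snd s) + length ss \<and> okhead (run s (sylw ss)) c"
  using assms
proof (induction ss arbitrary: s)
  case (Cons a ss)
  obtain u v e where a: "a = (u, v, e)" by (cases a)
  define s' where "s' = tstep e (shift s v)"
  have run: "run s (sylw (a # ss)) = run s' (sylw ss)"
    using Cons.prems Der_run[of u v s] a by (simp add: run_append s'_def step_def)
  have s': "s' = (gp (\<not> e) (idx e (vm (fst s) v)), (e, rep e (vm (fst s) v)) # snd s)"
    using Cons.prems(4) by (simp add: s'_def tstep_def shift_def okhead_def a)
  have "\<not> pinch a (hd (ss @ [c]))" using Cons.prems(1) by (cases ss) auto
  moreover obtain u2 v2 e2 where hd: "hd (ss @ [c]) = (u2, v2, e2)" by (cases "hd (ss @ [c])")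
  ultimately have "okhead s' (hd (ss @ [c]))"
    by (cases "e2 = (\<not> e)") (simp_all add: okhead_def pinch_def a s' poppable_def rep_gp_vm hd)
  moreover have "successively (\<lambda>a b. \<not> pinch a b) (ss @ [c])"
    using Cons.prems(1) by (cases ss) auto
  moreover have "okst (snd s')" using Cons.prems(3) by (simp add: s'_def okst_tstep)
  ultimately show ?case using Cons.IH[of s'] Cons.prems(2) a run s' by simp
qed simp

lemma run_reduced_power:
  assumes "successively (\<lambda>a b. \<not> pinch a b) (ss @ [hd ss])" "valid ss" "ss \<noteq> []"
  shows "n \<le> length (snd (run start (concat (replicate n (sylw ss)))))"
proof -
  have "length (snd (run s (concat (replicate n (sylw ss))))) \<ge> length (snd s) + n"
    if "okst (snd s)" "okhead s (hd ss)" for s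
    using that
  proof (induction n arbitrary: s)
    case (Suc n)
    let ?s = "run s (sylw ss)"
    have *: "length (snd ?s) = length (snd s) + length ss" "okhead ?s (hd ss)"
      using run_reduced[OF assms(1,2) Suc.prems(1)] Suc.prems(2) assms(3) by auto
    have "length ss \<ge> 1" using assms(3) by (cases ss) auto
    then show ?case using Suc.IH[OF okst_run[OF Suc.prems(1)] *(2)] * by (simp add: run_append)
  qed simp
  from this[of start] show ?thesis by (simp add: okhead_def poppable_def)
qed

lemma not_successively_split:
  "\<not> successively P xs \<Longrightarrow> \<exists>ys a b zs. xs = ys @ a # b # zs \<and> \<not> P a b"
proof (induction xs rule: induct_list012)
  case (3 x y zs)
  show ?case
  proof (cases "P x y")
    case True
    then obtain ys a b zs' where "y # zs = ys @ a # b # zs'" "\<not> P a b" using 3 by auto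
    then have "x # y # zs = (x # ys) @ a # b # zs'" by simp
    then show ?thesis using \<open>\<not> P a b\<close> by blast
  next
    case False
    then show ?thesis by (metis append_Nil)
  qed
qed auto

text \<open>A pinch between neighbours in the cyclic order is rotated to the front and becomes, as a
  \<open>Conj\<close>, part of a single vertex word, which removes two syllables. The process ends
  in V or in a cyclically reduced word.\<close>

lemma conjw_elliptic_or_reduced:
  assumes "valid ss" "Der u v"
  shows "(\<exists>u' v'. Der u' v' \<and> conjw X RR (sylw ss @ u) u') \<or>
    (\<exists>ss'. valid ss' \<and> ss' \<noteq> [] \<and> successively (\<lambda>a b. \<not> pinch a b) (ss' @ [hd ss']) \<and>
       conjw X RR (sylw ss @ u) (sylw ss'))"
  using assms
proof (induction "length ss" arbitrary: ss u v rule: less_induct)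
  case less
  have w: "sylw ss \<in> words_over X" "u \<in> words_over X"
    using sylw_words_over[OF less.prems(1)] Der_words_over[OF less.prems(2)] by auto
  show ?case
  proof (cases ss)
    case Nil
    have "conjw X RR u u" using conjw_rotate[of "[]" X RR u] by simp
    then have "Der u v \<and> conjw X RR (sylw ss @ u) u" using less.prems(2) Nil by simp
    then show ?thesis by blast
  next
    case (Cons a0 ss0)
    obtain u0 v0 e0 where a0: "a0 = (u0, v0, e0)" by (cases a0)
    define ss1 where "ss1 = (u @ u0, vm v v0, e0) # ss0"
    have v1: "valid ss1" using less.prems Cons a0 by (auto simp: ss1_def intro: Der.App)
    have c1: "conjw X RR (sylw ss @ u) (sylw ss1)"
      using conjw_rotate[OF w(1), of RR u] Cons a0 by (simp add: ss1_def)
    have len: "length ss1 = length ss" by (simp add: ss1_def Cons)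
    show ?thesis
    proof (cases "successively (\<lambda>a b. \<not> pinch a b) (ss1 @ [hd ss1])")
      case True
      moreover have "ss1 \<noteq> []" by (simp add: ss1_def)
      ultimately show ?thesis using v1 c1 by blast
    next
      case False
      then obtain ys a b zs where split: "ss1 @ [hd ss1] = ys @ a # b # zs" "pinch a b"
        using not_successively_split by blast
      \<comment> \<open>Because of the appended copy of the first syllable, the pinch may wrap
        around. It cannot consist of a syllable and itself, whose sign would be opposite to
        itself.\<close>
      have "\<exists>rest. conjw X RR (sylw ss1) (sylw (a # b # rest)) \<and> valid (a # b # rest) \<and> length ss1 = length rest + 2"
      proof (cases zs rule: rev_cases)
        case Nil
        then have *: "ss1 = ys @ [a]" "b = hd ss1" using split(1) by auto
        show ?thesis
        proof (cases ys)
          case Nil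
          then show ?thesis using * split(2) by (simp add: pinch_def)
        next
          case (Cons y ys')
          then have ss1: "ss1 = b # ys' @ [a]" using * by simp
          have "conjw X RR (sylw (b # ys') @ sylw [a]) (sylw [a] @ sylw (b # ys'))"
            using conjw_rotate sylw_words_over v1 ss1 by (metis append_Cons valid_simps(3) numeral_1_eq_Suc_0 numeral_One)
          then show ?thesis using v1 ss1 sylw_simps(3)[of "b # ys'" "[a]"] sylw_simps(3)[of "[a]" "b # ys'"]
              valid_simps(3)[of "b # ys'" "[a]"] valid_simps(3)[of "[a]" "b # ys'"]
            by (intro exI[of _ ys']) simp
        qed
      next
        case (snoc zs' z)
        then have ss1: "ss1 = ys @ (a # b # zs')" using split(1) by simp
        have "conjw X RR (sylw ys @ sylw (a # b # zs')) (sylw (a # b # zs') @ sylw ys)"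
          using conjw_rotate sylw_words_over v1 ss1 by (metis valid_simps(3) numeral_1_eq_Suc_0 numeral_One)
        then show ?thesis using v1 ss1 sylw_simps(3)[of ys "a # b # zs'"] sylw_simps(3)[of "a # b # zs'" ys]
            valid_simps(3)[of ys "a # b # zs'"] valid_simps(3)[of "a # b # zs'" ys]
          by (intro exI[of _ "zs' @ ys"]) simp
      qed
      then obtain rest where rest: "conjw X RR (sylw ss1) (sylw (a # b # rest))" "valid (a # b # rest)"
        "length ss1 = length rest + 2" by blast
      obtain ua va ea where a: "a = (ua, va, ea)" by (cases a)
      obtain ub vb eb where b: "b = (ub, vb, eb)" by (cases b)
      have eb: "eb = (\<not> ea)" "rep eb vb = (0, 0)" using split(2) by (auto simp: pinch_def a b)
      then obtain k where k: "vb = gp eb k" unfolding rep_eq_0_iff' by blast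
      have "Der ((2, \<not> eb) # ub @ [(2, eb)]) (gp (\<not> eb) k)"
        using rest(2) k by (intro Der.Conj) (simp add: a b)
      then have D: "Der (ua @ (2, ea) # ub @ [(2, eb)]) (vm va (gp (\<not> eb) k))"
        using rest(2) eb Der.App[of ua va] by (simp add: a b)
      let ?u = "ua @ (2, ea) # ub @ [(2, eb)]"
      have "conjw X RR (sylw (a # b # rest)) (sylw rest @ ?u)"
        using conjw_rotate[OF Der_words_over[OF D], of RR "sylw rest"] by (simp add: a b)
      then have c: "conjw X RR (sylw ss @ u) (sylw rest @ ?u)"
        using c1 rest(1) conjw_trans by blast
      have "length rest < length ss" using rest(3) len by simp
      moreover have "valid rest" using rest(2) by (simp add: a b)
      ultimately show ?thesis using less.hyps[OF _ _ D] conjw_trans[OF c] by blast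
    qed
  qed
qed

text \<open>If v contains an odd power of x, the exponent of u may stay bounded in the powers, so it
  is controlled only where \<open>fst v\<close> is 0. In either case one coordinate shows the growth
  for a nontrivial v.\<close>

lemma Der_concat_replicate:
  assumes "Der w v"
  shows "\<exists>v'. Der (concat (replicate n w)) v' \<and> fst v' = int n * fst v \<and>
    (fst v = 0 \<longrightarrow> snd v' = int n * snd v)"
proof (induction n)
  case (Suc n)
  then obtain v' where "Der (concat (replicate n w)) v'" "fst v' = int n * fst v"
    "fst v = 0 \<longrightarrow> snd v' = int n * snd v" by blast
  then have "Der (concat (replicate (Suc n) w)) (vm v v')"
    using Der.App[OF assms] by simp
  then show ?case using \<open>fst v' = _\<close> \<open>_ \<longrightarrow> snd v' = _\<close>
    by (intro exI[of _ "vm v v'"]) (auto simp: vm_def algebra_simps)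
qed (auto intro: Der.Nil)

lemma nat_le_powr_al: "real n \<le> real n powr al"
  using powr_mono[of 1 al "real n"] al_gt_1 by (cases "n = 0") auto

text \<open>Up to conjugation, which is paid for by c, there are two cases. In V, one coordinate of
  the n-th power is at least n in absolute value, and \<open>Bnd\<close> bounds it by the length to
  the power al. A cyclically reduced element forces a stack of height at least n, hence a length of
  at least n.\<close>

theorem power_length_bound:
  assumes "g \<in> words_over X" "\<not> pres_eq X RR g []"
  shows "\<exists>c. \<forall>k w. w \<in> words_over X \<and> pres_eq X RR w (wpow g k) \<longrightarrow>
    \<bar>real_of_int k\<bar> \<le> 2 * real p * (real (length w + c)) powr al"
proof -
  have bound: "\<exists>c. \<forall>n w. w \<in> words_over X \<and> pres_eq X RR w (wpow g (int n)) \<longrightarrow>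
    real n \<le> 2 * real p * (real (length w + c)) powr al"
  proof -
    obtain ss u v where su: "valid ss" "Der u v" "g = sylw ss @ u"
      using syl_decompose assms by blast
    have key: ?thesis if g': "conjw X RR g g'" "g' \<in> words_over X"
      and b: "\<And>n w. w \<in> words_over X \<Longrightarrow> pres_eq X RR w (concat (replicate n g')) \<Longrightarrow>
        real n \<le> 2 * real p * real (length w) powr al" for g'
    proof -
      obtain a where a: "a \<in> words_over X" "\<And>k. pres_eq X RR (wpow g k) (a @ wpow g' k @ inv_word a)"
        using conjw_wpow[OF g'(1) assms(1) g'(2)] by blast
      have "real n \<le> 2 * real p * (real (length w + 2 * length a)) powr al"
        if w: "w \<in> words_over X" "pres_eq X RR w (wpow g (int n))" for n w
      proof -
        let ?w = "inv_word a @ w @ a"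
        have "pres_eq X RR ?w (inv_word a @ (a @ wpow g' (int n) @ inv_word a) @ a)"
          by (rule pres_eq_context[OF pres_eq_trans[OF w(2) a(2)]])
        moreover have "pres_eq X RR ((inv_word a @ a) @ wpow g' (int n) @ (inv_word a @ a)) ([] @ wpow g' (int n) @ [])"
          using a(1) by (intro pres_eq_append pres_eq_inv_left pres_eq_refl)
        ultimately have "pres_eq X RR ?w (concat (replicate n g'))"
          using pres_eq_trans by (fastforce simp: wpow_def)
        from b[OF _ this] a(1) w(1) show ?thesis by (simp add: algebra_simps)
      qed
      then show ?thesis by blast
    qed
    from conjw_elliptic_or_reduced[OF su(1,2)] show ?thesis
    proof (elim disjE exE conjE)
      fix u' v' assume D: "Der u' v'" and c: "conjw X RR (sylw ss @ u) u'"
      have "v' \<noteq> (0, 0)"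
      proof
        assume "v' = (0, 0)"
        then have "pres_eq X RR u' []" using Der_imp_pres_eq_nf[OF D, of True] by (simp add: nf_def ks_def)
        moreover obtain a where a: "a \<in> words_over X" "pres_eq X RR g (a @ u' @ inv_word a)"
          using c su(3) by (auto simp: conjw_def)
        ultimately have "pres_eq X RR g (a @ [] @ inv_word a)"
          using pres_eq_context pres_eq_trans by blast
        also have "pres_eq X RR (a @ [] @ inv_word a) []" using a by (simp add: pres_eq_inv_right)
        finally show False using assms(2) by simp
      qed
      show ?thesis
      proof (rule key)
        show "conjw X RR g u'" "u' \<in> words_over X" using c su(3) Der_words_over[OF D] by auto
        fix n w assume w: "w \<in> words_over X" "pres_eq X RR w (concat (replicate n u'))"
        obtain vn where vn: "Der (concat (replicate n u')) vn" "fst vn = int n * fst v'"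
          "fst v' = 0 \<longrightarrow> snd vn = int n * snd v'"
          using Der_concat_replicate[OF D] by blast
        have "run start w = (vn, [])"
          using run_pres_eq[OF w(2), of start] Der_run[OF vn(1), of start] by (simp add: shift_def)
        then have Dw: "Der w vn" using Der_complete w(1) by blast
        let ?L = "real (length w) powr al"
        have L: "1 * ?L \<le> 2 * real p * ?L" using q_less_p by (intro mult_right_mono) auto
        show "real n \<le> 2 * real p * ?L"
        proof (cases "fst v' = 0")
          case True
          then have "1 \<le> \<bar>snd v'\<bar>" using \<open>v' \<noteq> (0, 0)\<close> by (cases v') auto
          then have "real n * 1 \<le> real n * \<bar>real_of_int (snd v')\<bar>" by (intro mult_left_mono) linarith+
          also have "\<dots> = \<bar>real_of_int (snd vn)\<bar>" using vn True by (simp add: abs_mult)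
          also have "\<dots> \<le> ?L" using Bnd_snd[OF Der_Bnd[OF Dw]] .
          finally show ?thesis using L by simp
        next
          case False
          then have "1 \<le> \<bar>fst v'\<bar>" by auto
          then have "real n * 1 \<le> real n * \<bar>real_of_int (fst v')\<bar>" by (intro mult_left_mono) linarith+
          also have "\<dots> = \<bar>real_of_int (fst vn)\<bar>" using vn by (simp add: abs_mult)
          also have "\<dots> \<le> 2 * real p * ?L" using Bnd_fst[OF Der_Bnd[OF Dw]] .
          finally show ?thesis by simp
        qed
      qed
    next
      fix ss' assume ss': "valid ss'" "ss' \<noteq> []" "successively (\<lambda>a b. \<not> pinch a b) (ss' @ [hd ss'])"
        and c: "conjw X RR (sylw ss @ u) (sylw ss')"
      show ?thesis
      proof (rule key)
        show "conjw X RR g (sylw ss')" "sylw ss' \<in> words_over X"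
          using c su(3) sylw_words_over[OF ss'(1)] by auto
        fix n w assume w: "w \<in> words_over X" "pres_eq X RR w (concat (replicate n (sylw ss')))"
        have "n \<le> length (snd (run start w))"
          using run_reduced_power[OF ss'(3,1,2)] run_pres_eq[OF w(2), of start] by simp
        also have "\<dots> \<le> length w" using stack_le_length[of start w] by simp
        finally have "real n \<le> real (length w)" by simp
        also have "\<dots> \<le> real (length w) powr al" by (rule nat_le_powr_al)
        also have "1 * real (length w) powr al \<le> 2 * real p * real (length w) powr al"
          using q_less_p by (intro mult_right_mono) auto
        finally show "real n \<le> 2 * real p * real (length w) powr al" by simp
      qed
    qed
  qed
  then obtain c where c: "\<And>n w. w \<in> words_over X \<Longrightarrow> pres_eq X RR w (wpow g (int n)) \<Longrightarrow>
    real n \<le> 2 * real p * (real (length w + c)) powr al" by blast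
  have "\<bar>real_of_int k\<bar> \<le> 2 * real p * (real (length w + c)) powr al"
    if w: "w \<in> words_over X" "pres_eq X RR w (wpow g k)" for k w
  proof (cases "k \<ge> 0")
    case True
    then show ?thesis using c[of w "nat k"] w by simp
  next
    case False
    have "pres_eq X RR (inv_word w) (wpow g (int (nat (- k))))"
      using pres_eq_inv_word[OF w(2) w(1)] assms(1) False by (simp add: inv_word_wpow)
    then show ?thesis using c[of "inv_word w" "nat (- k)"] w False by simp
  qed
  then show ?thesis by blast
qed

text \<open>Each further conjugation by h multiplies the exponent by about n / m.\<close>

lemma short_powers:
  fixes m n :: int
  assumes gh: "g \<in> words_over X" "h \<in> words_over X" and mn: "m \<noteq> 0" "\<bar>m\<bar> < \<bar>n\<bar>"
    and eq: "pres_eq X RR (inv_word h @ wpow g m @ h) (wpow g n)"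
  shows "\<exists>(l::real) (C::nat). 1 < l \<and> (\<forall>j. \<exists>w k. w \<in> words_over X \<and> length w \<le> C * (j + 1) \<and>
    l ^ j \<le> \<bar>real_of_int k\<bar> \<and> pres_eq X RR w (wpow g k))"
proof -
  define M where "M = \<bar>m\<bar>"
  \<comment> \<open>As m and n are integers, |n| / M \<ge> 1 + 1 / M. Half of the gain is given away
    to rounding, which suffices once the exponent is at least 2 M; therefore the induction starts at
    2 M.\<close>
  define l where "l = 1 + 1 / (2 * real_of_int M)"
  have M: "M \<ge> 1" using mn by (simp add: M_def)
  have eqs: "pres_eq X RR (inv_word h @ wpow g (m * s) @ h) (wpow g (n * s))" for s
  proof -
    have pw: "pres_eq X RR (wpow (wpow g i) s) (wpow g (i * s))" for i
      using wpow_presented[of g X RR i] wpow_presented[of g X RR "i * s"] wpow_presented[of "wpow g i" X RR s]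
        group.int_pow_pow[OF group_presented, of "cls X RR g" X RR i s] gh
      by (simp add: cls_eq_iff[symmetric])
    have "\<exists>c. eqx c (inv_word h @ wpow g m @ inv_word (inv_word h)) (wpow g n)"
      using eq gh by (intro pres_eq_imp_eqc) auto
    then obtain c where "eqx c (inv_word h @ wpow g m @ inv_word (inv_word h)) (wpow g n)" by blast
    then have "eqx (c * \<bar>real_of_int s\<bar>) (inv_word h @ wpow (wpow g m) s @ inv_word (inv_word h)) (wpow (wpow g n) s)"
      by (rule eqc_conj_wpow) (use gh in auto)
    then have "pres_eq X RR (inv_word h @ wpow (wpow g m) s @ h) (wpow (wpow g n) s)"
      using eqc_imp_pres_eq[OF _ RR_words_over] by simp
    then show ?thesis using pres_eq_trans pw pres_eq_context pres_eq_sym by meson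
  qed
  define C where "C = nat (2 * M * M) * length g + 2 * length h + nat M * length g"
  have "\<exists>s w. s \<ge> 0 \<and> w \<in> words_over X \<and> length w \<le> C * (j + 1) \<and> 2 * M * l ^ j \<le> real_of_int s
     \<and> pres_eq X RR w (wpow g (m * s))" for j
  proof (induction j)
    case 0
    have "nat \<bar>m * (2 * M)\<bar> = nat (2 * M * M)" using M by (simp add: M_def abs_mult mult.commute mult.left_commute)
    then have "length (wpow g (m * (2 * M))) \<le> C" by (simp add: length_wpow C_def)
    then show ?case using gh M by (intro exI[of _ "2 * M"] exI[of _ "wpow g (m * (2 * M))"]) auto
  next
    case (Suc j)
    then obtain s w where s: "s \<ge> 0" "w \<in> words_over X" "length w \<le> C * (j + 1)"
      "2 * M * l ^ j \<le> real_of_int s" "pres_eq X RR w (wpow g (m * s))" by blast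
    \<comment> \<open>Conjugation turns g^(ms) into g^(ns), whose exponent is made a multiple of m
      again: up to the sign e, ns is ms' plus a remainder r with |r| < M, which a word of bounded
      length removes.\<close>
    define s' where "s' = (\<bar>n\<bar> * s) div M"
    define r where "r = sgn n * ((\<bar>n\<bar> * s) mod M)"
    define e where "e = sgn m * sgn n"
    have abs_r: "\<bar>r\<bar> < M" using M by (simp add: r_def abs_mult sgn_if)
    have "M * s' + (\<bar>n\<bar> * s) mod M = \<bar>n\<bar> * s" by (simp add: s'_def)
    then have "sgn n * (\<bar>n\<bar> * s) = sgn n * (M * s' + (\<bar>n\<bar> * s) mod M)" by (simp only:)
    then have "sgn n * (\<bar>n\<bar> * s) = sgn n * M * s' + r" by (simp add: r_def distrib_left)
    moreover have "sgn n * (\<bar>n\<bar> * s) = n * s" by (simp add: mult_sgn_abs flip: mult.assoc)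
    moreover have "sgn n * M = e * m" by (simp add: e_def M_def sgn_if)
    ultimately have ns: "n * s - r = e * (m * s')" by simp
    have ee: "e = 1 \<or> e = -1" using mn by (auto simp: e_def sgn_if)
    let ?v = "(inv_word h @ w @ h) @ wpow g (- r)"
    have "pres_eq X RR ?v ((inv_word h @ wpow g (m * s) @ h) @ wpow g (- r))"
      by (intro pres_eq_append pres_eq_context s pres_eq_refl)
    also have "pres_eq X RR \<dots> (wpow g (n * s) @ wpow g (- r))" by (intro pres_eq_append eqs pres_eq_refl)
    also have "pres_eq X RR \<dots> (wpow g (e * (m * s')))"
      using pres_eq_sym[OF pres_eq_wpow_add[OF gh(1), of RR "n * s" "- r"]] ns by simp
    finally have v: "pres_eq X RR ?v (wpow g (e * (m * s')))" .
    have vw: "?v \<in> words_over X" using gh s by simp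
    have "length ?v \<le> C * (j + 1) + 2 * length h + nat M * length g"
    proof -
      have "nat \<bar>- r\<bar> * length g \<le> nat M * length g" using abs_r by (intro mult_le_mono1) simp
      moreover have "length ?v = length w + 2 * length h + nat \<bar>- r\<bar> * length g"
        by (simp add: length_wpow)
      ultimately show ?thesis using s(3) by linarith
    qed
    moreover have "2 * length h + nat M * length g \<le> C" by (simp add: C_def)
    moreover have "C * (Suc j + 1) = C * (j + 1) + C" by simp
    ultimately have len: "length ?v \<le> C * (Suc j + 1)" by linarith
    have "2 * real_of_int M * l ^ Suc j \<le> real_of_int s'"
    proof -
      have "M * s' > \<bar>n\<bar> * s - M" using M pos_mod_bound[of M "\<bar>n\<bar> * s"] \<open>M * s' + _ = _\<close> by linarith
      moreover have "\<bar>n\<bar> * s \<ge> (M + 1) * s" using mn s(1) by (intro mult_right_mono) (auto simp: M_def)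
      ultimately have "M * s' \<ge> M * s + s - M" by (simp add: algebra_simps)
      then have "real_of_int (M * s') \<ge> real_of_int (M * s + s - M)" by (simp only: of_int_le_iff)
      then have a: "real_of_int s' \<ge> real_of_int s + real_of_int s / M - 1"
        using M by (simp add: field_simps)
      have l1: "1 \<le> l" using M by (simp add: l_def)
      have "2 * real_of_int M * 1 \<le> 2 * real_of_int M * l ^ j"
        using l1 M by (intro mult_left_mono one_le_power) auto
      then have "2 * real_of_int M \<le> real_of_int s" using s(4) by simp
      then have "real_of_int s / M - 1 \<ge> real_of_int s / (2 * M)" using M by (simp add: field_simps)
      with a have "real_of_int s' \<ge> l * real_of_int s" by (simp add: l_def algebra_simps)
      moreover have "l * (2 * real_of_int M * l ^ j) \<le> l * real_of_int s"
        using s(4) l1 by (intro mult_left_mono) auto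
      ultimately show ?thesis by (simp add: algebra_simps)
    qed
    then have grow: "real_of_int (2 * M) * l ^ Suc j \<le> real_of_int s'" by simp
    have s'0: "s' \<ge> 0" using s(1) M by (simp add: s'_def pos_imp_zdiv_nonneg_iff)
    have "\<exists>w'. w' \<in> words_over X \<and> length w' \<le> C * (Suc j + 1) \<and> pres_eq X RR w' (wpow g (m * s'))"
    proof (cases "e = 1")
      case True
      then show ?thesis using v vw len by (intro exI[of _ ?v]) simp
    next
      case False
      then have "e = -1" using ee by simp
      then have "pres_eq X RR (inv_word ?v) (wpow g (m * s'))"
        using pres_eq_inv_word[OF v vw] gh by (simp add: inv_word_wpow)
      moreover have "length (inv_word ?v) \<le> C * (Suc j + 1)" using len by (simp only: length_inv_word)
      ultimately show ?thesis using vw by (intro exI[of _ "inv_word ?v"]) simp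
    qed
    then obtain w' where w': "w' \<in> words_over X" "length w' \<le> C * (Suc j + 1)"
      "pres_eq X RR w' (wpow g (m * s'))" by (elim exE conjE)
    show ?case by (rule exI[of _ s'], rule exI[of _ w'], intro conjI s'0 w' grow)
  qed
  note main = this
  have "\<exists>w k. w \<in> words_over X \<and> length w \<le> C * (j + 1) \<and> l ^ j \<le> \<bar>real_of_int k\<bar> \<and> pres_eq X RR w (wpow g k)" for j
  proof -
    obtain s w where s: "s \<ge> 0" "w \<in> words_over X" "length w \<le> C * (j + 1)"
      "2 * M * l ^ j \<le> real_of_int s" "pres_eq X RR w (wpow g (m * s))" using main by blast
    have "1 * l ^ j \<le> 2 * M * l ^ j" using M by (intro mult_right_mono) (auto simp: l_def)
    also have "\<dots> \<le> 1 * real_of_int s" using s by simp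
    also have "\<dots> \<le> \<bar>real_of_int m\<bar> * real_of_int s"
      using mn s(1) by (intro mult_right_mono) auto
    finally have "l ^ j \<le> \<bar>real_of_int (m * s)\<bar>" using s(1) by (simp add: abs_mult)
    then show ?thesis using s by blast
  qed
  moreover have "1 < l" using M by (simp add: l_def)
  ultimately show ?thesis by blast
qed

lemma conjugate_powers:
  fixes m n :: int
  assumes gh: "g \<in> words_over X" "h \<in> words_over X" and mn: "m \<noteq> 0" "n \<noteq> 0" "\<bar>m\<bar> \<noteq> \<bar>n\<bar>"
    and eq: "pres_eq X RR (inv_word h @ wpow g m @ h) (wpow g n)"
  shows "pres_eq X RR g []"
proof (rule ccontr)
  assume "\<not> pres_eq X RR g []"
  then obtain c where c: "\<And>k w. w \<in> words_over X \<Longrightarrow> pres_eq X RR w (wpow g k) \<Longrightarrow>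
    \<bar>real_of_int k\<bar> \<le> 2 * real p * (real (length w + c)) powr al"
    using power_length_bound[OF gh(1)] by blast
  have "\<exists>(l::real) (C::nat). 1 < l \<and> (\<forall>j. \<exists>w k. w \<in> words_over X \<and> length w \<le> C * (j + 1) \<and>
    l ^ j \<le> \<bar>real_of_int k\<bar> \<and> pres_eq X RR w (wpow g k))"
  proof (cases "\<bar>m\<bar> < \<bar>n\<bar>")
    case True
    then show ?thesis using short_powers[OF gh mn(1) _ eq] by blast
  next
    \<comment> \<open>Conjugation by the inverse of h exchanges m and n.\<close>
    case False
    have "pres_eq X RR (h @ (inv_word h @ wpow g m @ h) @ inv_word h) (h @ wpow g n @ inv_word h)"
      by (rule pres_eq_context[OF eq])
    moreover have "pres_eq X RR ((h @ inv_word h) @ wpow g m @ (h @ inv_word h)) ([] @ wpow g m @ [])"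
      using gh by (intro pres_eq_append pres_eq_inv_right pres_eq_refl)
    ultimately have "pres_eq X RR (inv_word (inv_word h) @ wpow g n @ inv_word h) (wpow g m)"
      by simp (rule pres_eq_trans[OF pres_eq_sym])
    then show ?thesis using short_powers[of g "inv_word h" n m] gh mn False by simp
  qed
  then obtain l :: real and C :: nat where l: "1 < l"
    and w: "\<And>j. \<exists>w k. w \<in> words_over X \<and> length w \<le> C * (j + 1) \<and>
    l ^ j \<le> \<bar>real_of_int k\<bar> \<and> pres_eq X RR w (wpow g k)" by blast
  have upper: "l ^ j \<le> 2 * real p * ((real C + real c + 1) * (real j + 1)) powr al" for j
  proof -
    obtain w k where *: "w \<in> words_over X" "length w \<le> C * (j + 1)"
      "l ^ j \<le> \<bar>real_of_int k\<bar>" "pres_eq X RR w (wpow g k)" using w by blast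
    have "real (length w + c) \<le> real (C * (j + 1)) + real c" using *(2) by (simp del: of_nat_mult)
    also have "\<dots> \<le> (real C + real c + 1) * (real j + 1)" by (simp add: algebra_simps)
    finally have "(real (length w + c)) powr al \<le> ((real C + real c + 1) * (real j + 1)) powr al"
      using al_gt_1 by (intro powr_mono2) auto
    then have "2 * real p * (real (length w + c)) powr al \<le> 2 * real p * ((real C + real c + 1) * (real j + 1)) powr al"
      by (intro mult_left_mono) auto
    then show ?thesis using c[OF *(1,4)] *(3) by linarith
  qed
  define K where "K = real C + real c + 1"
  have K: "K > 0" by (simp add: K_def)
  have p: "real p > 0" using q_less_p by simp
  have "(\<lambda>j::nat. 2 * real p * (K * (real j + 1)) powr al / l ^ j) \<longlonglongrightarrow> 0"
    using K l al_gt_1 p by real_asymp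
  then have "eventually (\<lambda>j. 2 * real p * (K * (real j + 1)) powr al / l ^ j < 1) sequentially"
    by (rule order_tendstoD) simp
  then obtain j where "2 * real p * (K * (real j + 1)) powr al / l ^ j < 1"
    by (auto simp: eventually_sequentially)
  then show False using upper[of j] l by (simp add: K_def field_simps)
qed

end

section \<open>Baumslag--Solitar subgroups\<close>

text \<open>A homomorphism is determined by words for the images of the generators. It is phrased as
  a substitution so that the relation of the source can be transported letter by letter.\<close>

lemma hom_on_words:
  fixes h :: "'g word set \<Rightarrow> 'h word set"
  assumes h: "h \<in> hom (presented_group S R) (presented_group S' R')"
  shows "\<exists>f. (\<forall>s\<in>S. f s \<in> words_over S' \<and> h (cls S R [(s, False)]) = cls S' R' (f s)) \<and>
    (\<forall>w\<in>words_over S. h (cls S R w) = cls S' R' (concat (map (\<lambda>(s, b). if b then inv_word (f s) else f s) w)))"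
proof -
  interpret H: group_hom "presented_group S R" "presented_group S' R'" h
    using h by (simp add: group_hom_def group_hom_axioms_def group_presented)
  have "\<forall>s\<in>S. \<exists>v. v \<in> words_over S' \<and> h (cls S R [(s, False)]) = cls S' R' v"
  proof
    fix s assume "s \<in> S"
    then have "cls S R [(s, False)] \<in> carrier (presented_group S R)" by simp
    then have "h (cls S R [(s, False)]) \<in> carrier (presented_group S' R')" by (rule H.hom_closed)
    then show "\<exists>v. v \<in> words_over S' \<and> h (cls S R [(s, False)]) = cls S' R' v"
      unfolding carrier_presented by blast
  qed
  from bchoice[OF this] obtain f
    where f': "\<forall>s\<in>S. f s \<in> words_over S' \<and> h (cls S R [(s, False)]) = cls S' R' (f s)" ..
  note f = f'[rule_format]
  let ?t = "\<lambda>(s, b). if b then inv_word (f s) else f s"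
  have *: "concat (map ?t w) \<in> words_over S' \<and> h (cls S R w) = cls S' R' (concat (map ?t w))"
    if "w \<in> words_over S" for w
    using that
  proof (induction w)
    case Nil
    then show ?case using H.hom_one by (simp add: one_presented)
  next
    case (Cons l w)
    obtain s b where l: "l = (s, b)" by (cases l)
    have s: "s \<in> S" using Cons.prems l by simp
    have "h (cls S R [l]) = cls S' R' (?t l)"
    proof (cases b)
      case True
      have "cls S R [l] = inv\<^bsub>presented_group S R\<^esub> (cls S R [(s, False)])"
        using s True l by (simp add: inv_presented)
      then show ?thesis using s f[OF s] True l H.hom_inv[of "cls S R [(s, False)]"] by (simp add: inv_presented)
    qed (use f[OF s] l in simp)
    moreover have "cls S R (l # w) = cls S R [l] \<otimes>\<^bsub>presented_group S R\<^esub> cls S R w"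
      using Cons.prems mult_presented[of "[l]" S w R] by simp
    moreover have "h (cls S R [l] \<otimes>\<^bsub>presented_group S R\<^esub> cls S R w)
        = h (cls S R [l]) \<otimes>\<^bsub>presented_group S' R'\<^esub> h (cls S R w)"
      using Cons.prems by (intro H.hom_mult) auto
    ultimately have 1: "h (cls S R (l # w)) = cls S' R' (?t l) \<otimes>\<^bsub>presented_group S' R'\<^esub> h (cls S R w)"
      by (simp only:)
    have tl: "?t l \<in> words_over S'" using f[OF s] by (simp add: l)
    have "w \<in> words_over S" using Cons.prems by simp
    note IH = Cons.IH[OF this]
    have "cls S' R' (?t l) \<otimes>\<^bsub>presented_group S' R'\<^esub> h (cls S R w) = cls S' R' (?t l @ concat (map ?t w))"
      unfolding conjunct2[OF IH] by (rule mult_presented[OF tl conjunct1[OF IH]])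
    with 1 have "h (cls S R (l # w)) = cls S' R' (concat (map ?t (l # w)))" by (simp only: list.map concat.simps)
    then show ?case using tl conjunct1[OF IH] by (simp only: list.map concat.simps words_over_append simp_thms)
  qed
  show ?thesis by (rule exI[of _ f], rule conjI[OF f'], rule ballI, rule conjunct2[OF *])
qed

definition BS_rel :: "int \<Rightarrow> int \<Rightarrow> nat word" where
  "BS_rel m n = [(1, True)] @ gpow 0 m @ [(1, False)] @ inv_word (gpow 0 n)"

lemma BS_group_eq: "BS_group m n = presented_group {0, 1} {BS_rel m n}"
  by (simp add: BS_group_def BS_rel_def)

text \<open>BS(m, n) acts on the reals by affine maps, a as the unit translation and t as a homothety.\<close>

lemma BS_a_nontrivial:
  assumes "m \<noteq> 0" "n \<noteq> 0"
  shows "\<not> pres_eq {0, 1} {BS_rel m n} [(0, False)] []"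
proof
  define c where "c = real_of_int n / real_of_int m"
  have c: "c \<noteq> 0" "c * real_of_int m = real_of_int n" using assms by (auto simp: c_def)
  define act :: "real \<Rightarrow> nat letter \<Rightarrow> real" where
    "act = (\<lambda>x l. if fst l = 0 then (if snd l then x - 1 else x + 1) else (if snd l then x / c else x * c))"
  have rep: "foldl act x (replicate k (0, b)) = x + (if b then - real k else real k)" for x k b
    by (induction k arbitrary: x) (auto simp: act_def)
  have gp: "foldl act x (gpow 0 k) = x + real_of_int k" for x k
    by (auto simp: gpow_def rep)
  have ig: "inv_word (gpow 0 n) = (gpow 0 (- n) :: nat word)" by (simp add: gpow_eq_wpow inv_word_wpow)
  have rel: "foldl act x (BS_rel m n) = x" for x
    using c by (simp add: BS_rel_def gp ig) (simp add: act_def field_simps)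
  assume "pres_eq {0, 1} {BS_rel m n} [(0, False)] []"
  then have "foldl act 0 [(0, False)] = foldl act 0 []"
    by (rule pres_eq_invariant[rotated 2]) (use c rel in \<open>auto simp: act_def\<close>)
  then show False by (simp add: act_def)
qed

context rpq
begin

text \<open>An embedding sends the relation of BS(m, n) to a conjugacy between the m-th and the n-th
  power of the image of a. That image is then trivial by \<open>conjugate_powers\<close>, whereas a
  is not.\<close>

theorem no_BS_subgroup:
  fixes m n :: int
  assumes mn: "m \<noteq> 0" "n \<noteq> 0" "\<bar>m\<bar> \<noteq> \<bar>n\<bar>"
  shows "\<not> (\<exists>H. subgroup H (Rpq p q) \<and> BS_group m n \<cong> (Rpq p q)\<lparr>carrier := H\<rparr>)"
proof
  let ?S = "{0, 1 :: nat}" and ?R = "{BS_rel m n}"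
  assume "\<exists>H. subgroup H (Rpq p q) \<and> BS_group m n \<cong> (Rpq p q)\<lparr>carrier := H\<rparr>"
  then obtain H h where H: "subgroup H (Rpq p q)" "h \<in> iso (BS_group m n) ((Rpq p q)\<lparr>carrier := H\<rparr>)"
    by (auto simp: is_iso_def)
  have "H \<subseteq> carrier (Rpq p q)" using H(1) by (rule subgroup.subset)
  then have hom: "h \<in> hom (presented_group ?S ?R) (presented_group X RR)"
    and inj: "inj_on h (carrier (presented_group ?S ?R))"
  proof -
    have "h \<in> hom (BS_group m n) ((Rpq p q)\<lparr>carrier := H\<rparr>)" "inj_on h (carrier (BS_group m n))"
      using H(2) by (simp_all add: iso_def bij_betw_def)
    then show "h \<in> hom (presented_group ?S ?R) (presented_group X RR)"
      "inj_on h (carrier (presented_group ?S ?R))"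
      using \<open>H \<subseteq> _\<close> unfolding BS_group_eq Rpq_def hom_def by force+
  qed
  from hom_on_words[OF hom] obtain f
    where f: "\<forall>s\<in>?S. f s \<in> words_over X \<and> h (cls ?S ?R [(s, False)]) = cls X RR (f s)"
    and hw': "\<forall>w\<in>words_over ?S. h (cls ?S ?R w) = cls X RR (concat (map (\<lambda>(s, b). if b then inv_word (f s) else f s) w))"
    by (elim exE conjE)
  note hw = bspec[OF hw']
  let ?t = "\<lambda>w. concat (map (\<lambda>(s, b). if b then inv_word (f s) else f s) w)"
  have tg: "?t (gpow 0 k) = wpow (f 0) k" for k by (simp add: gpow_def wpow_def)
  have wf: "f 0 \<in> words_over X" "f 1 \<in> words_over X" using bspec[OF f, of 0] bspec[OF f, of 1] by simp_all
  have eq: "pres_eq ?S ?R ([(1, True)] @ gpow 0 m @ [(1, False)]) (gpow 0 n)"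
    using pres_eq_relator[of "BS_rel m n" ?R ?S] pres_eq_iff_inv[of "gpow 0 n" ?S ?R "[(1, True)] @ gpow 0 m @ [(1, False)]"]
    by (simp add: BS_rel_def gpow_def)
  have w: "[(1, True)] @ gpow 0 m @ [(1, False)] \<in> words_over ?S" "gpow 0 n \<in> words_over ?S"
    by (auto simp: gpow_def)
  have "cls ?S ?R ([(1, True)] @ gpow 0 m @ [(1, False)]) = cls ?S ?R (gpow 0 n)"
    using eq w by (simp add: cls_eq_iff)
  then have "cls X RR (?t ([(1, True)] @ gpow 0 m @ [(1, False)])) = cls X RR (?t (gpow 0 n))"
    using hw[OF w(1)] hw[OF w(2)] by simp
  then have "cls X RR (inv_word (f 1) @ wpow (f 0) m @ f 1) = cls X RR (wpow (f 0) n)"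
    by (simp only: map_append concat_append tg) simp
  then have "pres_eq X RR (inv_word (f 1) @ wpow (f 0) m @ f 1) (wpow (f 0) n)"
    using wf by (subst (asm) cls_eq_iff) auto
  from conjugate_powers[OF wf mn this] have "pres_eq X RR (f 0) []" .
  then have "cls X RR (f 0) = cls X RR []" using wf by (subst cls_eq_iff) auto
  then have "h (cls ?S ?R [(0, False)]) = h (cls ?S ?R [])" using hw[of "[(0, False)]"] hw[of "[]"] by simp
  then have "cls ?S ?R [(0, False)] = cls ?S ?R []"
    by (rule inj_onD[OF inj]) simp_all
  then show False using BS_a_nontrivial[OF mn(1,2)] by (simp add: cls_eq_iff)
qed

end

section \<open>Automatic groups have quadratic Dehn functions\<close>

definition opt_list :: "'c option \<Rightarrow> 'c list" where
  "opt_list x = (case x of None \<Rightarrow> [] | Some a \<Rightarrow> [a])"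

text \<open>Padding is allowed in any place, since prefixes of paths in the automaton, and the
  continuations chosen for its states, need not be of the form \<open>pad u v\<close>.\<close>

definition unpad :: "'c option list \<Rightarrow> 'c list" where
  "unpad xs = concat (map opt_list xs)"

lemma unpad_append [simp]: "unpad (xs @ ys) = unpad xs @ unpad ys"
  and unpad_Nil [simp]: "unpad [] = []"
  and unpad_Some [simp]: "unpad (map Some u) = u"
  and unpad_None [simp]: "unpad (replicate n None) = []"
  by (simp_all add: unpad_def) (induction u; simp add: opt_list_def; fail | induction n; simp add: opt_list_def)+

lemma length_pad: "length (pad u v) = max (length u) (length v)"
  by (simp add: pad_def Let_def)

lemma map_pad:
  "map fst (pad u v) = map Some u @ replicate (max (length u) (length v) - length u) None"
  "map snd (pad u v) = map Some v @ replicate (max (length u) (length v) - length v) None"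
  by (simp_all add: pad_def Let_def)

lemma unpad_pad [simp]: "unpad (map fst (pad u v)) = u" "unpad (map snd (pad u v)) = v"
  by (simp_all add: map_pad)

lemma pres_eq_imp_uniform_eqc:
  assumes "finite I" "R \<subseteq> words_over S"
    and "\<And>i. i \<in> I \<Longrightarrow> P i \<Longrightarrow> f i \<in> words_over S \<and> pres_eq S R (f i) (g i)"
  shows "\<exists>K\<ge>0. \<forall>i\<in>I. P i \<longrightarrow> eqc S R K (f i) (g i)"
proof -
  have "\<forall>i\<in>{i \<in> I. P i}. \<exists>c. eqc S R c (f i) (g i)"
    using assms(3) pres_eq_imp_eqc[OF _ _ assms(2)] by blast
  from bchoice[OF this] obtain c where c: "\<forall>i\<in>{i \<in> I. P i}. eqc S R (c i) (f i) (g i)" ..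
  let ?K = "\<Sum>i\<in>{i \<in> I. P i}. c i"
  have nn: "\<And>i. i \<in> {i \<in> I. P i} \<Longrightarrow> 0 \<le> c i" using c eqc_nonneg by blast
  have "0 \<le> ?K" by (rule sum_nonneg[OF nn])
  moreover have "eqc S R ?K (f i) (g i)" if "i \<in> I" "P i" for i
  proof (rule eqc_mono)
    show "eqc S R (c i) (f i) (g i)" using c that by blast
    show "c i \<le> ?K" by (rule member_le_sum) (use that nn assms(1) in auto)
  qed
  ultimately show ?thesis by blast
qed

locale automatic_structure =
  fixes S :: "'g set" and R :: "'g word set" and A :: "nat set" and L :: "nat list set"
    and wrd :: "nat \<Rightarrow> 'g word"
  assumes fin_S: "finite S" and R_over: "R \<subseteq> words_over S" and fin_A: "finite A"
    and wrd_over: "\<And>a. a \<in> A \<Longrightarrow> wrd a \<in> words_over S"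
    and L_over: "L \<subseteq> lists A"
    and onto: "\<And>w. w \<in> words_over S \<Longrightarrow> \<exists>u\<in>L. pres_eq S R (concat (map wrd u)) w"
begin

definition W :: "nat list \<Rightarrow> 'g word" where
  "W u = concat (map wrd u)"

lemma W_append [simp]: "W (u @ v) = W u @ W v" and W_Nil [simp]: "W [] = []"
  by (simp_all add: W_def)

lemma W_over: "u \<in> lists A \<Longrightarrow> W u \<in> words_over S"
  using wrd_over by (auto simp: W_def)

abbreviation "PA \<equiv> (insert None (Some ` A)) \<times> (insert None (Some ` A))"

lemma unpad_over:
  assumes "P \<in> lists PA"
  shows "unpad (map fst P) \<in> lists A" "unpad (map snd P) \<in> lists A"
  using assms
  by (induction P) (auto simp: unpad_def opt_list_def split: option.splits)

definition comparison :: "'g word \<Rightarrow> (nat option \<times> nat option) list set" where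
  "comparison \<gamma> = {pad u v | u v. u \<in> L \<and> v \<in> L \<and> pres_eq S R (W u @ \<gamma>) (W v)}"

text \<open>The difference of the prefixes read so far depends only on the state, because a fixed
  continuation from that state to an accepting one determines it.\<close>

lemma fellow_travel_cost:
  assumes reg: "regular_lang PA (comparison \<gamma>)" and \<gamma>: "\<gamma> \<in> words_over S"
  shows "\<exists>K\<ge>0. \<forall>u\<in>L. \<forall>v\<in>L. pres_eq S R (W u @ \<gamma>) (W v) \<longrightarrow>
    eqc S R (K * real (max (length u) (length v) + 1)) (W u @ \<gamma>) (W v)"
proof -
  obtain Q :: "nat set" and q0 \<delta> F where aut: "finite Q" "q0 \<in> Q" "F \<subseteq> Q"
    "\<forall>q\<in>Q. \<forall>c\<in>PA. \<delta> q c \<in> Q" and lang: "comparison \<gamma> = {w \<in> lists PA. foldl \<delta> q0 w \<in> F}"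
    using reg unfolding regular_lang_def by (elim conjE exE)
  have finPA: "finite PA" using fin_A by simp
  define co where "co q = (SOME e. e \<in> lists PA \<and> foldl \<delta> q e \<in> F)" for q
  define live where "live q \<longleftrightarrow> (\<exists>e\<in>lists PA. foldl \<delta> q e \<in> F)" for q
  have co: "co q \<in> lists PA \<and> foldl \<delta> q (co q) \<in> F" if "live q" for q
    unfolding co_def by (rule someI_ex) (use that in \<open>auto simp: live_def\<close>)
  define W1 where "W1 P = W (unpad (map fst P))" for P :: "(nat option \<times> nat option) list"
  define W2 where "W2 P = W (unpad (map snd P))" for P :: "(nat option \<times> nat option) list"
  have W12: "W1 P \<in> words_over S" "W2 P \<in> words_over S" if "P \<in> lists PA" for P
    using unpad_over[OF that] W_over by (simp_all add: W1_def W2_def)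
  have W12_app: "W1 (P @ P') = W1 P @ W1 P'" "W2 (P @ P') = W2 P @ W2 P'" for P P'
    by (simp_all add: W1_def W2_def)
  define d where "d q = W1 (co q) @ \<gamma> @ inv_word (W2 (co q))" for q
  have d_over: "d q \<in> words_over S" if "live q" for q
    using co[OF that] W12 \<gamma> by (simp add: d_def)
  have acc: "pres_eq S R (W1 P @ \<gamma>) (W2 P)" if "P \<in> lists PA" "foldl \<delta> q0 P \<in> F" for P
  proof -
    have "P \<in> comparison \<gamma>" using that lang by blast
    then show ?thesis by (auto simp: comparison_def W1_def W2_def)
  qed
  have diff: "pres_eq S R (W1 P @ d (foldl \<delta> q0 P)) (W2 P)"
    if P: "P \<in> lists PA" "live (foldl \<delta> q0 P)" for P
  proof -
    let ?q = "foldl \<delta> q0 P"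
    have "P @ co ?q \<in> lists PA" "foldl \<delta> q0 (P @ co ?q) \<in> F" using co[OF P(2)] P(1) by auto
    from acc[OF this] have "pres_eq S R (W1 P @ W1 (co ?q) @ \<gamma>) (W2 P @ W2 (co ?q))"
      by (simp add: W12_app)
    from pres_eq_append[OF this pres_eq_refl, of "inv_word (W2 (co ?q))"]
    have "pres_eq S R (W1 P @ d ?q) (W2 P @ W2 (co ?q) @ inv_word (W2 (co ?q)))" by (simp add: d_def)
    also have "pres_eq S R (W2 P @ W2 (co ?q) @ inv_word (W2 (co ?q))) (W2 P @ [])"
      using co[OF P(2)] W12 by (intro pres_eq_append pres_eq_refl pres_eq_inv_right) auto
    finally show ?thesis by simp
  qed
  have reachQ: "foldl \<delta> q P \<in> Q" if "q \<in> Q" "P \<in> lists PA" for q P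
    using that(2,1) by (induction P arbitrary: q) (use aut(4) in auto)
  \<comment> \<open>Reachability enters because the equation for \<open>d\<close> is obtained by
    cancelling a prefix P that leads to q. There are finitely many pairs of a state and a letter,
    which makes the cost uniform.\<close>
  define good where "good q c \<longleftrightarrow> (\<exists>P\<in>lists PA. foldl \<delta> q0 P = q \<and> live q \<and> live (\<delta> q c))" for q c
  have trans: "d q @ W2 [c] \<in> words_over S \<and> pres_eq S R (d q @ W2 [c]) (W1 [c] @ d (\<delta> q c))"
    if c: "c \<in> PA" and g: "good q c" for q c
  proof -
    obtain P where P: "P \<in> lists PA" "foldl \<delta> q0 P = q" "live q" "live (\<delta> q c)"
      using g by (auto simp: good_def)
    have c': "[c] \<in> lists PA" using c by simp
    have 1: "pres_eq S R (W1 P @ d q) (W2 P)" using diff[OF P(1)] P by simp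
    have 2: "pres_eq S R (W1 (P @ [c]) @ d (\<delta> q c)) (W2 (P @ [c]))"
      using diff[of "P @ [c]"] P c by simp
    have "pres_eq S R (W1 P @ (d q @ W2 [c])) (W2 P @ W2 [c])"
      using pres_eq_append[OF 1 pres_eq_refl, of "W2 [c]"] by simp
    also have "pres_eq S R (W2 P @ W2 [c]) (W1 P @ (W1 [c] @ d (\<delta> q c)))"
      using pres_eq_sym[OF 2] by (simp add: W12_app)
    finally have "pres_eq S R (d q @ W2 [c]) (W1 [c] @ d (\<delta> q c))"
      by (rule pres_eq_cancel_left) (rule W12[OF P(1)])
    then show ?thesis using d_over[OF P(3)] W12[OF c'] by simp
  qed
  have "\<exists>K\<ge>0. \<forall>i\<in>Q \<times> PA. good (fst i) (snd i) \<longrightarrow>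
      eqc S R K (d (fst i) @ W2 [snd i]) (W1 [snd i] @ d (\<delta> (fst i) (snd i)))"
    by (rule pres_eq_imp_uniform_eqc[OF _ R_over])
      (use aut(1) finPA trans in \<open>auto simp only: finite_cartesian_product mem_Times_iff\<close>)
  then obtain K where K: "K \<ge> 0" "\<And>q c. q \<in> Q \<Longrightarrow> c \<in> PA \<Longrightarrow> good q c \<Longrightarrow>
      eqc S R K (d q @ W2 [c]) (W1 [c] @ d (\<delta> q c))" by force
  have travel: "eqc S R (K * real (length P)) (d q0 @ W2 P) (W1 P @ d (foldl \<delta> q0 P))"
    if "P \<in> lists PA" "live (foldl \<delta> q0 P)" for P
    using that
  proof (induction P rule: rev_induct)
    case (snoc c P)
    let ?q = "foldl \<delta> q0 P"
    have P: "P \<in> lists PA" "c \<in> PA" using snoc.prems(1) by auto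
    have l2: "live (\<delta> ?q c)" using snoc.prems(2) by simp
    then obtain e where "e \<in> lists PA" "foldl \<delta> (\<delta> ?q c) e \<in> F" by (auto simp: live_def)
    then have l1: "live ?q" unfolding live_def using P(2) by (intro bexI[of _ "c # e"]) auto
    have "good ?q c" using P l1 l2 by (auto simp: good_def)
    have "eqc S R (K * real (length P)) ([] @ (d q0 @ W2 P) @ W2 [c]) ([] @ (W1 P @ d ?q) @ W2 [c])"
      by (rule eqc_context[OF snoc.IH[OF P(1) l1]]) simp
    moreover have "eqc S R K (W1 P @ (d ?q @ W2 [c]) @ []) (W1 P @ (W1 [c] @ d (\<delta> ?q c)) @ [])"
      by (rule eqc_context[OF K(2)[OF reachQ[OF aut(2) P(1)] P(2) \<open>good ?q c\<close>]]) (rule W12[OF P(1)])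
    ultimately have "eqc S R (K * real (length P) + K) (d q0 @ W2 P @ W2 [c]) (W1 P @ W1 [c] @ d (\<delta> ?q c))"
      using eqc_trans by fastforce
    then show ?case by (simp add: W12_app algebra_simps)
  qed (simp add: W1_def W2_def)
  have "\<exists>K\<ge>0. \<forall>q\<in>{q0}. live q \<longrightarrow> eqc S R K (d q) []"
  proof (rule pres_eq_imp_uniform_eqc[OF _ R_over])
    fix q assume "q \<in> {q0}" "live q"
    then show "d q \<in> words_over S \<and> pres_eq S R (d q) []"
      using d_over diff[of "[]"] by (simp add: W1_def W2_def)
  qed simp
  then obtain K0 where K0: "K0 \<ge> 0" "live q0 \<Longrightarrow> eqc S R K0 (d q0) []" by blast
  have "\<exists>K\<ge>0. \<forall>q\<in>F. (\<exists>P\<in>lists PA. foldl \<delta> q0 P = q) \<longrightarrow> eqc S R K (d q) \<gamma>"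
  proof (rule pres_eq_imp_uniform_eqc[OF _ R_over])
    show "finite F" using aut(1,3) finite_subset by blast
    fix q assume q: "q \<in> F" "\<exists>P\<in>lists PA. foldl \<delta> q0 P = q"
    then obtain P where P: "P \<in> lists PA" "foldl \<delta> q0 P = q" by blast
    have live: "live q" unfolding live_def using q(1) by (intro bexI[of _ "[]"]) auto
    have "pres_eq S R (W1 P @ d q) (W2 P)" using diff[OF P(1)] P(2) live by simp
    also have "pres_eq S R (W2 P) (W1 P @ \<gamma>)" using acc[OF P(1)] P(2) q(1) pres_eq_sym by blast
    finally have "pres_eq S R (d q) \<gamma>" by (rule pres_eq_cancel_left) (rule W12[OF P(1)])
    then show "d q \<in> words_over S \<and> pres_eq S R (d q) \<gamma>" using d_over[OF live] by simp
  qed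
  then obtain K1 where K1: "K1 \<ge> 0" "\<And>P. P \<in> lists PA \<Longrightarrow> foldl \<delta> q0 P \<in> F \<Longrightarrow> eqc S R K1 (d (foldl \<delta> q0 P)) \<gamma>"
    by blast
  have "eqc S R ((K + K0 + K1) * real (max (length u) (length v) + 1)) (W u @ \<gamma>) (W v)"
    if uv: "u \<in> L" "v \<in> L" "pres_eq S R (W u @ \<gamma>) (W v)" for u v
  proof -
    let ?P = "pad u v" and ?q = "foldl \<delta> q0 (pad u v)"
    have "?P \<in> comparison \<gamma>" using uv by (auto simp: comparison_def)
    then have P: "?P \<in> lists PA" "?q \<in> F" using lang by auto
    have W: "W1 ?P = W u" "W2 ?P = W v" by (simp_all add: W1_def W2_def)
    have live: "live ?q" unfolding live_def using P(2) by (intro bexI[of _ "[]"]) auto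
    have live0: "live q0" unfolding live_def using P by blast
    have e1: "eqc S R (K * real (length ?P)) (d q0 @ W v) (W u @ d ?q)"
      using travel[OF P(1) live] unfolding W .
    have "eqc S R K0 ([] @ d q0 @ W v) ([] @ [] @ W v)"
      by (rule eqc_context[OF K0(2)[OF live0]]) simp
    then have e0: "eqc S R K0 (W v) (d q0 @ W v)" using eqc_sym[OF _ R_over] by simp
    have "eqc S R K1 (W u @ d ?q @ []) (W u @ \<gamma> @ [])"
      using W12[OF P(1)] W by (intro eqc_context[OF K1(2)[OF P]]) simp
    then have e2: "eqc S R K1 (W u @ d ?q) (W u @ \<gamma>)" by simp
    have "eqc S R (K0 + K * real (length ?P) + K1) (W v) (W u @ \<gamma>)"
      by (rule eqc_trans[OF eqc_trans[OF e0 e1] e2])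
    then have "eqc S R (K0 + K * real (length ?P) + K1) (W u @ \<gamma>) (W v)" using eqc_sym[OF _ R_over] by blast
    moreover have "K0 * 1 \<le> K0 * real (length ?P + 1)" "K1 * 1 \<le> K1 * real (length ?P + 1)"
      using K0(1) K1(1) by (intro mult_left_mono; simp)+
    then have "K0 + K * real (length ?P) + K1 \<le> (K + K0 + K1) * real (length ?P + 1)"
      using K(1) by (simp add: algebra_simps)
    ultimately show ?thesis using eqc_mono unfolding length_pad by blast
  qed
  then show ?thesis using K(1) K0(1) K1(1) by (intro exI[of _ "K + K0 + K1"]) auto
qed

text \<open>A shortest v is pumped down. If it outlasts u by more than the number of states, a state
  repeats after u has ended; there the first track is pure padding, so cutting the loop keeps u and
  shortens v.\<close>

lemma short_representative:
  assumes reg: "regular_lang PA (comparison \<gamma>)" and \<gamma>: "\<gamma> \<in> words_over S"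
  shows "\<exists>K::nat. \<forall>u\<in>L. \<exists>v\<in>L. pres_eq S R (W u @ \<gamma>) (W v) \<and> length v \<le> length u + K"
proof -
  obtain Q :: "nat set" and q0 \<delta> F where aut: "finite Q" "q0 \<in> Q" "F \<subseteq> Q"
    "\<forall>q\<in>Q. \<forall>c\<in>PA. \<delta> q c \<in> Q" and lang: "comparison \<gamma> = {w \<in> lists PA. foldl \<delta> q0 w \<in> F}"
    using reg unfolding regular_lang_def by (elim conjE exE)
  have reachQ: "foldl \<delta> q P \<in> Q" if "q \<in> Q" "P \<in> lists PA" for q P
    using that(2,1) by (induction P arbitrary: q) (use aut(4) in auto)
  have "\<exists>v\<in>L. pres_eq S R (W u @ \<gamma>) (W v) \<and> length v \<le> length u + card Q" if u: "u \<in> L" for u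
  proof -
    have "u \<in> lists A" using u L_over by blast
    then have "W u @ \<gamma> \<in> words_over S" using W_over \<gamma> by simp
    then obtain v0 where "v0 \<in> L \<and> pres_eq S R (W u @ \<gamma>) (W v0)"
      using onto pres_eq_sym unfolding W_def by blast
    from arg_min_natI[where P = "\<lambda>v. v \<in> L \<and> pres_eq S R (W u @ \<gamma>) (W v)" and m = length, OF this]
    obtain v where v: "v \<in> L" "pres_eq S R (W u @ \<gamma>) (W v)" and
      min: "\<And>v'. v' \<in> L \<Longrightarrow> pres_eq S R (W u @ \<gamma>) (W v') \<Longrightarrow> length v \<le> length v'"
      using arg_min_nat_le[where P = "\<lambda>v. v \<in> L \<and> pres_eq S R (W u @ \<gamma>) (W v)" and m = length] by blast
    have "length v \<le> length u + card Q"
    proof (rule ccontr)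
      assume long: "\<not> length v \<le> length u + card Q"
      let ?P = "pad u v"
      have "?P \<in> comparison \<gamma>" using u v by (auto simp: comparison_def)
      then have P: "?P \<in> lists PA" "foldl \<delta> q0 ?P \<in> F" using lang by auto
      have lenP: "length ?P = length v" using long by (simp add: length_pad)
      define st where "st i = foldl \<delta> q0 (take i ?P)" for i
      have "st ` {length u..length v} \<subseteq> Q"
        using reachQ[OF aut(2)] P(1) by (auto simp: st_def dest: in_set_takeD)
      then have "card (st ` {length u..length v}) \<le> card Q" by (rule card_mono[OF aut(1)])
      then have "\<not> inj_on st {length u..length v}" using long by (auto dest: card_image)
      then obtain i j where ij: "length u \<le> i" "i < j" "j \<le> length v" "st i = st j"
        by (auto simp: inj_on_def) (metis linorder_neqE_nat)
      let ?P' = "take i ?P @ drop j ?P"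
      have "foldl \<delta> q0 ?P' = foldl \<delta> q0 (take j ?P @ drop j ?P)"
        using ij(4) by (simp only: foldl_append st_def)
      then have "foldl \<delta> q0 ?P' \<in> F" using P(2) by simp
      moreover have "?P' \<in> lists PA" using P(1) by (auto dest: in_set_takeD in_set_dropD)
      ultimately have "?P' \<in> comparison \<gamma>" using lang by blast
      then obtain u' v' where uv': "?P' = pad u' v'" "u' \<in> L" "v' \<in> L" "pres_eq S R (W u' @ \<gamma>) (W v')"
        unfolding comparison_def by blast
      have none: "unpad (map fst (drop k ?P)) = []" if "length u \<le> k" for k
        using that by (simp add: map_pad flip: drop_map)
      have "u = unpad (map fst (take i ?P @ drop i ?P))" by simp
      then have "u = unpad (map fst (take i ?P))" using none[OF ij(1)] by (simp only: map_append unpad_append) simp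
      then have "u' = u" using none[of j] ij uv'(1) unpad_pad(1)[of u' v'] by (simp flip: uv'(1))
      have sn: "map snd ?P = map Some v" using long by (simp add: map_pad)
      have "v' = unpad (map snd ?P')" using uv'(1) by simp
      also have "map snd ?P' = map Some (take i v @ drop j v)"
        using sn by (simp flip: take_map drop_map)
      finally have "length v' < length v" using ij by simp
      then show False using min[OF uv'(3)] uv'(4) \<open>u' = u\<close> by simp
    qed
    then show ?thesis using v by blast
  qed
  then show ?thesis by blast
qed

text \<open>A representative in L is kept for each prefix of the word. Its length grows by at most a
  constant per letter, and passing from one to the next is a strip of linear cost; linearly many
  strips give the square. The representative of 1 reached at the end is compared with the initial
  one by the equality automaton.\<close>

theorem quadratic_dehn:
  assumes eqreg: "regular_lang PA (comparison [])"
    and mulreg: "\<And>a. a \<in> A \<Longrightarrow> regular_lang PA (comparison (wrd a))"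
  shows "\<exists>K\<ge>0. \<forall>n. real (dehn_function S R n) \<le> K * (real n + 1)^2"
proof -
  obtain K1 where K1: "K1 \<ge> 0" "\<And>u v. u \<in> L \<Longrightarrow> v \<in> L \<Longrightarrow> pres_eq S R (W u) (W v) \<Longrightarrow>
    eqc S R (K1 * real (max (length u) (length v) + 1)) (W u) (W v)"
    using fellow_travel_cost[OF eqreg] by auto
  have "\<forall>a\<in>A. \<exists>K\<ge>0. \<forall>u\<in>L. \<forall>v\<in>L. pres_eq S R (W u @ wrd a) (W v) \<longrightarrow>
    eqc S R (K * real (max (length u) (length v) + 1)) (W u @ wrd a) (W v)"
    using fellow_travel_cost[OF mulreg wrd_over] by blast
  from bchoice[OF this] obtain k2 where k2: "\<And>a. a \<in> A \<Longrightarrow> 0 \<le> k2 a"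
    "\<And>a u v. a \<in> A \<Longrightarrow> u \<in> L \<Longrightarrow> v \<in> L \<Longrightarrow> pres_eq S R (W u @ wrd a) (W v) \<Longrightarrow>
    eqc S R (k2 a * real (max (length u) (length v) + 1)) (W u @ wrd a) (W v)" by blast
  define K2 where "K2 = sum k2 A"
  have K2: "\<And>a. a \<in> A \<Longrightarrow> k2 a \<le> K2" "K2 \<ge> 0"
    using k2(1) fin_A by (auto simp: K2_def intro: member_le_sum sum_nonneg)
  have "\<forall>a\<in>A. \<exists>K::nat. \<forall>u\<in>L. \<exists>v\<in>L. pres_eq S R (W u @ wrd a) (W v) \<and> length v \<le> length u + K"
    using short_representative[OF mulreg wrd_over] by blast
  from bchoice[OF this] obtain k3 where k3: "\<And>a u. a \<in> A \<Longrightarrow> u \<in> L \<Longrightarrow>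
    \<exists>v\<in>L. pres_eq S R (W u @ wrd a) (W v) \<and> length v \<le> length u + k3 a" by blast
  define K3 where "K3 = sum k3 A"
  have K3: "a \<in> A \<Longrightarrow> k3 a \<le> K3" for a using fin_A by (auto simp: K3_def intro: member_le_sum)
  \<comment> \<open>The empty word need not lie in L, so the path starts at some representative of
    1.\<close>
  obtain u0 where u0: "u0 \<in> L" "pres_eq S R (W u0) []" using onto[of "[]"] by (auto simp: W_def)
  have u0w: "W u0 \<in> words_over S" using u0 L_over W_over by blast
  let ?c = "length u0"
  have path: "\<exists>v\<in>L. length v \<le> ?c + K3 * length as \<and>
    eqc S R (K2 * real (length as) * real (?c + K3 * length as + 1)) (W u0 @ W as) (W v)"
    if "as \<in> lists A" for as
    using that
  proof (induction as rule: rev_induct)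
    case Nil
    then show ?case using u0 by (intro bexI[of _ u0]) auto
  next
    case (snoc a as)
    then obtain v where v: "v \<in> L" "length v \<le> ?c + K3 * length as"
      "eqc S R (K2 * real (length as) * real (?c + K3 * length as + 1)) (W u0 @ W as) (W v)" by auto
    have a: "a \<in> A" using snoc.prems by simp
    obtain v' where v': "v' \<in> L" "pres_eq S R (W v @ wrd a) (W v')" "length v' \<le> length v + k3 a"
      using k3[OF a v(1)] by blast
    have len: "length v' \<le> ?c + K3 * length (as @ [a])" using v(2) v'(3) K3[OF a] by simp
    let ?N = "real (?c + K3 * length (as @ [a]) + 1)"
    have "eqc S R (k2 a * real (max (length v) (length v') + 1)) (W v @ wrd a) (W v')"
      using k2(2)[OF a v(1) v'(1,2)] .
    moreover have "max (length v) (length v') + 1 \<le> ?c + K3 * length (as @ [a]) + 1"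
      using len v(2) by simp
    then have "k2 a * real (max (length v) (length v') + 1) \<le> K2 * ?N"
      by (intro mult_mono of_nat_mono K2 a) simp_all
    ultimately have 1: "eqc S R (K2 * ?N) (W v @ wrd a) (W v')" by (rule eqc_mono)
    have "eqc S R (K2 * real (length as) * real (?c + K3 * length as + 1)) ([] @ (W u0 @ W as) @ wrd a) ([] @ W v @ wrd a)"
      by (rule eqc_context[OF v(3)]) simp
    moreover have "K2 * real (length as) * real (?c + K3 * length as + 1) \<le> K2 * real (length as) * ?N"
      using K2(2) by (intro mult_left_mono) auto
    ultimately have "eqc S R (K2 * real (length as) * ?N) (W u0 @ W as @ wrd a) (W v @ wrd a)"
      using eqc_mono by fastforce
    from eqc_trans[OF this 1]
    have "eqc S R (K2 * real (length (as @ [a])) * ?N) (W u0 @ W (as @ [a])) (W v')"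
      by (simp add: algebra_simps W_def)
    then show ?case using v'(1) len by blast
  qed
  have "\<forall>l\<in>S \<times> (UNIV :: bool set). \<exists>u. u \<in> L \<and> pres_eq S R (W u) [l]"
  proof
    fix l :: "'g letter" assume "l \<in> S \<times> UNIV"
    then have "[l] \<in> words_over S" by auto
    from onto[OF this] show "\<exists>u. u \<in> L \<and> pres_eq S R (W u) [l]" by (auto simp: W_def)
  qed
  from bchoice[OF this] obtain \<alpha>
    where \<alpha>': "\<forall>l\<in>S \<times> UNIV. \<alpha> l \<in> L \<and> pres_eq S R (W (\<alpha> l)) [l]" ..
  note \<alpha> = bspec[OF \<alpha>']
  have finl: "finite (S \<times> (UNIV :: bool set))" using fin_S by simp
  have "\<exists>K\<ge>0. \<forall>l\<in>S \<times> (UNIV :: bool set). True \<longrightarrow> eqc S R K [l] (W (\<alpha> l))"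
  proof (rule pres_eq_imp_uniform_eqc[OF finl R_over])
    fix l :: "'g letter" assume l: "l \<in> S \<times> UNIV"
    show "[l] \<in> words_over S \<and> pres_eq S R [l] (W (\<alpha> l))"
      using pres_eq_sym[OF conjunct2[OF \<alpha>[OF l]]] l by auto
  qed
  then obtain K4 where K4: "K4 \<ge> 0" "\<And>l. l \<in> S \<times> UNIV \<Longrightarrow> eqc S R K4 [l] (W (\<alpha> l))" by blast
  define M where "M = (\<Sum>l\<in>S \<times> UNIV. length (\<alpha> l))"
  have M: "length (\<alpha> l) \<le> M" if "l \<in> S \<times> UNIV" for l
    unfolding M_def by (rule member_le_sum[where f = "\<lambda>l. length (\<alpha> l)"]) (use that finl in auto)
  have translate: "concat (map \<alpha> w) \<in> lists A \<and> length (concat (map \<alpha> w)) \<le> M * length w \<and>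
    eqc S R (K4 * real (length w)) w (W (concat (map \<alpha> w)))" if "w \<in> words_over S" for w
    using that
  proof (induction w)
    case (Cons l w)
    have l: "l \<in> S \<times> UNIV" using Cons.prems by (auto simp: mem_Times_iff)
    have lA: "\<alpha> l \<in> lists A" using \<alpha>[OF l] L_over by blast
    have IH: "concat (map \<alpha> w) \<in> lists A" "length (concat (map \<alpha> w)) \<le> M * length w"
      "eqc S R (K4 * real (length w)) w (W (concat (map \<alpha> w)))" using Cons by auto
    have "eqc S R (K4 + K4 * real (length w)) ([l] @ w) (W (\<alpha> l) @ W (concat (map \<alpha> w)))"
      by (rule eqc_append[OF K4(2)[OF l] IH(3) W_over[OF lA]])
    then show ?case using IH(1,2) lA M[OF l] by (simp add: algebra_simps)
  qed simp
  define N where "N n = ?c + K3 * (M * n) + 1" for n :: nat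
  have bound: "eqc S R (K4 * real n + K2 * real (M * n) * real (N n) + K1 * real (N n)) w []"
    if w: "w \<in> words_over S" "length w \<le> n" "pres_eq S R w []" for w n
  proof -
    let ?as = "concat (map \<alpha> w)"
    have as: "?as \<in> lists A" "length ?as \<le> M * n" "eqc S R (K4 * real (length w)) w (W ?as)"
    proof -
      show "?as \<in> lists A" "eqc S R (K4 * real (length w)) w (W ?as)" using translate[OF w(1)] by blast+
      have "length ?as \<le> M * length w" using translate[OF w(1)] by blast
      also have "\<dots> \<le> M * n" using w(2) by simp
      finally show "length ?as \<le> M * n" .
    qed
    obtain v where v: "v \<in> L" "length v \<le> ?c + K3 * length ?as"
      "eqc S R (K2 * real (length ?as) * real (?c + K3 * length ?as + 1)) (W u0 @ W ?as) (W v)"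
      using path[OF as(1)] by blast
    have leN: "?c + K3 * length ?as + 1 \<le> N n" using as(2) by (simp add: N_def)
    have "pres_eq S R w (W ?as)" by (rule eqc_imp_pres_eq[OF as(3) R_over])
    then have "pres_eq S R (W ?as) []" using w(3) pres_eq_sym pres_eq_trans by metis
    from pres_eq_append[OF pres_eq_refl this, of "W u0"] have "pres_eq S R (W u0 @ W ?as) (W u0)" by simp
    moreover have "pres_eq S R (W u0 @ W ?as) (W v)" by (rule eqc_imp_pres_eq[OF v(3) R_over])
    ultimately have "pres_eq S R (W v) (W u0)" by (rule_tac pres_eq_trans[OF pres_eq_sym])
    from K1(2)[OF v(1) u0(1) this] have e3: "eqc S R (K1 * real (N n)) (W v) (W u0)"
    proof (rule eqc_mono)
      show "K1 * real (max (length v) (length u0) + 1) \<le> K1 * real (N n)"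
        using K1(1) v(2) leN by (intro mult_left_mono) auto
    qed
    have e2: "eqc S R (K2 * real (M * n) * real (N n)) (W u0 @ W ?as) (W v)"
    proof (rule eqc_mono[OF v(3)])
      show "K2 * real (length ?as) * real (?c + K3 * length ?as + 1) \<le> K2 * real (M * n) * real (N n)"
        using as(2) leN K2(2) by (intro mult_mono of_nat_mono) auto
    qed
    have "eqc S R (K2 * real (M * n) * real (N n) + K1 * real (N n)) (W u0 @ W ?as) (W u0 @ [])"
      using eqc_trans[OF e2 e3] by simp
    from eqc_cancel_left[OF this u0w]
    have "eqc S R (K2 * real (M * n) * real (N n) + K1 * real (N n)) (W ?as) []" .
    from eqc_trans[OF as(3) this] show ?thesis
    proof (rule eqc_mono)
      have "K4 * real (length w) \<le> K4 * real n" using K4(1) w(2) by (intro mult_left_mono) auto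
      then show "K4 * real (length w) + (K2 * real (M * n) * real (N n) + K1 * real (N n))
        \<le> K4 * real n + K2 * real (M * n) * real (N n) + K1 * real (N n)" by simp
    qed
  qed
  define C where "C = real (?c + K3 * M + 1)"
  define K where "K = K4 + K2 * real M * C + K1 * C"
  have C0: "C \<ge> 0" by (simp add: C_def)
  have "real (dehn_function S R n) \<le> K * (real n + 1)^2" for n
  proof -
    let ?x = "K4 * real n + K2 * real (M * n) * real (N n) + K1 * real (N n)"
    have "area S R w \<le> nat \<lfloor>?x\<rfloor>" if "w \<in> words_over S \<and> length w \<le> n \<and> pres_eq S R w []" for w
      using area_le[OF bound[of w n]] that by (simp add: le_nat_floor)
    then have "dehn_function S R n \<le> nat \<lfloor>?x\<rfloor>" by (subst dehn_function_le_iff[OF fin_S]) auto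
    moreover have x0: "0 \<le> ?x" using K4(1) K2(2) K1(1) by simp
    ultimately have "real (dehn_function S R n) \<le> ?x" by (simp add: le_nat_iff le_floor_iff)
    also have "?x \<le> K * (real n + 1)^2"
    proof -
      let ?y = "real n + 1"
      have N: "real (N n) \<le> C * ?y" by (simp add: N_def C_def algebra_simps)
      have Mn: "K2 * real (M * n) \<le> K2 * real M * ?y"
        using mult_left_mono[of "real n" "real n + 1" "K2 * real M"] K2(2) by (simp add: mult.assoc)
      have "K2 * real (M * n) * real (N n) \<le> (K2 * real M * ?y) * (C * ?y)"
        by (rule mult_mono[OF Mn N]) (use K2(2) in simp_all)
      moreover have "K1 * real (N n) \<le> K1 * (C * ?y)"
        using K1(1) N by (intro mult_left_mono)
      moreover have "K1 * C * ?y \<le> K1 * C * ?y^2" "K4 * real n \<le> K4 * ?y^2"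
        using K1(1) K4(1) C0 by (intro mult_left_mono; simp add: power2_eq_square algebra_simps)+
      ultimately show ?thesis by (simp add: K_def algebra_simps power2_eq_square)
    qed
    finally show ?thesis .
  qed
  moreover have "K \<ge> 0" using K4(1) K2(2) K1(1) C0 by (simp add: K_def)
  ultimately show ?thesis by blast
qed

end

theorem automatic_imp_quadratic_dehn:
  fixes S :: "'g set"
  assumes fin: "finite S" and R: "R \<subseteq> words_over S" and aut: "automatic_group (presented_group S R)"
  shows "\<exists>K\<ge>0. \<forall>n. real (dehn_function S R n) \<le> K * (real n + 1)^2"
proof -
  let ?G = "presented_group S R"
  interpret G: group ?G by (rule group_presented)
  obtain A \<mu> L where A: "finite (A :: nat set)" "\<mu> ` A \<subseteq> carrier ?G" "regular_lang A L"
    and onto: "eval_word ?G \<mu> ` L = carrier ?G"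
    and eqr: "regular_lang (insert None (Some ` A) \<times> insert None (Some ` A))
      {pad u v | u v. u \<in> L \<and> v \<in> L \<and> eval_word ?G \<mu> u = eval_word ?G \<mu> v}"
    and mulr: "\<forall>a\<in>A. regular_lang (insert None (Some ` A) \<times> insert None (Some ` A))
      {pad u v | u v. u \<in> L \<and> v \<in> L \<and> eval_word ?G \<mu> u \<otimes>\<^bsub>?G\<^esub> \<mu> a = eval_word ?G \<mu> v}"
    using aut unfolding automatic_group_def Let_def by (elim exE conjE)
  have "\<forall>a\<in>A. \<exists>w. w \<in> words_over S \<and> \<mu> a = cls S R w"
    using A(2) unfolding carrier_presented by blast
  from bchoice[OF this] obtain wrd where wrd: "\<And>a. a \<in> A \<Longrightarrow> wrd a \<in> words_over S \<and> \<mu> a = cls S R (wrd a)"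
    by blast
  have L: "L \<subseteq> lists A" using A(3) unfolding regular_lang_def by blast
  have ev: "concat (map wrd u) \<in> words_over S \<and> eval_word ?G \<mu> u = cls S R (concat (map wrd u))"
    if "u \<in> lists A" for u
    using that
  proof (induction u)
    case Nil
    then show ?case by (simp add: eval_word_def one_presented)
  next
    case (Cons a u)
    then show ?case using wrd[of a] by (simp add: eval_word_def mult_presented)
  qed
  interpret automatic_structure S R A L wrd
  proof
    fix w assume w: "w \<in> words_over S"
    then have "cls S R w \<in> eval_word ?G \<mu> ` L" unfolding onto by simp
    then obtain u where "u \<in> L" "cls S R w = eval_word ?G \<mu> u" by blast
    then show "\<exists>u\<in>L. pres_eq S R (concat (map wrd u)) w" using ev[of u] L w cls_eq_iff pres_eq_sym by blast
  qed (use fin R A L wrd in auto)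
  have evW: "eval_word ?G \<mu> u = cls S R (W u)" "W u \<in> words_over S" if "u \<in> L" for u
    using ev[of u] L that by (auto simp: W_def)
  have "{pad u v | u v. u \<in> L \<and> v \<in> L \<and> eval_word ?G \<mu> u = eval_word ?G \<mu> v} = comparison []"
  proof -
    have "eval_word ?G \<mu> u = eval_word ?G \<mu> v \<longleftrightarrow> pres_eq S R (W u @ []) (W v)"
      if "u \<in> L" "v \<in> L" for u v
      using evW[OF that(1)] evW[OF that(2)] by (simp add: cls_eq_iff)
    then show ?thesis unfolding comparison_def by (intro Collect_cong) blast
  qed
  moreover have "{pad u v | u v. u \<in> L \<and> v \<in> L \<and> eval_word ?G \<mu> u \<otimes>\<^bsub>?G\<^esub> \<mu> a = eval_word ?G \<mu> v}
      = comparison (wrd a)" if "a \<in> A" for a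
  proof -
    have "eval_word ?G \<mu> u \<otimes>\<^bsub>?G\<^esub> \<mu> a = eval_word ?G \<mu> v \<longleftrightarrow> pres_eq S R (W u @ wrd a) (W v)"
      if "u \<in> L" "v \<in> L" for u v
      using evW[OF that(1)] evW[OF that(2)] wrd[OF \<open>a \<in> A\<close>] by (simp add: mult_presented cls_eq_iff)
    then show ?thesis unfolding comparison_def by (intro Collect_cong) blast
  qed
  ultimately show ?thesis using quadratic_dehn eqr bspec[OF mulr] by simp
qed

theorem (in rpq) not_automatic: "\<not> automatic_group (Rpq p q)"
proof
  assume "automatic_group (Rpq p q)"
  then obtain K where K: "K \<ge> 0" "\<And>n. real (dehn_function X RR n) \<le> K * (real n + 1)^2"
    using automatic_imp_quadratic_dehn[OF _ RR_words_over] by (auto simp: Rpq_def)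
  obtain C :: nat where C: "C > 0" "\<And>n. real n powr (2 * al) \<le> real (dehn_function X RR (C * n))"
    using dehn_lower by blast
  have le: "real n powr (2 * al) \<le> K * (real C * real n + 1)^2" for n
    using C(2)[of n] K(2)[of "C * n"] by simp
  have "1 < al" "0 < real C" using al_gt_1 C by auto
  then have "(\<lambda>n::nat. K * (real C * real n + 1)^2 / real n powr (2 * al)) \<longlonglongrightarrow> 0"
    by real_asymp
  then have "eventually (\<lambda>n. K * (real C * real n + 1)^2 / real n powr (2 * al) < 1) sequentially"
    by (rule order_tendstoD) simp
  moreover have "eventually (\<lambda>n::nat. n > 0) sequentially" by (rule eventually_gt_at_top)
  ultimately have "eventually (\<lambda>n::nat. False) sequentially"
  proof eventually_elim
    case (elim n)
    then show False using le[of n] by (simp add: field_simps)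
  qed
  then show False by simp
qed

section \<open>Actions on CAT(0) spaces\<close>

text \<open>Let m be the midpoint of a geodesic from x to f x. Its image is the midpoint of the
  image geodesic from f x to f (f x), and by comparison these two midpoints are at most half the
  third side of the triangle apart.\<close>

lemma CAT0_midpoint:
  fixes f :: "'a::metric_space \<Rightarrow> 'a"
  assumes cat: "CAT0_space TYPE('a)" and iso: "\<And>x y. dist (f x) (f y) = dist x y"
  shows "\<exists>m. dist m (f m) \<le> dist x (f (f x)) / 2"
proof -
  define d where "d = dist x (f x)"
  define e where "e = dist (f (f x)) x"
  have geo: "\<exists>c. geodesic_path c u v" for u v :: 'a
    using cat unfolding CAT0_space_def by blast
  obtain c1 where c1: "geodesic_path c1 x (f x)" using geo by blast
  obtain c3 where c3: "geodesic_path c3 (f (f x)) x" using geo by blast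
  have c2: "geodesic_path (f \<circ> c1) (f x) (f (f x))"
    using c1 by (simp add: geodesic_path_def iso)
  have de: "e \<le> 2 * d" "0 \<le> e" "0 \<le> d"
    using dist_triangle[of "f (f x)" x "f x"] iso[of x "f x"]
    by (simp_all add: d_def e_def dist_commute)
  \<comment> \<open>The comparison triangle is isosceles with two sides d and base e. It is placed
    with its base on the real axis; h is its height, which exists by the triangle inequality e \<le>
    2 d.\<close>
  define h where "h = sqrt (d^2 - e^2 / 4)"
  have "e^2 \<le> (2 * d)^2" using de by (intro power_mono)
  then have "0 \<le> d^2 - e^2 / 4" by (simp add: power2_eq_square)
  then have h2: "h^2 = d^2 - e^2 / 4" by (simp add: h_def)
  define P Q R where "P = Complex (- e / 2) 0" and "Q = Complex 0 h" and "R = Complex (e / 2) 0"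
  have "sqrt ((e / 2)^2 + h^2) = d"
    using de by (simp add: h2 power_divide)
  then have dPQ: "dist P Q = d" "dist Q R = d" and dRP: "dist R P = e"
    using de by (simp_all add: P_def Q_def R_def dist_norm cmod_def)
  let ?T = "{(c1 s, comp_point P Q (dist x (f x)) s) | s. s \<in> {0..dist x (f x)}} \<union>
            {((f \<circ> c1) s, comp_point Q R (dist (f x) (f (f x))) s) | s. s \<in> {0..dist (f x) (f (f x))}} \<union>
            {(c3 s, comp_point R P (dist (f (f x)) x) s) | s. s \<in> {0..dist (f (f x)) x}}"
  have "\<forall>(u, u')\<in>?T. \<forall>(v, v')\<in>?T. dist u v \<le> dist u' v'"
    by (rule cat[unfolded CAT0_space_def Let_def, THEN conjunct2, THEN spec[where x = x],
        THEN spec[where x = "f x"], THEN spec[where x = "f (f x)"], THEN spec[where x = c1],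
        THEN spec[where x = "f \<circ> c1"], THEN spec[where x = c3], THEN spec[where x = P],
        THEN spec[where x = Q], THEN spec[where x = R], THEN mp])
      (use c1 c2 c3 dPQ dRP in \<open>simp add: iso d_def e_def\<close>)
  moreover have "(c1 (d / 2), comp_point P Q d (d / 2)) \<in> ?T" using de by (auto simp: d_def)
  moreover have "((f \<circ> c1) (d / 2), comp_point Q R d (d / 2)) \<in> ?T" using de by (auto simp: d_def iso)
  ultimately have le: "dist (c1 (d / 2)) (f (c1 (d / 2))) \<le> dist (comp_point P Q d (d / 2)) (comp_point Q R d (d / 2))"
    by fastforce
  show ?thesis
  \<comment> \<open>\<open>comp_point\<close> divides by d, so the degenerate triangle is treated
    apart; there x itself is fixed.\<close>
  proof (cases "d = 0")
    case True
    then have "dist x (f x) \<le> dist x (f (f x)) / 2" by (simp add: d_def)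
    then show ?thesis by blast
  next
    case False
    then have "comp_point P Q d (d / 2) - comp_point Q R d (d / 2) = - ((R - P) / 2)"
      by (simp add: comp_point_def field_simps)
    then have "dist (comp_point P Q d (d / 2)) (comp_point Q R d (d / 2)) = e / 2"
      using dRP by (simp add: dist_norm norm_divide)
    then show ?thesis using le by (metis e_def dist_commute)
  qed
qed

lemma dist_funpow_le:
  assumes "\<And>x y. dist (f x) (f y) = dist x y"
  shows "dist x ((f ^^ n) x) \<le> real n * dist x (f x)"
proof (induction n)
  case (Suc n)
  have "dist x ((f ^^ Suc n) x) \<le> dist x (f x) + dist (f x) (f ((f ^^ n) x))"
    using dist_triangle[of x "(f ^^ Suc n) x" "f x"] by simp
  then show ?case using Suc assms by (simp add: algebra_simps)
qed simp

lemma dist_funpow_isometry: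
  fixes f :: "'a::metric_space \<Rightarrow> 'a"
  assumes "\<And>x y. dist (f x) (f y) = dist x y"
  shows "dist ((f ^^ n) x) ((f ^^ n) y) = dist x y"
  by (induction n) (auto simp: assms)

text \<open>By the midpoint argument, translation lengths at least double when an isometry is squared.\<close>

lemma CAT0_displacement:
  fixes f :: "'a::metric_space \<Rightarrow> 'a"
  assumes cat: "CAT0_space TYPE('a)" and iso: "\<And>x y. dist (f x) (f y) = dist x y"
    and c: "\<And>x. c \<le> dist x (f x)"
  shows "real n * c \<le> dist x ((f ^^ n) x)"
proof -
  have pow: "2 ^ k * c \<le> dist x ((f ^^ (2 ^ k)) x)" for k x
  proof (induction k arbitrary: x)
    case (Suc k)
    let ?g = "f ^^ (2 ^ k)"
    obtain m where m: "dist m (?g m) \<le> dist x (?g (?g x)) / 2"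
      using CAT0_midpoint[OF cat, of ?g] dist_funpow_isometry[of f, OF iso] by blast
    have "?g (?g x) = (f ^^ (2 ^ Suc k)) x" by (simp add: mult_2 funpow_add)
    then show ?case using m Suc[of m] by simp
  qed (use c in simp)
  show ?thesis
  proof (cases "n = 0")
    case False
    let ?D = "dist x ((f ^^ n) x)" and ?d = "dist x (f x)"
    \<comment> \<open>With 2^k = n j + r, the displacement by f^(2^k) is at most j times that by f^n
      plus a term bounded independently of k, which disappears in the limit after division by
      2^k.\<close>
    have *: "real n * c \<le> ?D + real n * real n * ?d / 2 ^ k" for k
    proof -
      let ?j = "2 ^ k div n" and ?r = "2 ^ k mod n"
      have split: "2 ^ k = n * ?j + ?r" by simp
      have "dist x ((f ^^ (2 ^ k)) x) \<le> dist x ((f ^^ (n * ?j)) x) + dist ((f ^^ (n * ?j)) x) ((f ^^ (n * ?j)) ((f ^^ ?r) x))"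
      proof -
        have "(f ^^ (2 ^ k)) x = (f ^^ (n * ?j)) ((f ^^ ?r) x)"
          by (subst split, subst funpow_add) simp
        then show ?thesis using dist_triangle by metis
      qed
      also have "dist ((f ^^ (n * ?j)) x) ((f ^^ (n * ?j)) ((f ^^ ?r) x)) = dist x ((f ^^ ?r) x)"
        by (rule dist_funpow_isometry[OF iso])
      also have "\<dots> \<le> real ?r * ?d" by (rule dist_funpow_le[OF iso])
      also have "\<dots> \<le> real n * ?d" using False by (intro mult_right_mono) (auto simp: less_imp_le)
      also have "dist x ((f ^^ (n * ?j)) x) \<le> real ?j * ?D"
        using dist_funpow_le[of "f ^^ n" x ?j] dist_funpow_isometry[OF iso]
        by (simp add: funpow_mult mult.commute)
      finally have "2 ^ k * c \<le> real ?j * ?D + real n * ?d" using pow[of k x] by simp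
      then have "real n * (2 ^ k * c) \<le> real n * (real ?j * ?D + real n * ?d)"
        by (rule mult_left_mono) simp
      moreover have "real (n * ?j) * ?D \<le> 2 ^ k * ?D"
      proof (rule mult_right_mono)
        have "real (n * ?j) \<le> real (2 ^ k)" using split by (intro of_nat_mono) linarith
        then show "real (n * ?j) \<le> 2 ^ k" by simp
      qed simp
      ultimately have "2 ^ k * (real n * c) \<le> 2 ^ k * ?D + real n * real n * ?d"
        by (simp add: algebra_simps)
      then show ?thesis by (simp add: field_simps)
    qed
    have "(\<lambda>k. ?D + real n * real n * ?d / 2 ^ k) \<longlonglongrightarrow> ?D + 0"
      by (intro tendsto_intros LIMSEQ_divide_realpow_zero) simp
    then show ?thesis using * LIMSEQ_le_const by fastforce
  qed simp
qed

text \<open>Suitable conjugates of g move points of the compact set by less and less. Near an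
  accumulation point l only finitely many group elements matter, so their displacements of l are
  bounded away from 0 unless they vanish. Thus some conjugate of g fixes l; its powers lie in a
  finite set, so two of them agree.\<close>

lemma almost_fixed_imp_torsion:
  fixes \<phi> :: "'c \<Rightarrow> 'a::metric_space \<Rightarrow> 'a" and G (structure)
  assumes "group G" and act: "isometric_action G \<phi>" and proper: "proper_action G \<phi>"
    and coc: "cocompact_action G \<phi>" and g: "g \<in> carrier G"
    and small: "\<And>\<epsilon>. \<epsilon> > 0 \<Longrightarrow> \<exists>x. dist x (\<phi> g x) < \<epsilon>"
  shows "\<exists>n>0. g [^] (n::nat) = \<one>"
proof -
  interpret group G by fact
  have act1: "\<phi> \<one> x = x"
    and actm: "\<And>a b. a \<in> carrier G \<Longrightarrow> b \<in> carrier G \<Longrightarrow> \<phi> (a \<otimes> b) x = \<phi> a (\<phi> b x)"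
    and acti: "\<And>a y. a \<in> carrier G \<Longrightarrow> dist (\<phi> a x) (\<phi> a y) = dist x y" for x
    using act unfolding isometric_action_def by auto
  obtain K where K: "compact K" "(\<Union>a\<in>carrier G. \<phi> a ` K) = UNIV"
    using coc unfolding cocompact_action_def by blast
  have "\<exists>a k. a \<in> carrier G \<and> k \<in> K \<and> dist k (\<phi> (inv a \<otimes> g \<otimes> a) k) < inverse (real (Suc n))" for n
  proof -
    obtain x where x: "dist x (\<phi> g x) < inverse (real (Suc n))" using small[of "inverse (real (Suc n))"] by auto
    have "x \<in> (\<Union>a\<in>carrier G. \<phi> a ` K)" using K(2) by simp
    then obtain a k where a: "a \<in> carrier G" "k \<in> K" "x = \<phi> a k" by blast
    have "dist k (\<phi> (inv a \<otimes> g \<otimes> a) k) = dist (\<phi> a k) (\<phi> a (\<phi> (inv a \<otimes> g \<otimes> a) k))"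
      using a by (simp add: acti)
    also have "\<phi> a (\<phi> (inv a \<otimes> g \<otimes> a) k) = \<phi> g x"
      using a g by (simp add: m_assoc inv_solve_left flip: actm) (simp add: actm flip: m_assoc)
    finally have "dist k (\<phi> (inv a \<otimes> g \<otimes> a) k) < inverse (real (Suc n))"
      using a x by simp
    with a show ?thesis by blast
  qed
  then obtain a k where ak: "\<And>n. a n \<in> carrier G" "\<And>n. k n \<in> K"
    "\<And>n. dist (k n) (\<phi> (inv (a n) \<otimes> g \<otimes> a n) (k n)) < inverse (real (Suc n))"
    by metis
  define h where "h n = inv (a n) \<otimes> g \<otimes> a n" for n
  have hc: "h n \<in> carrier G" for n using ak(1) g by (simp add: h_def)
  obtain l r where l: "l \<in> K" "strict_mono r" "(k \<circ> r) \<longlonglongrightarrow> l"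
    using K(1) ak(2) unfolding compact_eq_seq_compact_metric seq_compact_def by blast
  obtain \<rho> where \<rho>: "\<rho> > 0" "finite {b \<in> carrier G. \<phi> b ` {y. dist l y < \<rho>} \<inter> {y. dist l y < \<rho>} \<noteq> {}}"
    using proper unfolding proper_action_def by blast
  define F where "F = {b \<in> carrier G. \<phi> b ` {y. dist l y < \<rho>} \<inter> {y. dist l y < \<rho>} \<noteq> {}}"
  have FI: "b \<in> F" if "b \<in> carrier G" "dist l (\<phi> b l) < \<rho>" for b
  proof -
    have "\<phi> b l \<in> \<phi> b ` {y. dist l y < \<rho>} \<inter> {y. dist l y < \<rho>}" using that(2) \<rho>(1) by simp
    then show ?thesis using that(1) by (auto simp: F_def)
  qed
  \<comment> \<open>A displacement of l below the minimum of D is less than \<rho>, hence due to an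
    element of F, and is not one of the positive ones, hence 0.\<close>
  define D where "D = insert \<rho> ((\<lambda>b. dist l (\<phi> b l)) ` F \<inter> {0<..})"
  have D: "finite D" "D \<noteq> {}" "\<And>x. x \<in> D \<Longrightarrow> 0 < x"
    using \<rho> by (auto simp: D_def F_def)
  then have "Min D > 0" using Min_in by blast
  have "(\<lambda>n. 2 * dist ((k \<circ> r) n) l + inverse (real (Suc (r n)))) \<longlonglongrightarrow> 2 * 0 + 0"
    by (intro tendsto_intros tendsto_dist_iff[THEN iffD1] l(3)
        LIMSEQ_subseq_LIMSEQ[OF LIMSEQ_inverse_real_of_nat l(2), unfolded o_def])
  then have "eventually (\<lambda>n. 2 * dist ((k \<circ> r) n) l + inverse (real (Suc (r n))) < Min D) sequentially"
    by (rule order_tendstoD) (use \<open>Min D > 0\<close> in simp)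
  then obtain n where n: "2 * dist (k (r n)) l + inverse (real (Suc (r n))) < Min D"
    by (auto simp: eventually_sequentially)
  define b where "b = h (r n)"
  have b: "b \<in> carrier G" using hc by (simp add: b_def)
  have "dist l (\<phi> b l) \<le> dist l (k (r n)) + dist (k (r n)) (\<phi> b (k (r n))) + dist (\<phi> b (k (r n))) (\<phi> b l)"
    using dist_triangle[of l "\<phi> b l" "k (r n)"] dist_triangle[of "k (r n)" "\<phi> b l" "\<phi> b (k (r n))"] by linarith
  also have "\<dots> < Min D"
    using n ak(3)[of "r n"] acti[OF b] by (simp add: b_def h_def dist_commute)
  finally have small_b: "dist l (\<phi> b l) < Min D" .
  also have "Min D \<le> \<rho>" using D by (intro Min_le) (auto simp: D_def)
  finally have "b \<in> F" using FI b by blast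
  have "dist l (\<phi> b l) = 0"
  proof (rule ccontr)
    assume "dist l (\<phi> b l) \<noteq> 0"
    then have "dist l (\<phi> b l) \<in> D" using \<open>b \<in> F\<close> by (auto simp: D_def)
    then show False using small_b D(1) Min_le by fastforce
  qed
  then have fix_b: "\<phi> b l = l" by simp
  have "\<phi> (b [^] i) l = l" for i :: nat
    by (induction i) (use b fix_b in \<open>auto simp: act1 actm\<close>)
  then have "range (\<lambda>i::nat. b [^] i) \<subseteq> F" using FI b \<rho>(1) by auto
  then have "finite (range (\<lambda>i::nat. b [^] i))" using \<rho>(2) finite_subset unfolding F_def by blast
  then have "\<not> inj (\<lambda>i::nat. b [^] i)" using finite_imageD infinite_UNIV_nat by blast
  then obtain i j :: nat where ij: "i < j" "b [^] i = b [^] j"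
    unfolding inj_def by (metis linorder_neqE_nat)
  have "b [^] i \<otimes> b [^] (j - i) = b [^] (i + (j - i))"
    by (rule nat_pow_mult[OF b])
  also have "\<dots> = b [^] i" using ij by simp
  finally have b1: "b [^] (j - i) = \<one>" using b by simp
  let ?a = "a (r n)"
  have aG: "?a \<in> carrier G" using ak(1) .
  have conj: "b [^] i = inv ?a \<otimes> g [^] i \<otimes> ?a" for i :: nat
  proof (induction i)
    case (Suc i)
    have "b [^] Suc i = (inv ?a \<otimes> g [^] i \<otimes> ?a) \<otimes> (inv ?a \<otimes> g \<otimes> ?a)"
      using Suc by (simp add: b_def h_def)
    also have "\<dots> = inv ?a \<otimes> g [^] i \<otimes> (?a \<otimes> inv ?a) \<otimes> g \<otimes> ?a"
      using aG g by (simp only: m_assoc m_closed inv_closed nat_pow_closed)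
    finally show ?case using aG g by (simp add: m_assoc)
  qed (use aG in simp)
  have "inv ?a \<otimes> g [^] (j - i) \<otimes> ?a = \<one>" using conj b1 by simp
  then have "?a \<otimes> (inv ?a \<otimes> g [^] (j - i) \<otimes> ?a) \<otimes> inv ?a = \<one>" using aG by simp
  moreover have "?a \<otimes> (inv ?a \<otimes> g [^] (j - i) \<otimes> ?a) \<otimes> inv ?a
      = (?a \<otimes> inv ?a) \<otimes> g [^] (j - i) \<otimes> (?a \<otimes> inv ?a)"
    using aG g by (simp only: m_assoc m_closed inv_closed nat_pow_closed)
  ultimately have "g [^] (j - i) = \<one>" using aG g by simp
  then show ?thesis using ij(1) by (intro exI[of _ "j - i"]) simp
qed

lemma (in rpq) not_CAT0:
  fixes \<phi> :: "nat word set \<Rightarrow> 'a::metric_space \<Rightarrow> 'a"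
  assumes cat: "CAT0_space TYPE('a)" and act: "isometric_action (Rpq p q) \<phi>"
    and proper: "proper_action (Rpq p q) \<phi>" and coc: "cocompact_action (Rpq p q) \<phi>"
  shows False
proof -
  have G: "Rpq p q = presented_group X RR" by (simp add: Rpq_def)
  interpret group "presented_group X RR" by (rule group_presented)
  define g where "g = cls X RR [(0, False)]"
  have gc: "g \<in> carrier (presented_group X RR)" by (simp add: g_def)
  have act1: "\<phi> (cls X RR []) x = x"
    and actm: "\<And>u v. u \<in> words_over X \<Longrightarrow> v \<in> words_over X \<Longrightarrow> \<phi> (cls X RR (u @ v)) x = \<phi> (cls X RR u) (\<phi> (cls X RR v) x)"
    and acti: "\<And>u y. u \<in> words_over X \<Longrightarrow> dist (\<phi> (cls X RR u) x) (\<phi> (cls X RR u) y) = dist x y" for x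
    using act unfolding isometric_action_def G
    by (simp_all add: one_presented flip: mult_presented)
  obtain x0 :: 'a where True by blast
  define D where "D = (\<Sum>l\<in>X \<times> UNIV. dist x0 (\<phi> (cls X RR [l]) x0))"
  have D: "dist x0 (\<phi> (cls X RR [l]) x0) \<le> D" if "l \<in> X \<times> UNIV" for l
    unfolding D_def by (rule member_le_sum[where f = "\<lambda>l. dist x0 (\<phi> (cls X RR [l]) x0)"]) (use that in auto)
  have word: "dist x0 (\<phi> (cls X RR w) x0) \<le> D * real (length w)" if "w \<in> words_over X" for w
    using that
  proof (induction w)
    case (Cons l w)
    have l: "[l] \<in> words_over X" "l \<in> X \<times> UNIV" "w \<in> words_over X" using Cons.prems by (auto simp: mem_Times_iff)
    have "dist x0 (\<phi> (cls X RR (l # w)) x0) \<le> dist x0 (\<phi> (cls X RR [l]) x0)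
        + dist (\<phi> (cls X RR [l]) x0) (\<phi> (cls X RR [l]) (\<phi> (cls X RR w) x0))"
      using actm[OF l(1,3)] by (simp add: dist_triangle)
    also have "\<dots> \<le> D + D * real (length w)" using D[OF l(2)] Cons.IH[OF l(3)] acti[OF l(1)] by simp
    finally show ?case by (simp add: algebra_simps)
  next
    case Nil
    show ?case by (simp only: act1) simp
  qed
  have pow: "\<phi> (cls X RR (gpow 0 (int n))) = \<phi> g ^^ n" for n
  proof (induction n)
    case 0
    show ?case by (rule ext) (simp only: of_nat_0 gpow_0 act1 funpow.simps id_apply)
  next
    case (Suc n)
    have "gpow 0 (int (Suc n)) = [(0, False)] @ (gpow 0 (int n) :: nat word)"
      by (simp add: gpow_def nat_add_distrib)
    then have "\<phi> (cls X RR (gpow 0 (int (Suc n)))) x = \<phi> g (\<phi> (cls X RR (gpow 0 (int n))) x)" for x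
      using actm[of "[(0, False)]" "gpow 0 (int n)"] by (simp only: g_def) simp
    then show ?case using Suc by (simp add: fun_eq_iff)
  qed
  have iso: "dist (\<phi> g x) (\<phi> g y) = dist x y" for x y using acti by (simp add: g_def)
  have small: "\<exists>x. dist x (\<phi> g x) < \<epsilon>" if "\<epsilon> > 0" for \<epsilon>
  proof (rule ccontr)
    assume "\<not> (\<exists>x. dist x (\<phi> g x) < \<epsilon>)"
    then have c: "\<epsilon> \<le> dist x (\<phi> g x)" for x by (simp add: not_less)
    define C where "C = D * (4 * real q + 6)"
    \<comment> \<open>With k = \<open>kseq d\<close>, the element x^(2qk) moves x0 by at least
      2qk\<epsilon>, but by at most a constant times the length of \<open>Zw d\<close>, which is of
      order 2^d. As 2^\<alpha> > 2, this fails for large d.\<close>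
    have upper: "(2 powr al) ^ d * \<epsilon> \<le> C * 2 ^ d" for d
    proof -
      let ?n = "2 * q * kseq d"
      have "pres_eq X RR (Zw d) (gpow 0 (int ?n))"
        by (subst pres_eq_iff_run) (simp_all add: run_Zw run_gpow_0 gp_def)
      then have eq: "cls X RR (Zw d) = cls X RR (gpow 0 (int ?n))" by (subst cls_eq_iff) simp_all
      have "real ?n * \<epsilon> \<le> dist x0 ((\<phi> g ^^ ?n) x0)" by (rule CAT0_displacement[OF cat iso c])
      also have "\<dots> = dist x0 (\<phi> (cls X RR (Zw d)) x0)" by (simp only: eq pow)
      also have "\<dots> \<le> D * real (length (Zw d))" by (rule word) simp
      also have "\<dots> \<le> D * real ((4 * q + 6) * 2 ^ d)"
      proof (intro mult_left_mono of_nat_mono)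
        show "length (Zw d) \<le> (4 * q + 6) * 2 ^ d" using length_Zw[of d] by linarith
        show "0 \<le> D" by (simp add: D_def sum_nonneg)
      qed
      also have "\<dots> = C * 2 ^ d" by (simp add: C_def)
      finally have "real ?n * \<epsilon> \<le> C * 2 ^ d" .
      moreover have "(2 powr al) ^ d * \<epsilon> \<le> real ?n * \<epsilon>"
      proof (rule mult_right_mono)
        have "1 * kseq d \<le> ?n" using q_pos by (intro mult_le_mono1) simp
        then have "real (kseq d) \<le> real ?n" by (intro of_nat_mono) simp
        then show "(2 powr al) ^ d \<le> real ?n" using kseq_ge[of d] by linarith
      qed (use that in simp)
      ultimately show ?thesis by simp
    qed
    define \<beta> where "\<beta> = 2 powr (al - 1)"
    have \<beta>: "1 < \<beta>" using al_gt_1 by (simp add: \<beta>_def)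
    have "2 powr al = 2 * \<beta>" by (simp add: \<beta>_def powr_diff)
    then have "\<beta> ^ d * \<epsilon> \<le> C" for d
      using upper[of d] by (simp add: power_mult_distrib mult.assoc mult.left_commute)
    then have "\<beta> ^ d \<le> C / \<epsilon>" for d using that by (simp add: field_simps)
    moreover obtain d where "C / \<epsilon> < \<beta> ^ d" using real_arch_pow[OF \<beta>] by blast
    ultimately show False using not_less by blast
  qed
  obtain n :: nat where n: "n > 0" "g [^]\<^bsub>presented_group X RR\<^esub> n = \<one>\<^bsub>presented_group X RR\<^esub>"
    using almost_fixed_imp_torsion[OF group_presented act[unfolded G] proper[unfolded G] coc[unfolded G] gc small] by blast
  have "g [^]\<^bsub>presented_group X RR\<^esub> n = cls X RR (gpow 0 (int n))"
    using wpow_presented[of "[(0, False)]" X RR "int n"]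
    by (simp add: g_def gpow_eq_wpow int_pow_int)
  then have "pres_eq X RR (gpow 0 (int n)) []" using n(2) by (simp add: one_presented cls_eq_iff)
  then have "run start (gpow 0 (int n)) = run start []" by (rule run_pres_eq) simp
  then show False using n(1) by (simp add: run_gpow_0 shift_def)
qed

section \<open>The one-relator presentation\<close>

context rpq
begin

text \<open>The second relator solved for y, for the Tietze transformation that eliminates this
  generator; \<open>orel\<close> is then the first relator with y substituted.\<close>

definition yword :: "nat word" where
  "yword = gpow 0 (- (2 * int p - 1)) @ [(2, True)] @ gpow 0 (2 * int q) @ [(2, False)]"

definition orel :: "nat word" where
  "orel = gpow 0 2 @ inv_word yword @ inv_word yword"

definition subst_y :: "nat letter \<Rightarrow> nat word" where
  "subst_y l = (if fst l = 1 then (if snd l then inv_word yword else yword) else [l])"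

abbreviation "Y \<equiv> {0, 2 :: nat}"

lemma yword_words_over [simp]: "yword \<in> words_over Y" "yword \<in> words_over {0, Suc 0, 2}"
  by (simp_all add: yword_def)

lemma words_over_Y: "w \<in> words_over Y \<Longrightarrow> w \<in> words_over {0, Suc 0, 2}"
  by (auto simp: words_over_def)

lemma concat_map_single: "concat (map (\<lambda>l. [l]) w) = w"
  by (induction w) auto

lemma subst_y_id: "w \<in> words_over Y \<Longrightarrow> concat (map subst_y w) = w"
  by (induction w) (auto simp: subst_y_def)

lemma subst_y_gpow_0: "concat (map subst_y (gpow 0 k)) = gpow 0 k"
  by (rule subst_y_id) simp

lemma eq_yword: "pres_eq X RR yword [(1, False)]"
proof -
  have "pres_eq X RR ([(2, True)] @ gpow 0 (2 * int q) @ [(2, False)]) cword"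
    using eqc_imp_pres_eq[OF eqx_edge[of 1] RR_words_over] by simp
  from pres_eq_append[OF pres_eq_refl this, of "gpow 0 (- (2 * int p - 1))"]
  have "pres_eq X RR yword ((gpow 0 (- (2 * int p - 1)) @ gpow 0 (2 * int p - 1)) @ [(1, False)])"
    by (simp add: yword_def cword_def)
  also have "pres_eq X RR \<dots> (gpow 0 (- (2 * int p - 1) + (2 * int p - 1)) @ [(1, False)])"
    by (rule pres_eq_append[OF gpow_add pres_eq_refl]) simp
  finally show ?thesis by simp
qed

lemma eq_orel: "pres_eq X RR orel []"
proof -
  have "pres_eq X RR (inv_word yword) [(1, True)]"
    using pres_eq_inv_word[OF eq_yword] by simp
  then have "pres_eq X RR orel (gpow 0 2 @ [(1, True)] @ [(1, True)])"
    unfolding orel_def by (intro pres_eq_append pres_eq_refl)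
  also have "gpow 0 2 @ [(1, True)] @ [(1, True)] = vrel"
    by (simp add: vrel_eq gpow_def numeral_2_eq_2)
  also have "pres_eq X RR vrel []" by (rule pres_eq_relator) (simp add: RR_eq)
  finally show ?thesis .
qed

lemma Y_imp_X:
  assumes "pres_eq Y {orel} u v"
  shows "pres_eq X RR u v"
proof -
  have "pres_eq X RR (concat (map (\<lambda>l. [l]) u)) (concat (map (\<lambda>l. [l]) v))"
  proof (rule pres_eq_substitute[OF _ _ assms])
    fix g :: nat and b assume "g \<in> Y"
    then show "pres_eq X RR ([(g, b)] @ [(g, \<not> b)]) []"
      using pres_eq_cancel_pair[of g X RR b] by auto
  qed (use eq_orel concat_map_single in simp)
  then show ?thesis by (simp only: concat_map_single)
qed

text \<open>Under the substitution the first relator becomes \<open>orel\<close> literally, and the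
  second becomes freely trivial.\<close>

lemma X_imp_Y:
  assumes "pres_eq X RR u v"
  shows "pres_eq Y {orel} (concat (map subst_y u)) (concat (map subst_y v))"
proof (rule pres_eq_substitute[OF _ _ assms])
  fix g :: nat and b assume "g \<in> X"
  then show "pres_eq Y {orel} (subst_y (g, b) @ subst_y (g, \<not> b)) []"
    using pres_eq_inv_left[of yword Y] pres_eq_inv_right[of yword Y] pres_eq_cancel_pair[of g Y _ b]
    by (auto simp: subst_y_def)
next
  fix r assume "r \<in> RR"
  then consider "r = vrel" | "r = trel" by (auto simp: RR_eq)
  then show "pres_eq Y {orel} (concat (map subst_y r)) []"
  proof cases
    case 1
    have "concat (map subst_y vrel) = orel"
      by (simp add: vrel_eq subst_y_def orel_def gpow_def numeral_2_eq_2)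
    then show ?thesis using 1 pres_eq_relator[of orel "{orel}" Y] by simp
  next
    case 2
    let ?b = "[(2, True)] @ gpow 0 (2 * int q) @ [(2, False)] :: nat word"
    let ?g = "gpow 0 (- (2 * int p - 1)) :: nat word"
    have "concat (map subst_y trel) = ?b @ inv_word (?g @ ?b) @ ?g"
    proof -
      have ig: "inv_word (gpow 0 (2 * int p - 1)) = ?g" by (simp add: inv_gpow)
      have "trel = ?b @ [(1, True)] @ ?g" unfolding trel_def cword_def inv_word_append ig by simp
      then show ?thesis
        by (simp only: map_append concat_append subst_y_gpow_0) (simp add: subst_y_def yword_def subst_y_gpow_0)
    qed
    then have e: "concat (map subst_y trel) = (?b @ inv_word ?b) @ (inv_word ?g @ ?g)" by simp
    have "pres_eq Y {orel} ((?b @ inv_word ?b) @ (inv_word ?g @ ?g)) ([] @ [])"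
      by (intro pres_eq_append pres_eq_inv_left pres_eq_inv_right) simp_all
    then show ?thesis using 2 e by simp
  qed
qed

lemma eq_subst_y: "pres_eq X RR w (concat (map subst_y w))"
proof (induction w)
  case (Cons l w)
  have "pres_eq X RR [l] (subst_y l)"
  proof (cases "fst l = 1")
    case True
    have "pres_eq X RR (inv_word yword) [(1, True)]"
      using pres_eq_inv_word[OF eq_yword] by simp
    then show ?thesis using True pres_eq_sym eq_yword by (cases l) (auto simp: subst_y_def)
  qed (simp add: subst_y_def)
  from pres_eq_append[OF this Cons] show ?case by simp
qed simp

lemma subst_y_words_over: "w \<in> words_over X \<Longrightarrow> concat (map subst_y w) \<in> words_over Y"
  by (induction w) (auto simp: subst_y_def)

theorem one_relator: "one_relator_group (Rpq p q)"
proof -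
  let ?G = "presented_group Y {orel}" and ?H = "presented_group X RR"
  define f where "f A = {v \<in> words_over X. \<exists>a\<in>A. pres_eq X RR v a}" for A
  have f: "f (cls Y {orel} w) = cls X RR w" if "w \<in> words_over Y" for w
  proof
    show "f (cls Y {orel} w) \<subseteq> cls X RR w"
      using Y_imp_X pres_eq_trans unfolding f_def cls_def by blast
    show "cls X RR w \<subseteq> f (cls Y {orel} w)"
      using that unfolding f_def cls_def by blast
  qed
  have iff: "pres_eq Y {orel} u v \<longleftrightarrow> pres_eq X RR u v" if "u \<in> words_over Y" "v \<in> words_over Y" for u v
    using Y_imp_X X_imp_Y[of u v] subst_y_id that by auto
  have "f \<in> iso ?G ?H"
  proof (rule isoI)
    show "f \<in> hom ?G ?H"
      by (rule homI) (auto simp: carrier_presented f mult_presented words_over_Y)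
    show "bij_betw f (carrier ?G) (carrier ?H)"
    proof (rule bij_betw_imageI)
      show "inj_on f (carrier ?G)"
      proof (rule inj_onI)
        fix a b assume "a \<in> carrier ?G" "b \<in> carrier ?G" and eq: "f a = f b"
        then obtain u v where uv: "u \<in> words_over Y" "v \<in> words_over Y"
          "a = cls Y {orel} u" "b = cls Y {orel} v" by (auto simp: carrier_presented)
        then have "pres_eq X RR u v" using eq by (simp add: f cls_eq_iff words_over_Y)
        then show "a = b" using uv by (simp add: cls_eq_iff iff)
      qed
      have "cls X RR w \<in> f ` carrier ?G" if "w \<in> words_over X" for w
      proof -
        have "cls X RR w = f (cls Y {orel} (concat (map subst_y w)))"
          using that eq_subst_y f[OF subst_y_words_over[OF that]] by (simp add: cls_eq_iff)
        then show ?thesis using subst_y_words_over[OF that] by (auto simp: carrier_presented)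
      qed
      then show "f ` carrier ?G = carrier ?H"
        by (auto simp: carrier_presented f words_over_Y)
    qed
  qed
  then have "?G \<cong> Rpq p q" by (auto simp: is_iso_def Rpq_def)
  moreover have "orel \<in> words_over Y" by (simp add: orel_def)
  ultimately show ?thesis unfolding one_relator_group_def by (intro exI[of _ Y] exI[of _ orel]) simp
qed

end

theorem mainTheorem1:
  fixes p q :: nat
  assumes "0 < q" and "q < p"
  shows "one_relator_group (Rpq p q)
    \<and> dehn_simeq (\<lambda>n. real (dehn_function {0, 1, 2} (Rpq_rels p q) n))
                 (\<lambda>n. real n powr (2 * log 2 (2 * real p / real q)))
    \<and> (\<forall>m n :: int. m \<noteq> 0 \<and> n \<noteq> 0 \<and> m \<noteq> n \<and> m \<noteq> - n \<longrightarrow>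
          \<not> (\<exists>H. subgroup H (Rpq p q) \<and> BS_group m n \<cong> (Rpq p q)\<lparr>carrier := H\<rparr>))
    \<and> \<not> automatic_group (Rpq p q)
    \<and> (\<forall>\<phi> :: nat word set \<Rightarrow> 'a::metric_space \<Rightarrow> 'a.
          \<not> (CAT0_space TYPE('a) \<and> isometric_action (Rpq p q) \<phi> \<and>
             proper_action (Rpq p q) \<phi> \<and> cocompact_action (Rpq p q) \<phi>))"
proof -
  interpret rpq p q using assms by unfold_locales
  have "dehn_simeq (\<lambda>n. real (dehn_function {0, 1, 2} (Rpq_rels p q) n))
      (\<lambda>n. real n powr (2 * log 2 (2 * real p / real q)))"
    using dehn_simeq_powr by (simp only: al_def)
  moreover have "\<not> (\<exists>H. subgroup H (Rpq p q) \<and> BS_group m n \<cong> (Rpq p q)\<lparr>carrier := H\<rparr>)"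
    if "m \<noteq> 0 \<and> n \<noteq> 0 \<and> m \<noteq> n \<and> m \<noteq> - n" for m n :: int
    by (rule no_BS_subgroup) (use that in \<open>auto simp: abs_if split: if_splits\<close>)
  moreover have "\<not> (CAT0_space TYPE('a) \<and> isometric_action (Rpq p q) \<phi> \<and>
      proper_action (Rpq p q) \<phi> \<and> cocompact_action (Rpq p q) \<phi>)"
    for \<phi> :: "nat word set \<Rightarrow> 'a \<Rightarrow> 'a"
    using not_CAT0[of \<phi>] by blast
  ultimately show ?thesis using one_relator not_automatic by blast
qed

end
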